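(* Let $(\Xi^n)_{n\ge 0}$ be generated by an edge iterated graph system satisfying the standing assumptions (canonical, distance-positive, degree-primitive, single-edge initial graph), and assume $\dim_{\mathrm R}(\Xi)>0$ (equivalently $\rho(\Psi)>1$). Then the $L^2(\Xi_{\mathrm M},\mu_{\Xi_{\mathrm M}})$-realisation of the resistance form $(\mathcal E_R,\mathcal F_R)$ coincides with the Dirichlet form $(\mathcal E_W,\mathcal F_W)$. Consequently, the diffusion $W$ is the Brownian motion associated with the resistance form $(\mathcal E_R,\mathcal F_R)$.
   Context: **EIGS.** Fix $K\ge1$ colours $[K]=\{1,\dots,K\}$. An edge iterated graph system (EIGS) consists of finite directed rule graphs $R_1,\dots,R_K$ whose edges are coloured by a map $\mathscr C$ with values in $[K]$, each $R_i$ having two distinct planting vertices $\beta_i^+\ne\beta_i^-$, and an initial graph $\Xi^0$, which is a single directed edge of some colour with endpoints $\mathfrak v_+,\mathfrak v_-$. Given $\Xi^n$, the graph $\Xi^{n+1}$ is obtained by simultaneously replacing every directed edge $e=(a,b)$ of colour $i$ by a fresh copy of $R_i$, identifying $a\equiv\beta_i^+$, $b\equiv\beta_i^-$, with no other identifications. Thus $V(\Xi^n)\subset V(\Xi^{n+1})$. Distances, degrees, paths and resistances refer to underlying undirected graphs, which are assumed simple and connected. **Matrices.** $\mathbf N\in\mathbb N^{2K\times2K}$ has rows $\kappa_{R_1}(\beta_1^+),\kappa_{R_1}(\beta_1^-),\dots,\kappa_{R_K}(\beta_K^+),\kappa_{R_K}(\beta_K^-)$, where $[\kappa_G(v)]_{2j-1}$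 (resp. $[\kappa_G(v)]_{2j}$) is the number of $j$-coloured edges of $G$ leaving (resp. entering) $v$. $\mathcal D$ is the finite set of $K\times K$ matrices obtained by choosing, for each $i$, a simple path in $R_i$ between $\beta_i^+$ and $\beta_i^-$ and letting the $(i,j)$ entry be the number of $j$-coloured edges on the chosen path. $\rho(\cdot)$ is the spectral radius and $\rho_{\min}(\mathcal D)=\min_{D\in\mathcal D}\rho(D)$. **Resistance map.** For $\mathbf x\in(0,\infty)^K$, $[\Psi(\mathbf x)]_i$ is the effective resistance between $\beta_i^+$ and $\beta_i^-$ in $R_i$ when each $j$-coloured edge has resistance $[\mathbf x]_j$. There are a unique $\rho(\Psi)>0$ and a unique (up to scaling) $\mathbf v\in(0,\infty)^K$ with $\Psi(\mathbf v)=\rho(\Psi)\mathbf v$; fix such a $\mathbf v$. The resistance dimension is $\dim_{\mathrm R}(\Xi)=\frac{\log\rho(\Psi)}{\log\rho_{\min}(\mathcal D)}$. **Standing assumptions.** (1) Canonical: every edge of every $R_i$ lies on a simple path joining $\beta_i^+$ and $\beta_i^-$. (2) Distance-positive: all matrices in $\mathcal D$ have positive entries; if $K=1$, additionally $d_{R_1}(\beta_1^+,\beta_1^-)\ge2$. (3) $\mathbf N$ is primitive. (4) $\Xi^0$ is a single edge. **Limit space.** $\hat d_{\Xi^n}=d_{\Xi^n}/\mathrm{diam}(\Xi^n)$. Let $\mathscr V=\bigcup_nV(\Xi^n)$, with metric $d_{\Xi_{\mathrm M}}(u,w)=\lim_n\hat d_{\Xi^n}(u,w)$; its completion $(\Xi_{\mathrm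 M},d_{\Xi_{\mathrm M}})$ is compact and is the Gromov--Hausdorff limit of $(V(\Xi^n),\hat d_{\Xi^n})$. $\mu_{\Xi_{\mathrm M}}$ is the weak limit of the uniform probability measures on $V(\Xi^n)\subset\Xi_{\mathrm M}$. **The form $(\mathcal E_W,\mathcal F_W)$ and $W$.** For $f:V(\Xi^n)\to\mathbb R$ let $\mathcal E_n^W(f,f)=\sum_{\{u,w\}\in E(\Xi^n)}c_n(\{u,w\})(f(u)-f(w))^2$ with $c_n(e)=\rho(\Psi)^n/[\mathbf v]_{\mathscr C(e)}$. One has $\mathcal E_n^W(f,f)=\min\{\mathcal E_{n+1}^W(g,g):g|_{V(\Xi^n)}=f\}$. For $h:V(\Xi^m)\to\mathbb R$ there is a unique continuous function $P_mh$ on $\Xi_{\mathrm M}$ (a harmonic spline) whose restriction to each $V(\Xi^n)$, $n\ge m$, minimises $\mathcal E_n^W$ among extensions of $h$. Setting $\mathcal E(P_mh,P_mh)=\mathcal E_m^W(h,h)$ defines a closable form on the space of harmonic splines in $L^2(\Xi_{\mathrm M},\mu_{\Xi_{\mathrm M}})$; its closure $(\mathcal E_W,\mathcal F_W)$ is a conservative regular Dirichlet form, and $W$ is the associated Hunt process. **The resistance form.** When $\rho(\Psi)>1$, let $\mathcal F_{\mathscr V}=\{f:\mathscr V\to\mathbb R:\sup_m\mathcal E_m^W(f|_{V(\Xi^m)},f|_{V(\Xi^m)})<\infty\}$ and $\mathcal E_{\mathscr V}(f,f)=\lim_m\mathcal E_m^W(f|_{V(\Xi^m)},f|_{V(\Xi^m)})$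 (a non-decreasing limit). This is a resistance form (in Kigami's sense) on $\mathscr V$; each $f\in\mathcal F_{\mathscr V}$ extends uniquely to a continuous function on $\Xi_{\mathrm M}$, and $(\mathcal E_R,\mathcal F_R)$ is the resulting resistance form on $\Xi_{\mathrm M}$, i.e. $\mathcal F_R=\{u\in C(\Xi_{\mathrm M}):u|_{\mathscr V}\in\mathcal F_{\mathscr V}\}$, $\mathcal E_R(u,u)=\mathcal E_{\mathscr V}(u|_{\mathscr V},u|_{\mathscr V})$. Its $L^2$-realisation is the form $\mathcal E_R$ with domain $\mathcal F_R$ viewed in $L^2(\Xi_{\mathrm M},\mu_{\Xi_{\mathrm M}})$. The Brownian motion associated with the resistance form is the symmetric Hunt process of this Dirichlet form. *)

theory Defs
  imports
    "HOL-Probability.Probability"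
    "HOL-Probability.Stopping_Time"
    "Jordan_Normal_Form.Spectral_Radius"
    "Graph_Theory.Digraph_Component_Vwalk"
begin

section \<open>Underlying undirected graphs\<close>

abbreviation undir :: "('v, 'e) pre_digraph \<Rightarrow> ('v, 'v \<times> 'v) pre_digraph" where
  "undir G \<equiv> with_proj (mk_symmetric G)"

text \<open>Simplicity of the underlying undirected graph also forbids antiparallel arcs.\<close>

definition simple_underlying :: "('v, 'e) pre_digraph \<Rightarrow> bool" where
  "simple_underlying G \<longleftrightarrow> loopfree_digraph G \<and>
     (\<forall>e\<in>arcs G. \<forall>e'\<in>arcs G. {tail G e, head G e} = {tail G e', head G e'} \<longrightarrow> e = e')"

definition gdist :: "('v, 'e) pre_digraph \<Rightarrow> 'v \<Rightarrow> 'v \<Rightarrow> nat" where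
  "gdist G u w = (LEAST l. \<exists>p. vwalk p (undir G) \<and> hd p = u \<and> last p = w \<and> vwalk_length p = l)"

definition gdiam :: "('v, 'e) pre_digraph \<Rightarrow> nat" where
  "gdiam G = Max ((\<lambda>(u, w). gdist G u w) ` (verts G \<times> verts G))"

definition simple_paths :: "('v, 'e) pre_digraph \<Rightarrow> 'v \<Rightarrow> 'v \<Rightarrow> 'v list set" where
  "simple_paths G a b = {p. vpath p (undir G) \<and> hd p = a \<and> last p = b}"

definition arcs_on :: "('v, 'e) pre_digraph \<Rightarrow> 'v list \<Rightarrow> 'e set" where
  "arcs_on G p = {e \<in> arcs G. (tail G e, head G e) \<in> set (vwalk_arcs p) \<or>
                              (head G e, tail G e) \<in> set (vwalk_arcs p)}"

text \<open>Effective resistance between two vertices, by the Dirichlet principle: its reciprocal is the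
  least energy of a potential with boundary values 1 and 0.  The edge \<open>e\<close> has resistance \<open>r e\<close>.\<close>

definition eff_resistance :: "('v, 'e) pre_digraph \<Rightarrow> ('e \<Rightarrow> real) \<Rightarrow> 'v \<Rightarrow> 'v \<Rightarrow> real" where
  "eff_resistance G r a b =
     1 / (INF f\<in>{f. f a = 1 \<and> f b = 0}. \<Sum>e\<in>arcs G. (f (tail G e) - f (head G e))\<^sup>2 / r e)"


section \<open>Edge iterated graph systems\<close>

text \<open>Colours are \<open>0, \<dots>, K - 1\<close> with \<open>K = ncolours S\<close>.  The colour of an arc \<open>e\<close> of the \<open>i\<close>-th rule
  graph is \<open>arc_colour S i e\<close>, so rule graphs may share arc names.  The initial graph, being a single
  directed edge, is determined by its colour.\<close>

record ('v, 'e) eigs =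
  ncolours :: nat
  rule :: "nat \<Rightarrow> ('v, 'e) pre_digraph"
  arc_colour :: "nat \<Rightarrow> 'e \<Rightarrow> nat"
  beta_plus :: "nat \<Rightarrow> 'v"
  beta_minus :: "nat \<Rightarrow> 'v"
  init_colour :: nat

definition is_eigs :: "('v, 'e) eigs \<Rightarrow> bool" where
  "is_eigs S \<longleftrightarrow> 1 \<le> ncolours S \<and> init_colour S < ncolours S \<and>
     (\<forall>i<ncolours S.
        fin_digraph (rule S i) \<and> simple_underlying (rule S i) \<and>
        Digraph_Component.connected (rule S i) \<and>
        (\<forall>e\<in>arcs (rule S i). arc_colour S i e < ncolours S) \<and>
        beta_plus S i \<in> verts (rule S i) \<and> beta_minus S i \<in> verts (rule S i) \<and>
        beta_plus S i \<noteq> beta_minus S i)"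

text \<open>An edge of the \<open>n\<close>-th graph is addressed by a word of \<open>n\<close> rule-graph arcs, most recent
  substitution first: \<open>e # w\<close> is the copy of the arc \<open>e\<close> in the rule graph planted at the edge \<open>w\<close>,
  and the empty word is the initial edge.  A vertex is either an endpoint of the initial edge or
  \<open>Inner w x\<close>, the copy of the non-planting vertex \<open>x\<close> created when \<open>w\<close> is replaced.  The length
  of \<open>w\<close> records the generation, so copies are fresh and the vertex sets increase.\<close>

datatype ('v, 'e) xvertex = Root_plus | Root_minus | Inner "'e list" 'v

primrec word_colour :: "('v, 'e) eigs \<Rightarrow> 'e list \<Rightarrow> nat" where
  "word_colour S [] = init_colour S"
| "word_colour S (e # w) = arc_colour S (word_colour S w) e"

definition plant :: "('v, 'e) eigs \<Rightarrow> 'e list \<Rightarrow> ('v, 'e) xvertex \<times> ('v, 'e) xvertex \<Rightarrow> 'v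
    \<Rightarrow> ('v, 'e) xvertex" where
  "plant S w ab x =
     (if x = beta_plus S (word_colour S w) then fst ab
      else if x = beta_minus S (word_colour S w) then snd ab
      else Inner w x)"

primrec word_ends :: "('v, 'e) eigs \<Rightarrow> 'e list \<Rightarrow> ('v, 'e) xvertex \<times> ('v, 'e) xvertex" where
  "word_ends S [] = (Root_plus, Root_minus)"
| "word_ends S (e # w) =
     (plant S w (word_ends S w) (tail (rule S (word_colour S w)) e),
      plant S w (word_ends S w) (head (rule S (word_colour S w)) e))"

primrec xi_arcs :: "('v, 'e) eigs \<Rightarrow> nat \<Rightarrow> 'e list set" where
  "xi_arcs S 0 = {[]}"
| "xi_arcs S (Suc n) = {e # w | e w. w \<in> xi_arcs S n \<and> e \<in> arcs (rule S (word_colour S w))}"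

primrec xi_verts :: "('v, 'e) eigs \<Rightarrow> nat \<Rightarrow> ('v, 'e) xvertex set" where
  "xi_verts S 0 = {Root_plus, Root_minus}"
| "xi_verts S (Suc n) = xi_verts S n \<union>
     {Inner w x | w x. w \<in> xi_arcs S n \<and> x \<in> verts (rule S (word_colour S w))
        - {beta_plus S (word_colour S w), beta_minus S (word_colour S w)}}"

definition Xi :: "('v, 'e) eigs \<Rightarrow> nat \<Rightarrow> (('v, 'e) xvertex, 'e list) pre_digraph" where
  "Xi S n = \<lparr> verts = xi_verts S n, arcs = xi_arcs S n,
              tail = (\<lambda>w. fst (word_ends S w)), head = (\<lambda>w. snd (word_ends S w)) \<rparr>"

definition all_verts :: "('v, 'e) eigs \<Rightarrow> ('v, 'e) xvertex set" where
  "all_verts S = (\<Union>n. verts (Xi S n))"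


section \<open>Matrices and standing assumptions\<close>

text \<open>Row \<open>2 * i\<close> belongs to \<open>beta_plus\<close> and row \<open>2 * i + 1\<close> to \<open>beta_minus\<close> of the \<open>i\<close>-th rule;
  column \<open>2 * j\<close> counts leaving and column \<open>2 * j + 1\<close> entering arcs of colour \<open>j\<close>.\<close>

definition degree_matrix :: "('v, 'e) eigs \<Rightarrow> nat mat" where
  "degree_matrix S = mat (2 * ncolours S) (2 * ncolours S) (\<lambda>(r, s).
     let i = r div 2; j = s div 2;
         b = (if even r then beta_plus S i else beta_minus S i);
         A = (if even s then out_arcs (rule S i) b else in_arcs (rule S i) b)
     in card {e \<in> A. arc_colour S i e = j})"

definition primitive_mat :: "nat mat \<Rightarrow> bool" where
  "primitive_mat A \<longleftrightarrow>
     (\<exists>k>0. \<forall>i<dim_row A. \<forall>j<dim_col A. 0 < (A ^\<^sub>m k) $$ (i, j))"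

definition planting_paths :: "('v, 'e) eigs \<Rightarrow> nat \<Rightarrow> 'v list set" where
  "planting_paths S i = simple_paths (rule S i) (beta_plus S i) (beta_minus S i)"

definition distance_matrices :: "('v, 'e) eigs \<Rightarrow> nat mat set" where
  "distance_matrices S =
     {mat (ncolours S) (ncolours S)
        (\<lambda>(i, j). card {e \<in> arcs_on (rule S i) (p i). arc_colour S i e = j}) | p.
      \<forall>i<ncolours S. p i \<in> planting_paths S i}"

definition rho_min :: "nat mat set \<Rightarrow> real" where
  "rho_min Ds = Min ((\<lambda>D. spectral_radius (map_mat of_nat D)) ` Ds)"

definition canonical :: "('v, 'e) eigs \<Rightarrow> bool" where
  "canonical S \<longleftrightarrow> (\<forall>i<ncolours S. \<forall>e\<in>arcs (rule S i).
     \<exists>p\<in>planting_paths S i. e \<in> arcs_on (rule S i) p)"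

definition distance_positive :: "('v, 'e) eigs \<Rightarrow> bool" where
  "distance_positive S \<longleftrightarrow>
     (\<forall>D\<in>distance_matrices S. \<forall>i<ncolours S. \<forall>j<ncolours S. 0 < D $$ (i, j)) \<and>
     (ncolours S = 1 \<longrightarrow> 2 \<le> gdist (rule S 0) (beta_plus S 0) (beta_minus S 0))"

definition degree_primitive :: "('v, 'e) eigs \<Rightarrow> bool" where
  "degree_primitive S \<longleftrightarrow> primitive_mat (degree_matrix S)"


section \<open>Resistance map and resistance dimension\<close>

text \<open>Vectors indexed by the colours are functions on \<open>nat\<close> of which only the values below
  \<open>ncolours S\<close> matter.\<close>

definition Psi :: "('v, 'e) eigs \<Rightarrow> (nat \<Rightarrow> real) \<Rightarrow> nat \<Rightarrow> real" where
  "Psi S x i = eff_resistance (rule S i) (\<lambda>e. x (arc_colour S i e)) (beta_plus S i) (beta_minus S i)"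

definition Psi_eigenpair :: "('v, 'e) eigs \<Rightarrow> real \<Rightarrow> (nat \<Rightarrow> real) \<Rightarrow> bool" where
  "Psi_eigenpair S r x \<longleftrightarrow>
     0 < r \<and> (\<forall>i<ncolours S. 0 < x i) \<and> (\<forall>i<ncolours S. Psi S x i = r * x i)"

definition rho_Psi :: "('v, 'e) eigs \<Rightarrow> real" where
  "rho_Psi S = (THE r. \<exists>x. Psi_eigenpair S r x)"

definition dim_R :: "('v, 'e) eigs \<Rightarrow> real" where
  "dim_R S = ln (rho_Psi S) / ln (rho_min (distance_matrices S))"


section \<open>Limit space and limit measure\<close>

definition normalised_dist :: "('v, 'e) eigs \<Rightarrow> nat \<Rightarrow> ('v, 'e) xvertex \<Rightarrow> ('v, 'e) xvertex \<Rightarrow> real" where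
  "normalised_dist S n u w = real (gdist (Xi S n) u w) / real (gdiam (Xi S n))"

text \<open>The complete metric space \<open>'x\<close>, together with \<open>\<iota>\<close>, is a completion of the set of all vertices
  with the limit metric.\<close>

definition is_limit_space :: "('v, 'e) eigs \<Rightarrow> (('v, 'e) xvertex \<Rightarrow> 'x::complete_space) \<Rightarrow> bool" where
  "is_limit_space S \<iota> \<longleftrightarrow>
     (\<forall>u\<in>all_verts S. \<forall>w\<in>all_verts S. (\<lambda>n. normalised_dist S n u w) \<longlonglongrightarrow> dist (\<iota> u) (\<iota> w)) \<and>
     closure (\<iota> ` all_verts S) = UNIV"

text \<open>Weak convergence of the uniform probability measures on the vertex sets.\<close>

definition is_limit_measure ::
    "('v, 'e) eigs \<Rightarrow> (('v, 'e) xvertex \<Rightarrow> 'x::complete_space) \<Rightarrow> 'x measure \<Rightarrow> bool" where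
  "is_limit_measure S \<iota> \<mu> \<longleftrightarrow> prob_space \<mu> \<and> sets \<mu> = sets borel \<and>
     (\<forall>f::'x \<Rightarrow> real. continuous_on UNIV f \<longrightarrow> bounded (range f) \<longrightarrow>
        (\<lambda>n. (\<Sum>x\<in>verts (Xi S n). f (\<iota> x)) / real (card (verts (Xi S n))))
          \<longlonglongrightarrow> (LINT x|\<mu>. f x))"


section \<open>Quadratic forms\<close>

text \<open>A symmetric form is given by its domain and its diagonal values, which determine it by
  polarisation.  Forms on \<open>L\<^sup>2\<close> have domains consisting of square integrable functions rather than
  classes; all form domains and form values on \<open>L\<^sup>2\<close> below are invariant under almost everywhere
  equality.\<close>

type_synonym 'x qform = "('x \<Rightarrow> real) set \<times> (('x \<Rightarrow> real) \<Rightarrow> real)"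

definition forms_coincide :: "'x qform \<Rightarrow> 'x qform \<Rightarrow> bool" where
  "forms_coincide q q' \<longleftrightarrow> fst q = fst q' \<and> (\<forall>u\<in>fst q. snd q u = snd q' u)"

definition L2 :: "'x measure \<Rightarrow> ('x \<Rightarrow> real) set" where
  "L2 \<mu> = {u \<in> borel_measurable \<mu>. integrable \<mu> (\<lambda>x. (u x)\<^sup>2)}"

definition closure_approx :: "'x measure \<Rightarrow> 'x qform \<Rightarrow> (nat \<Rightarrow> 'x \<Rightarrow> real) \<Rightarrow> ('x \<Rightarrow> real) \<Rightarrow> bool" where
  "closure_approx \<mu> q F u \<longleftrightarrow>
     (\<forall>k. F k \<in> fst q \<inter> L2 \<mu>) \<and>
     (\<forall>\<epsilon>>0. \<exists>N. \<forall>k\<ge>N. \<forall>l\<ge>N. snd q (\<lambda>x. F k x - F l x) < \<epsilon>) \<and>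
     (\<lambda>k. LINT x|\<mu>. (F k x - u x)\<^sup>2) \<longlonglongrightarrow> 0"

text \<open>The closure of a closable form.\<close>

definition form_closure :: "'x measure \<Rightarrow> 'x qform \<Rightarrow> 'x qform" where
  "form_closure \<mu> q =
     ({u \<in> L2 \<mu>. \<exists>F. closure_approx \<mu> q F u},
      \<lambda>u. THE e. \<exists>F. closure_approx \<mu> q F u \<and> (\<lambda>k. snd q (F k)) \<longlonglongrightarrow> e)"

definition L2_realisation :: "'x measure \<Rightarrow> 'x qform \<Rightarrow> 'x qform" where
  "L2_realisation \<mu> q =
     ({f \<in> L2 \<mu>. \<exists>u\<in>fst q. AE x in \<mu>. f x = u x},
      \<lambda>f. THE e. \<exists>u\<in>fst q. (AE x in \<mu>. f x = u x) \<and> e = snd q u)"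


section \<open>The two forms\<close>

text \<open>Throughout, \<open>v\<close> is a positive eigenvector of the resistance map.  The sum over arcs is a sum
  over undirected edges since the underlying graphs are simple.\<close>

definition energy :: "('v, 'e) eigs \<Rightarrow> (nat \<Rightarrow> real) \<Rightarrow> nat \<Rightarrow> (('v, 'e) xvertex \<Rightarrow> real) \<Rightarrow> real" where
  "energy S v n f =
     (\<Sum>w\<in>arcs (Xi S n). rho_Psi S ^ n / v (word_colour S w) *
        (f (tail (Xi S n) w) - f (head (Xi S n) w))\<^sup>2)"

definition is_harmonic_spline ::
    "('v, 'e) eigs \<Rightarrow> (nat \<Rightarrow> real) \<Rightarrow> (('v, 'e) xvertex \<Rightarrow> 'x::complete_space) \<Rightarrow> nat
      \<Rightarrow> (('v, 'e) xvertex \<Rightarrow> real) \<Rightarrow> ('x \<Rightarrow> real) \<Rightarrow> bool" where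
  "is_harmonic_spline S v \<iota> m h P \<longleftrightarrow>
     continuous_on UNIV P \<and> (\<forall>x\<in>verts (Xi S m). P (\<iota> x) = h x) \<and>
     (\<forall>n\<ge>m. \<forall>g. (\<forall>x\<in>verts (Xi S m). g x = h x) \<longrightarrow> energy S v n (P \<circ> \<iota>) \<le> energy S v n g)"

definition spline_form ::
    "('v, 'e) eigs \<Rightarrow> (nat \<Rightarrow> real) \<Rightarrow> (('v, 'e) xvertex \<Rightarrow> 'x::complete_space) \<Rightarrow> 'x qform" where
  "spline_form S v \<iota> =
     ({P. \<exists>m h. is_harmonic_spline S v \<iota> m h P},
      \<lambda>P. THE e. \<exists>m h. is_harmonic_spline S v \<iota> m h P \<and> e = energy S v m h)"

definition W_form ::
    "('v, 'e) eigs \<Rightarrow> (nat \<Rightarrow> real) \<Rightarrow> (('v, 'e) xvertex \<Rightarrow> 'x::complete_space) \<Rightarrow> 'x measure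
      \<Rightarrow> 'x qform" where
  "W_form S v \<iota> \<mu> = form_closure \<mu> (spline_form S v \<iota>)"

definition vertex_form :: "('v, 'e) eigs \<Rightarrow> (nat \<Rightarrow> real) \<Rightarrow> ('v, 'e) xvertex qform" where
  "vertex_form S v =
     ({f. bdd_above (range (\<lambda>m. energy S v m f))}, \<lambda>f. lim (\<lambda>m. energy S v m f))"

definition R_form ::
    "('v, 'e) eigs \<Rightarrow> (nat \<Rightarrow> real) \<Rightarrow> (('v, 'e) xvertex \<Rightarrow> 'x::complete_space) \<Rightarrow> 'x qform" where
  "R_form S v \<iota> =
     ({u. continuous_on UNIV u \<and> u \<circ> \<iota> \<in> fst (vertex_form S v)},
      \<lambda>u. snd (vertex_form S v) (u \<circ> \<iota>))"


section \<open>Hunt processes\<close>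

text \<open>The state space is a compact space \<open>'x\<close> with an isolated cemetery point \<open>None\<close>.\<close>

definition cemetery_borel :: "'x::topological_space option measure" where
  "cemetery_borel = sigma UNIV {A. Some -` A \<in> sets borel}"

definition cemetery_tendsto ::
    "('a \<Rightarrow> 'x::topological_space option) \<Rightarrow> 'x option \<Rightarrow> 'a filter \<Rightarrow> bool" where
  "cemetery_tendsto f l F \<longleftrightarrow>
     (case l of None \<Rightarrow> eventually (\<lambda>a. f a = None) F
      | Some y \<Rightarrow> eventually (\<lambda>a. f a \<noteq> None) F \<and> filterlim (\<lambda>a. the (f a)) (nhds y) F)"

record ('w, 'x) mprocess =
  sample :: "'w measure"
  law :: "'x option \<Rightarrow> 'w measure"
  traj :: "ennreal \<Rightarrow> 'w \<Rightarrow> 'x option"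

text \<open>The measure component of the measure space \<open>sample W\<close> is irrelevant.  Time ranges over
  \<open>[0, \<infinity>]\<close>, and the position at time \<open>\<infinity>\<close> is the cemetery.\<close>

definition normal_process :: "('w, 'x::topological_space) mprocess \<Rightarrow> bool" where
  "normal_process W \<longleftrightarrow>
     law W \<in> cemetery_borel \<rightarrow>\<^sub>M prob_algebra (sample W) \<and>
     (\<forall>t. traj W t \<in> sample W \<rightarrow>\<^sub>M cemetery_borel) \<and>
     (\<forall>\<omega>\<in>space (sample W). traj W \<infinity> \<omega> = None) \<and>
     (\<forall>t. AE \<omega> in law W None. traj W t \<omega> = None) \<and>
     (\<forall>x. AE \<omega> in law W x. traj W 0 \<omega> = x)"

definition hunt_paths :: "('w, 'x::topological_space) mprocess \<Rightarrow> bool" where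
  "hunt_paths W \<longleftrightarrow>
     (\<forall>\<omega>\<in>space (sample W).
        (\<forall>s t. s \<le> t \<longrightarrow> traj W s \<omega> = None \<longrightarrow> traj W t \<omega> = None) \<and>
        (\<forall>t<\<infinity>. cemetery_tendsto (\<lambda>s. traj W s \<omega>) (traj W t \<omega>) (at_right t)) \<and>
        (\<forall>t. 0 < t \<longrightarrow> t < \<infinity> \<longrightarrow> (\<exists>l. cemetery_tendsto (\<lambda>s. traj W s \<omega>) l (at_left t)))) \<and>
     (\<exists>\<theta>. \<forall>t. \<forall>\<omega>\<in>space (sample W). \<theta> t \<omega> \<in> space (sample W) \<and>
        (\<forall>s. traj W s (\<theta> t \<omega>) = traj W (s + t) \<omega>))"

definition admissible_filtration ::
    "('w, 'x::topological_space) mprocess \<Rightarrow> (ennreal \<Rightarrow> 'w measure) \<Rightarrow> bool" where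
  "admissible_filtration W Fil \<longleftrightarrow>
     filtration (space (sample W)) Fil \<and>
     (\<forall>t. sets (Fil t) \<subseteq> sets (sample W)) \<and>
     (\<forall>t. traj W t \<in> Fil t \<rightarrow>\<^sub>M cemetery_borel) \<and>
     (\<forall>t<\<infinity>. sets (Fil t) = (\<Inter>s\<in>{t<..}. sets (Fil s)))"

definition strong_markov ::
    "('w, 'x::topological_space) mprocess \<Rightarrow> (ennreal \<Rightarrow> 'w measure) \<Rightarrow> bool" where
  "strong_markov W Fil \<longleftrightarrow>
     (\<forall>x \<sigma> s. \<forall>E\<in>sets cemetery_borel. stopping_time Fil \<sigma> \<longrightarrow>
        (\<forall>A\<in>sets (filtration.pre_sigma (space (sample W)) Fil \<sigma>).
           emeasure (law W x) {\<omega> \<in> A. traj W (\<sigma> \<omega> + s) \<omega> \<in> E} =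
           (\<integral>\<^sup>+\<omega>\<in>A. emeasure (law W (traj W (\<sigma> \<omega>) \<omega>)) {\<omega>' \<in> space (sample W). traj W s \<omega>' \<in> E}
              \<partial>law W x)))"

definition quasi_left_continuous ::
    "('w, 'x::topological_space) mprocess \<Rightarrow> (ennreal \<Rightarrow> 'w measure) \<Rightarrow> bool" where
  "quasi_left_continuous W Fil \<longleftrightarrow>
     (\<forall>x T. (\<forall>n::nat. stopping_time Fil (T n)) \<longrightarrow>
        (\<forall>\<omega>\<in>space (sample W). incseq (\<lambda>n. T n \<omega>)) \<longrightarrow>
        (AE \<omega> in law W x. (SUP n. T n \<omega>) < \<infinity> \<longrightarrow>
           cemetery_tendsto (\<lambda>n. traj W (T n \<omega>) \<omega>) (traj W (SUP n. T n \<omega>) \<omega>) sequentially))"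

text \<open>Since the laws form a kernel on \<open>sample W\<close>, requiring the strong Markov property and
  quasi-left-continuity for all starting points yields them for all initial distributions.\<close>

definition hunt_process :: "('w, 'x::topological_space) mprocess \<Rightarrow> bool" where
  "hunt_process W \<longleftrightarrow> normal_process W \<and> hunt_paths W \<and>
     (\<exists>Fil. admissible_filtration W Fil \<and> strong_markov W Fil \<and> quasi_left_continuous W Fil)"

text \<open>Functions on \<open>'x\<close> are extended by 0 to the cemetery.\<close>

definition transition :: "('w, 'x) mprocess \<Rightarrow> real \<Rightarrow> ('x \<Rightarrow> real) \<Rightarrow> 'x \<Rightarrow> real" where
  "transition W t f x =
     (LINT \<omega>|law W (Some x). (case traj W (ennreal t) \<omega> of None \<Rightarrow> 0 | Some y \<Rightarrow> f y))"

definition symmetric_process :: "'x::topological_space measure \<Rightarrow> ('w, 'x) mprocess \<Rightarrow> bool" where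
  "symmetric_process \<mu> W \<longleftrightarrow>
     (\<forall>t>0. \<forall>A\<in>sets borel. \<forall>B\<in>sets borel.
        (\<integral>\<^sup>+x\<in>A. emeasure (law W (Some x))
            {\<omega> \<in> space (sample W). traj W (ennreal t) \<omega> \<in> Some ` B} \<partial>\<mu>) =
        (\<integral>\<^sup>+x\<in>B. emeasure (law W (Some x))
            {\<omega> \<in> space (sample W). traj W (ennreal t) \<omega> \<in> Some ` A} \<partial>\<mu>))"

text \<open>The form of a symmetric process with transition semigroup \<open>T\<^sub>t\<close> is the limit of
  \<open>(u - T\<^sub>t u, u) / t\<close> in \<open>L\<^sup>2\<close> as \<open>t\<close> tends to 0, with domain those \<open>u\<close> for which it is finite.\<close>

definition approx_form :: "'x measure \<Rightarrow> ('w, 'x) mprocess \<Rightarrow> ('x \<Rightarrow> real) \<Rightarrow> real \<Rightarrow> real" where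
  "approx_form \<mu> W u t = (LINT x|\<mu>. (u x - transition W t u x) * u x) / t"

definition process_form :: "'x measure \<Rightarrow> ('w, 'x) mprocess \<Rightarrow> 'x qform" where
  "process_form \<mu> W =
     ({u \<in> L2 \<mu>. \<exists>l. (approx_form \<mu> W u \<longlongrightarrow> l) (at_right 0)},
      \<lambda>u. Lim (at_right 0) (approx_form \<mu> W u))"

definition hunt_process_of_form ::
    "'x::topological_space measure \<Rightarrow> 'x qform \<Rightarrow> ('w, 'x) mprocess \<Rightarrow> bool" where
  "hunt_process_of_form \<mu> q W \<longleftrightarrow>
     hunt_process W \<and> symmetric_process \<mu> W \<and> forms_coincide (process_form \<mu> W) q"

definition brownian_motion_of_resistance_form ::
    "'x::topological_space measure \<Rightarrow> 'x qform \<Rightarrow> ('w, 'x) mprocess \<Rightarrow> bool" where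
  "brownian_motion_of_resistance_form \<mu> q W \<longleftrightarrow> hunt_process_of_form \<mu> (L2_realisation \<mu> q) W"

end

theory Submission
  imports Defs
    "HOL-Real_Asymp.Real_Asymp"
begin

text \<open>A function of bounded energy oscillates by at most a constant times \<open>\<rho>(\<Psi>) powr (- m / 2)\<close> on each
  level \<open>m\<close> cell, and disjoint level \<open>m\<close> cells have positive distance in the limit space.  Hence for
  \<open>\<rho>(\<Psi>) > 1\<close> functions of finite energy are uniformly continuous and their oscillation is controlled by
  the energy.  So the harmonic splines interpolating \<open>u\<close> on the vertex sets converge to \<open>u\<close> both in energy
  and uniformly, while conversely a sequence of splines that is Cauchy in energy and converges in \<open>L\<^sup>2\<close>
  converges uniformly to a continuous function of finite energy.  This function is determined by its
  almost everywhere class because the limit measure has full support.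

  Distances are handled by duality with Lipschitz functions, in parallel to energies: a Lipschitz function
  extends to the next graph with the same constant if edge lengths are transformed by the analogue for
  lengths of the resistance map.\<close>

section \<open>Distances and Lipschitz functions on a graph\<close>

text \<open>A shortest path may wander through many cells, so cutting paths along cells is awkward;
  a Lipschitz function, in contrast, can be restricted or extended in each cell separately. This is
  why distances are treated dually. Distance-positivity keeps the lengths of all colours within the
  factor \<open>rule_size\<close> of each other, so that the single sequence \<open>min_len\<close>
  measures all distances up to constants. It at least doubles at each level because planting
  vertices are never adjacent, which makes cells shrink; it grows by at most a fixed factor, which
  keeps disjoint cells apart after normalisation by the diameter. Full support of the measure is a
  matter of counting: every rule contains every colour, so edges of different colours have
  comparably many descendants and no cell loses its share of the vertices in the limit. That
  \<open>dim_R S\<close> and \<open>ln (rho_Psi S)\<close> have the same sign needs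
  \<open>rho_min\<close> above 1. A planting path has at least two arcs, so powers of a distance
  matrix grow exponentially.\<close>

declare parcs_mk_symmetric [simp]

text \<open>The order of quantifiers matters: \<open>N\<close> counts the steps of one fixed walk
  and therefore serves all \<open>f\<close> and \<open>B\<close> at once.\<close>

lemma reachable_difference_bound:
  assumes "u \<rightarrow>\<^sup>*\<^bsub>undir G\<^esub> z"
  shows "\<exists>N::nat. \<forall>(f::'a \<Rightarrow> real) (B::real).
    (\<forall>e\<in>arcs G. \<bar>f (tail G e) - f (head G e)\<bar> \<le> B) \<longrightarrow> \<bar>f u - f z\<bar> \<le> N * B"
  using assms unfolding reachable_def
proof (induct rule: rtrancl_on_induct)
  case base
  show ?case by (rule exI[of _ 0]) auto
next
  case (step y z)
  from step(5) obtain N :: nat where N: "\<And>(f::'a \<Rightarrow> real) (B::real).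
    (\<forall>e\<in>arcs G. \<bar>f (tail G e) - f (head G e)\<bar> \<le> B) \<Longrightarrow> \<bar>f u - f y\<bar> \<le> N * B" by blast
  have "\<bar>f u - f z\<bar> \<le> Suc N * B"
    if f: "\<forall>e\<in>arcs G. \<bar>f (tail G e) - f (head G e)\<bar> \<le> B" for f :: "'a \<Rightarrow> real" and B :: real
  proof -
    from step(2) obtain e where "e \<in> arcs G" "(y, z) = (tail G e, head G e) \<or> (y, z) = (head G e, tail G e)"
      by auto
    with f have "\<bar>f y - f z\<bar> \<le> B" by (auto simp: abs_minus_commute)
    with N[OF f] show ?thesis by (simp add: algebra_simps)
  qed
  then show ?case by blast
qed

lemma connected_reachable:
  assumes "Digraph_Component.connected G" "u \<in> verts G" "z \<in> verts G"
  shows "u \<rightarrow>\<^sup>*\<^bsub>undir G\<^esub> z"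
  using assms by (auto simp: Digraph_Component.connected_def strongly_connected_def)

lemma connected_difference_bound:
  assumes fin: "finite (verts G)" and conn: "Digraph_Component.connected G"
  shows "\<exists>N::nat. \<forall>(f::'a \<Rightarrow> real) (B::real) u z. 0 \<le> B \<longrightarrow> u \<in> verts G \<longrightarrow> z \<in> verts G \<longrightarrow>
    (\<forall>e\<in>arcs G. \<bar>f (tail G e) - f (head G e)\<bar> \<le> B) \<longrightarrow> \<bar>f u - f z\<bar> \<le> N * B"
proof -
  have "\<forall>p\<in>verts G \<times> verts G. \<exists>N::nat. \<forall>(f::'a \<Rightarrow> real) (B::real).
    (\<forall>e\<in>arcs G. \<bar>f (tail G e) - f (head G e)\<bar> \<le> B) \<longrightarrow> \<bar>f (fst p) - f (snd p)\<bar> \<le> N * B"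
    by (intro ballI, rule reachable_difference_bound[OF connected_reachable[OF conn]]) auto
  then obtain N :: "'a \<times> 'a \<Rightarrow> nat" where N: "\<And>p (f::'a \<Rightarrow> real) (B::real). p \<in> verts G \<times> verts G \<Longrightarrow>
    (\<forall>e\<in>arcs G. \<bar>f (tail G e) - f (head G e)\<bar> \<le> B) \<Longrightarrow> \<bar>f (fst p) - f (snd p)\<bar> \<le> N p * B"
    by (subst (asm) bchoice_iff) blast
  have "\<bar>f u - f z\<bar> \<le> Max (N ` (verts G \<times> verts G)) * B"
    if "0 \<le> B" "u \<in> verts G" "z \<in> verts G" "\<forall>e\<in>arcs G. \<bar>f (tail G e) - f (head G e)\<bar> \<le> B"
    for f :: "'a \<Rightarrow> real" and B :: real and u z
  proof -
    have "\<bar>f u - f z\<bar> \<le> N (u, z) * B" using N[of "(u, z)" f B] that by auto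
    also have "\<dots> \<le> Max (N ` (verts G \<times> verts G)) * B"
      using that fin by (intro mult_right_mono) (auto intro!: Max_ge)
    finally show ?thesis .
  qed
  then show ?thesis by blast
qed

lemma (in wf_digraph) wf_undir: "wf_digraph (undir G)"
  by unfold_locales auto

lemma (in wf_digraph) undir_reachable_iff_vwalk:
  "u \<rightarrow>\<^sup>*\<^bsub>undir G\<^esub> z \<longleftrightarrow> (\<exists>p. vwalk p (undir G) \<and> hd p = u \<and> last p = z)"
  by (rule wf_digraph.reachable_vwalk_conv[OF wf_undir])

lemma (in wf_digraph) undir_reachable_imp_vpath:
  assumes "u \<rightarrow>\<^sup>*\<^bsub>undir G\<^esub> z"
  obtains p where "vpath p (undir G)" "hd p = u" "last p = z"
  using assms wf_digraph.reachable_vpath_conv[OF wf_undir] by blast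

lemma vwalk_difference_le_length:
  fixes f :: "'v \<Rightarrow> real"
  assumes "vwalk p (undir G)" "\<forall>e\<in>arcs G. \<bar>f (tail G e) - f (head G e)\<bar> \<le> 1"
  shows "\<bar>f (hd p) - f (last p)\<bar> \<le> vwalk_length p"
  using assms
proof (induct p rule: vwalk_arcs.induct)
  case 1 then show ?case by (auto simp: vwalk_def)
next
  case (2 x) then show ?case by simp
next
  case (3 x y xs)
  have w: "vwalk (y # xs) (undir G)" using 3(2) by (auto simp: vwalk_def)
  from 3(2) obtain e where "e \<in> arcs G" "(x, y) = (tail G e, head G e) \<or> (x, y) = (head G e, tail G e)"
    by (auto simp: vwalk_def)
  with 3(3) have "\<bar>f x - f y\<bar> \<le> 1" by (auto simp: abs_minus_commute)
  moreover have "\<bar>f (hd (y # xs)) - f (last (y # xs))\<bar> \<le> vwalk_length (y # xs)"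
    using 3(1)[OF w 3(3)] .
  ultimately show ?case by auto
qed

lemma gdist_le_vwalk_length:
  "vwalk p (undir G) \<Longrightarrow> gdist G (hd p) (last p) \<le> vwalk_length p"
  unfolding gdist_def by (rule Least_le) auto

context wf_digraph
begin

lemma gdist_vwalk:
  assumes "Digraph_Component.connected G" "u \<in> verts G" "z \<in> verts G"
  obtains p where "vwalk p (undir G)" "hd p = u" "last p = z" "vwalk_length p = gdist G u z"
proof -
  have "\<exists>l p. vwalk p (undir G) \<and> hd p = u \<and> last p = z \<and> vwalk_length p = l"
    using connected_reachable[OF assms] undir_reachable_iff_vwalk by blast
  from LeastI_ex[OF this] show ?thesis using that unfolding gdist_def by blast
qed

lemma difference_le_gdist:
  fixes f :: "'a \<Rightarrow> real"
  assumes "Digraph_Component.connected G" "u \<in> verts G" "z \<in> verts G"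
    and "\<forall>e\<in>arcs G. \<bar>f (tail G e) - f (head G e)\<bar> \<le> 1"
  shows "\<bar>f u - f z\<bar> \<le> gdist G u z"
  by (metis gdist_vwalk[OF assms(1-3)] vwalk_difference_le_length assms(4))

lemma gdist_step:
  assumes "Digraph_Component.connected G" "z \<in> verts G" "(x, y) \<in> arcs_ends (undir G)"
  shows "gdist G x z \<le> Suc (gdist G y z)"
proof -
  have xy: "x \<in> verts G" "y \<in> verts G" using assms(3) by auto
  obtain p where p: "vwalk p (undir G)" "hd p = y" "last p = z" "vwalk_length p = gdist G y z"
    using gdist_vwalk[OF assms(1) xy(2) assms(2)] by blast
  have ne: "p \<noteq> []" using p(1) by (auto simp: vwalk_def)
  have "vwalk (x # p) (undir G)" using p xy assms(3) by (intro vwalk_consI) auto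
  from gdist_le_vwalk_length[OF this] show ?thesis using p ne by (cases p) auto
qed

lemma gdist_self: "u \<in> verts G \<Longrightarrow> gdist G u u = 0"
  using gdist_le_vwalk_length[of "[u]" G] by (auto simp: vwalk_def)

text \<open>The distance to \<open>z\<close> is itself a 1-Lipschitz function, so it can be used as
  the test function. Together with \<open>difference_le_gdist\<close> this is the duality by which
  all distances are estimated.\<close>

lemma gdist_le_if_Lipschitz_bound:
  assumes "Digraph_Component.connected G" "u \<in> verts G" "z \<in> verts G"
    and bound: "\<And>f::'a \<Rightarrow> real. \<forall>e\<in>arcs G. \<bar>f (tail G e) - f (head G e)\<bar> \<le> 1 \<Longrightarrow> \<bar>f u - f z\<bar> \<le> B"
  shows "real (gdist G u z) \<le> B"
proof -
  have "\<bar>real (gdist G (tail G e) z) - real (gdist G (head G e) z)\<bar> \<le> 1" if "e \<in> arcs G" for e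
    using gdist_step[OF assms(1,3), of "tail G e" "head G e"]
      gdist_step[OF assms(1,3), of "head G e" "tail G e"] that by (fastforce simp del: of_nat_Suc)
  from bound[of "\<lambda>x. real (gdist G x z)", OF ballI, OF this] show ?thesis
    using gdist_self[OF assms(3)] by simp
qed

end

lemma vwalk_first_arc:
  assumes "vwalk p (undir G)" "hd p \<noteq> last p"
  obtains x xs where "p = hd p # x # xs" "(hd p, x) \<in> arcs_ends (undir G)" "x \<in> verts G"
proof -
  from assms have "p \<noteq> []" by (auto simp: vwalk_def)
  with assms(2) obtain y x xs where p: "p = y # x # xs"
    by (metis last_ConsL list.exhaust list.sel(1))
  show ?thesis using that[of x xs] assms(1) unfolding p vwalk_def by auto
qed


section \<open>Rule graphs\<close>

locale eigs_system =
  fixes S :: "('v, 'e) eigs"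
  assumes eigs: "is_eigs S" and distance_pos: "distance_positive S"
begin

abbreviation "K \<equiv> ncolours S"
abbreviation "R \<equiv> rule S"
abbreviation "colour \<equiv> arc_colour S"
abbreviation "\<beta>p \<equiv> beta_plus S"
abbreviation "\<beta>m \<equiv> beta_minus S"

lemma K_pos: "0 < K" and init_colour_less: "init_colour S < K"
  using eigs by (auto simp: is_eigs_def)

context
  fixes i assumes i: "i < K"
begin

lemma rule_fin_digraph: "fin_digraph (R i)"
  and rule_simple: "simple_underlying (R i)"
  and rule_connected: "Digraph_Component.connected (R i)"
  and colour_less: "e \<in> arcs (R i) \<Longrightarrow> colour i e < K"
  and beta_plus_in: "\<beta>p i \<in> verts (R i)"
  and beta_minus_in: "\<beta>m i \<in> verts (R i)"
  and beta_neq: "\<beta>p i \<noteq> \<beta>m i"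
  using eigs i by (auto simp: is_eigs_def)

lemma rule_wf_digraph: "wf_digraph (R i)"
  using rule_fin_digraph by (simp add: fin_digraph_def)

lemma finite_rule [simp]: "finite (verts (R i))" "finite (arcs (R i))"
  using rule_fin_digraph fin_digraph.finite_verts fin_digraph.finite_arcs by auto

lemma rule_tail_head [simp]:
  assumes "e \<in> arcs (R i)"
  shows "tail (R i) e \<in> verts (R i)" "head (R i) e \<in> verts (R i)"
  using rule_wf_digraph assms by (auto simp: wf_digraph_def)

lemma planting_path_exists: "\<exists>p. p \<in> planting_paths S i"
  using wf_digraph.undir_reachable_imp_vpath[OF rule_wf_digraph
    connected_reachable[OF rule_connected beta_plus_in beta_minus_in]]
  unfolding planting_paths_def simple_paths_def by blast

end

text \<open>A distance matrix records one path per rule simultaneously. Inserting \<open>p\<close>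
  as the \<open>i\<close>-th path into an arbitrary choice \<open>q\<close> isolates the statement
  about \<open>p\<close>.\<close>

lemma colour_on_planting_path:
  assumes i: "i < K" and j: "j < K" and p: "p \<in> planting_paths S i"
  shows "\<exists>e\<in>arcs_on (R i) p. colour i e = j"
proof -
  obtain q where q: "\<And>i. i < K \<Longrightarrow> q i \<in> planting_paths S i"
    using planting_path_exists by metis
  have "\<forall>k<K. (q(i := p)) k \<in> planting_paths S k" using q p by auto
  then have "mat K K (\<lambda>(k, j). card {e \<in> arcs_on (R k) ((q(i := p)) k). colour k e = j})
      \<in> distance_matrices S" (is "?D \<in> _") unfolding distance_matrices_def by blast
  with distance_pos i j have "0 < ?D $$ (i, j)" unfolding distance_positive_def by blast
  then have "{e \<in> arcs_on (R i) p. colour i e = j} \<noteq> {}" using i j by (auto simp: card_gt_0_iff)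
  then show ?thesis by auto
qed

text \<open>Such an arc would be a planting path with only one colour on it. A second colour
  contradicts positivity, and for a single colour this is what the extra distance condition
  excludes.\<close>

lemma no_direct_arc:
  assumes i: "i < K" and e: "e \<in> arcs (R i)"
  shows "{tail (R i) e, head (R i) e} \<noteq> {\<beta>p i, \<beta>m i}"
proof
  assume eq: "{tail (R i) e, head (R i) e} = {\<beta>p i, \<beta>m i}"
  let ?p = "[\<beta>p i, \<beta>m i]"
  have walk: "vwalk ?p (undir (R i))"
    using eq e beta_plus_in[OF i] beta_minus_in[OF i]
    by (auto simp: vwalk_def doubleton_eq_iff intro!: bexI[of _ e])
  show False
  proof (cases "K = 1")
    case True
    with i have "i = 0" by simp
    with True distance_pos have "2 \<le> gdist (R i) (\<beta>p i) (\<beta>m i)"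
      by (auto simp: distance_positive_def)
    with gdist_le_vwalk_length[OF walk] show False by simp
  next
    case False
    define j where "j = (if colour i e = 0 then 1 else 0 :: nat)"
    have j: "j < K" "j \<noteq> colour i e" using False K_pos by (auto simp: j_def)
    have "?p \<in> planting_paths S i"
      using walk beta_neq[OF i] by (auto simp: planting_paths_def simple_paths_def vpath_def)
    from colour_on_planting_path[OF i j(1) this] obtain e'
      where e': "e' \<in> arcs (R i)" "colour i e' = j"
        "{tail (R i) e', head (R i) e'} = {\<beta>p i, \<beta>m i}" by (auto simp: arcs_on_def insert_commute)
    with rule_simple[OF i] e eq have "e = e'" unfolding simple_underlying_def by blast
    with e' j show False by simp
  qed
qed

lemma beta_not_adjacent:
  assumes i: "i < K"
  shows "(\<beta>p i, \<beta>m i) \<notin> arcs_ends (undir (R i))"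
proof
  assume "(\<beta>p i, \<beta>m i) \<in> arcs_ends (undir (R i))"
  then obtain e where "e \<in> arcs (R i)"
    "(\<beta>p i, \<beta>m i) = (tail (R i) e, head (R i) e) \<or> (\<beta>p i, \<beta>m i) = (head (R i) e, tail (R i) e)"
    by auto
  with no_direct_arc[OF i, of e] show False by (auto simp: insert_commute)
qed

lemma incident_arc:
  assumes i: "i < K" and x: "x \<in> verts (R i)"
  shows "\<exists>e\<in>arcs (R i). x = tail (R i) e \<or> x = head (R i) e"
proof -
  obtain y where y: "y \<in> verts (R i)" "y \<noteq> x"
    using beta_neq[OF i] beta_plus_in[OF i] beta_minus_in[OF i] by metis
  obtain p where p: "vwalk p (undir (R i))" "hd p = x" "last p = y"
    using connected_reachable[OF rule_connected[OF i] x y(1)]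
      wf_digraph.undir_reachable_iff_vwalk[OF rule_wf_digraph[OF i]] by blast
  from vwalk_first_arc[OF p(1)] p(2,3) y(2) obtain z where "(x, z) \<in> arcs_ends (undir (R i))" by metis
  then show ?thesis by auto
qed

text \<open>Non-adjacency of the planting vertices keeps the far end of the first arc away from
  \<open>\<beta>m i\<close> and that of the last arc away from \<open>\<beta>p i\<close>. This
  yields an inner vertex and, later, two different arcs on \<open>p\<close>.\<close>

lemma beta_neighbours:
  assumes i: "i < K" and p: "p \<in> planting_paths S i"
  obtains x y where "x \<in> verts (R i)" "x \<noteq> \<beta>p i" "x \<noteq> \<beta>m i" "(\<beta>p i, x) \<in> set (vwalk_arcs p)"
    "y \<noteq> \<beta>p i" "(y, \<beta>m i) \<in> set (vwalk_arcs p)"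
proof -
  from p have p: "vwalk p (undir (R i))" "hd p = \<beta>p i" "last p = \<beta>m i" "distinct p"
    by (auto simp: planting_paths_def simple_paths_def vpath_def)
  obtain x xs where x: "p = \<beta>p i # x # xs" "(\<beta>p i, x) \<in> arcs_ends (undir (R i))" "x \<in> verts (R i)"
    using vwalk_first_arc[OF p(1)] p(2,3) beta_neq[OF i] by metis
  have xn: "x \<noteq> \<beta>m i" using x(2) beta_not_adjacent[OF i] by metis
  have last_arc: "(last (butlast q), last q) \<in> set (vwalk_arcs q)" if "length q \<ge> 2" for q :: "'v list"
    using that by (induct q rule: vwalk_arcs.induct) (auto simp: Suc_le_eq)
  define y where "y = last (butlast p)"
  have y: "(y, \<beta>m i) \<in> set (vwalk_arcs p)" using last_arc[of p] p(3) x(1) by (simp add: y_def)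
  have "(y, \<beta>m i) \<in> arcs_ends (undir (R i))" using y p(1) by (auto simp: vwalk_def)
  then have yn: "y \<noteq> \<beta>p i" using beta_not_adjacent[OF i] by metis
  show ?thesis using that[of x y] x xn y yn p(4) by auto
qed

lemma inner_vertex_exists:
  assumes i: "i < K"
  shows "\<exists>x\<in>verts (R i). x \<noteq> \<beta>p i \<and> x \<noteq> \<beta>m i"
  using planting_path_exists[OF i] beta_neighbours[OF i] by metis

lemma colour_occurs:
  assumes i: "i < K" and j: "j < K"
  shows "\<exists>e\<in>arcs (R i). colour i e = j"
  using planting_path_exists[OF i] colour_on_planting_path[OF i j] by (auto simp: arcs_on_def)

text \<open>Every planting path uses colour \<open>j\<close>, so deleting the arcs of this colour
  separates the planting vertices; \<open>\<phi>\<close> is the indicator of the complement of the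
  remaining component of \<open>\<beta>m i\<close>.\<close>

lemma colour_cut:
  assumes i: "i < K" and j: "j < K"
  shows "\<exists>\<phi>::'v \<Rightarrow> real. \<phi> (\<beta>p i) = 1 \<and> \<phi> (\<beta>m i) = 0 \<and>
    (\<forall>e\<in>arcs (R i). \<bar>\<phi> (tail (R i) e) - \<phi> (head (R i) e)\<bar> \<le> of_bool (colour i e = j))"
proof -
  define G where "G = (R i)\<lparr>arcs := {e \<in> arcs (R i). colour i e \<noteq> j}\<rparr>"
  have G [simp]: "verts G = verts (R i)" "arcs G = {e \<in> arcs (R i). colour i e \<noteq> j}"
    "tail G = tail (R i)" "head G = head (R i)" by (auto simp: G_def)
  have wf: "wf_digraph G" using i by unfold_locales auto
  define \<phi> :: "'v \<Rightarrow> real" where "\<phi> x = (if x \<rightarrow>\<^sup>*\<^bsub>undir G\<^esub> \<beta>m i then 0 else 1)" for x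
  have "\<not> \<beta>p i \<rightarrow>\<^sup>*\<^bsub>undir G\<^esub> \<beta>m i"
  proof
    assume "\<beta>p i \<rightarrow>\<^sup>*\<^bsub>undir G\<^esub> \<beta>m i"
    then obtain p where p: "vpath p (undir G)" "hd p = \<beta>p i" "last p = \<beta>m i"
      using wf_digraph.undir_reachable_imp_vpath[OF wf] by blast
    have "vpath p (undir (R i))" using p(1) by (auto simp: vpath_def vwalk_def)
    with p have "p \<in> planting_paths S i" by (auto simp: planting_paths_def simple_paths_def)
    from colour_on_planting_path[OF i j this] obtain e where e: "e \<in> arcs (R i)" "colour i e = j"
      and "(tail (R i) e, head (R i) e) \<in> set (vwalk_arcs p) \<or>
        (head (R i) e, tail (R i) e) \<in> set (vwalk_arcs p)" by (auto simp: arcs_on_def)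
    with p(1) have "(tail (R i) e, head (R i) e) \<in> arcs_ends (undir G) \<or>
        (head (R i) e, tail (R i) e) \<in> arcs_ends (undir G)" by (auto simp: vpath_def vwalk_def)
    then obtain e' where e': "e' \<in> arcs (R i)" "colour i e' \<noteq> j"
        "{tail (R i) e', head (R i) e'} = {tail (R i) e, head (R i) e}" by (auto simp: insert_commute)
    with rule_simple[OF i] e have "e = e'" unfolding simple_underlying_def by blast
    with e e' show False by simp
  qed
  moreover have "\<beta>m i \<rightarrow>\<^sup>*\<^bsub>undir G\<^esub> \<beta>m i"
    using beta_minus_in[OF i] by (simp add: reachable_def)
  moreover have "\<bar>\<phi> (tail (R i) e) - \<phi> (head (R i) e)\<bar> \<le> of_bool (colour i e = j)"
    if e: "e \<in> arcs (R i)" for e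
  proof (cases "colour i e = j")
    case True
    then show ?thesis by (simp add: \<phi>_def)
  next
    case False
    then have "tail (R i) e \<rightarrow>\<^bsub>undir G\<^esub> head (R i) e" "head (R i) e \<rightarrow>\<^bsub>undir G\<^esub> tail (R i) e"
      using e by auto
    then have "\<phi> (tail (R i) e) = \<phi> (head (R i) e)"
      using wf_digraph.adj_reachable_trans[OF wf_digraph.wf_undir[OF wf]] unfolding \<phi>_def by metis
    then show ?thesis by simp
  qed
  ultimately show ?thesis by (intro exI[of _ \<phi>]) (simp add: \<phi>_def)
qed

text \<open>One constant covers both the number of arcs and the length of connecting walks, so that
  counting and oscillation estimates share it. It depends on \<open>S\<close> alone, not on a
  level.\<close>

definition rule_size :: nat where
  "rule_size = (SOME N. 1 \<le> N \<and> (\<forall>i<K. card (arcs (R i)) \<le> N \<and>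
    (\<forall>(f::'v \<Rightarrow> real) (B::real) u z. 0 \<le> B \<longrightarrow> u \<in> verts (R i) \<longrightarrow> z \<in> verts (R i) \<longrightarrow>
      (\<forall>e\<in>arcs (R i). \<bar>f (tail (R i) e) - f (head (R i) e)\<bar> \<le> B) \<longrightarrow> \<bar>f u - f z\<bar> \<le> N * B)))"

lemma rule_size:
  "1 \<le> rule_size \<and> (\<forall>i<K. card (arcs (R i)) \<le> rule_size \<and>
    (\<forall>(f::'v \<Rightarrow> real) (B::real) u z. 0 \<le> B \<longrightarrow> u \<in> verts (R i) \<longrightarrow> z \<in> verts (R i) \<longrightarrow>
      (\<forall>e\<in>arcs (R i). \<bar>f (tail (R i) e) - f (head (R i) e)\<bar> \<le> B) \<longrightarrow> \<bar>f u - f z\<bar> \<le> rule_size * B))"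
proof -
  have "\<exists>N::nat \<Rightarrow> nat. \<forall>i. i < K \<longrightarrow> (\<forall>(f::'v \<Rightarrow> real) (B::real) u z. 0 \<le> B \<longrightarrow> u \<in> verts (R i) \<longrightarrow> z \<in> verts (R i) \<longrightarrow>
      (\<forall>e\<in>arcs (R i). \<bar>f (tail (R i) e) - f (head (R i) e)\<bar> \<le> B) \<longrightarrow> \<bar>f u - f z\<bar> \<le> real (N i) * B)"
  proof (intro choice allI)
    fix i
    show "\<exists>N::nat. i < K \<longrightarrow> (\<forall>(f::'v \<Rightarrow> real) (B::real) u z. 0 \<le> B \<longrightarrow> u \<in> verts (R i) \<longrightarrow> z \<in> verts (R i) \<longrightarrow>
      (\<forall>e\<in>arcs (R i). \<bar>f (tail (R i) e) - f (head (R i) e)\<bar> \<le> B) \<longrightarrow> \<bar>f u - f z\<bar> \<le> real N * B)"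
      using connected_difference_bound[OF finite_rule(1) rule_connected, of i] by (cases "i < K") simp_all
  qed
  then obtain N :: "nat \<Rightarrow> nat" where N: "\<And>i f (B::real) u z. i < K \<Longrightarrow> 0 \<le> B \<Longrightarrow> u \<in> verts (R i) \<Longrightarrow>
      z \<in> verts (R i) \<Longrightarrow> (\<forall>e\<in>arcs (R i). \<bar>f (tail (R i) e) - f (head (R i) e)\<bar> \<le> B) \<Longrightarrow>
      \<bar>f u - f z\<bar> \<le> real (N i) * B" by blast
  define N' where "N' = 1 + (\<Sum>i<K. N i + card (arcs (R i)))"
  have le: "N i + card (arcs (R i)) \<le> N'" if "i < K" for i
    unfolding N'_def by (rule order_trans[OF member_le_sum[of i "{..<K}"]]) (use that in auto)
  have "\<bar>f u - f z\<bar> \<le> real N' * B" if "i < K" "0 \<le> B" "u \<in> verts (R i)" "z \<in> verts (R i)"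
    "\<forall>e\<in>arcs (R i). \<bar>f (tail (R i) e) - f (head (R i) e)\<bar> \<le> B" for i u z and f :: "'v \<Rightarrow> real" and B :: real
  proof -
    have "real (N i) * B \<le> real N' * B" using le[OF that(1)] that(2) by (intro mult_right_mono) auto
    with N[OF that] show ?thesis by linarith
  qed
  moreover have "card (arcs (R i)) \<le> N'" if "i < K" for i using le[OF that] by simp
  moreover have "1 \<le> N'" by (simp add: N'_def)
  ultimately have "1 \<le> N' \<and> (\<forall>i<K. card (arcs (R i)) \<le> N' \<and>
    (\<forall>(f::'v \<Rightarrow> real) (B::real) u z. 0 \<le> B \<longrightarrow> u \<in> verts (R i) \<longrightarrow> z \<in> verts (R i) \<longrightarrow>
      (\<forall>e\<in>arcs (R i). \<bar>f (tail (R i) e) - f (head (R i) e)\<bar> \<le> B) \<longrightarrow> \<bar>f u - f z\<bar> \<le> N' * B))"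
    by auto
  from someI[of "\<lambda>N'. 1 \<le> N' \<and> (\<forall>i<K. card (arcs (R i)) \<le> N' \<and>
    (\<forall>(f::'v \<Rightarrow> real) (B::real) u z. 0 \<le> B \<longrightarrow> u \<in> verts (R i) \<longrightarrow> z \<in> verts (R i) \<longrightarrow>
      (\<forall>e\<in>arcs (R i). \<bar>f (tail (R i) e) - f (head (R i) e)\<bar> \<le> B) \<longrightarrow> \<bar>f u - f z\<bar> \<le> N' * B))", OF this]
  show ?thesis unfolding rule_size_def[symmetric] .
qed

lemma rule_size_ge_1: "1 \<le> rule_size"
  and card_arcs_le: "i < K \<Longrightarrow> card (arcs (R i)) \<le> rule_size"
  and rule_difference_bound: "i < K \<Longrightarrow> 0 \<le> B \<Longrightarrow> u \<in> verts (R i) \<Longrightarrow> z \<in> verts (R i) \<Longrightarrow>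
    (\<And>e. e \<in> arcs (R i) \<Longrightarrow> \<bar>f (tail (R i) e) - f (head (R i) e)\<bar> \<le> B) \<Longrightarrow>
    \<bar>f u - f z\<bar> \<le> rule_size * (B::real)"
  using rule_size by blast+

section \<open>Lipschitz functions on a single rule graph\<close>

definition rule_Lipschitz :: "(nat \<Rightarrow> real) \<Rightarrow> nat \<Rightarrow> ('v \<Rightarrow> real) \<Rightarrow> bool" where
  "rule_Lipschitz x i f \<longleftrightarrow>
    (\<forall>e\<in>arcs (R i). \<bar>f (tail (R i) e) - f (head (R i) e)\<bar> \<le> x (colour i e))"

text \<open>The distance between the planting vertices when an edge of colour \<open>j\<close> has length \<open>x j\<close>, in its
  dual description by Lipschitz functions.  This is the counterpart of \<open>Psi\<close> for lengths.\<close>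

definition dist_map :: "(nat \<Rightarrow> real) \<Rightarrow> nat \<Rightarrow> real" where
  "dist_map x i = (SUP f\<in>{f. rule_Lipschitz x i f \<and> f (\<beta>m i) = 0}. f (\<beta>p i))"

context
  fixes x :: "nat \<Rightarrow> real" and i :: nat
  assumes i: "i < K" and x: "\<And>j. j < K \<Longrightarrow> 0 \<le> x j"
begin

lemma rule_Lipschitz_bound:
  fixes B :: real
  assumes f: "rule_Lipschitz x i f" and B: "\<And>j. j < K \<Longrightarrow> x j \<le> B"
    and "u \<in> verts (R i)" "z \<in> verts (R i)"
  shows "\<bar>f u - f z\<bar> \<le> rule_size * B"
proof (rule rule_difference_bound[OF i])
  show "0 \<le> B" using x B i order_trans by blast
  show "\<bar>f (tail (R i) e) - f (head (R i) e)\<bar> \<le> B" if "e \<in> arcs (R i)" for e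
    using f B[OF colour_less[OF i that]] that unfolding rule_Lipschitz_def by force
qed fact+

lemma rule_Lipschitz_bdd:
  assumes u: "u \<in> verts (R i)"
  shows "bdd_above ((\<lambda>f. f u) ` {f. rule_Lipschitz x i f \<and> f (\<beta>m i) = 0})"
proof (intro bdd_aboveI2[where M = "rule_size * (\<Sum>j<K. x j)"], safe)
  fix f :: "'v \<Rightarrow> real" assume f: "rule_Lipschitz x i f" "f (\<beta>m i) = 0"
  have "x j \<le> (\<Sum>j<K. x j)" if "j < K" for j using that x by (intro member_le_sum) auto
  from rule_Lipschitz_bound[OF f(1) this u beta_minus_in[OF i]] f(2)
  show "f u \<le> rule_size * (\<Sum>j<K. x j)" by simp
qed

lemma rule_Lipschitz_zero: "(\<lambda>_. 0) \<in> {f. rule_Lipschitz x i f \<and> f (\<beta>m i) = 0}"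
  using x colour_less[OF i] by (auto simp: rule_Lipschitz_def)

lemma rule_Lipschitz_le_dist_map:
  assumes f: "rule_Lipschitz x i f"
  shows "\<bar>f (\<beta>p i) - f (\<beta>m i)\<bar> \<le> dist_map x i"
proof -
  \<comment> \<open>Shifting by the value at \<open>\<beta>m i\<close> and possibly changing sign
    normalises \<open>f\<close> without affecting its Lipschitz property; the two signs give the
    absolute value.\<close>
  have *: "s * (f (\<beta>p i) - f (\<beta>m i)) \<le> dist_map x i" if "s = 1 \<or> s = -1" for s
  proof -
    define g where "g u = s * (f u - f (\<beta>m i))" for u
    have "g \<in> {f. rule_Lipschitz x i f \<and> f (\<beta>m i) = 0}"
      using f that by (auto simp: g_def rule_Lipschitz_def abs_minus_commute)
    from cSUP_upper[OF this rule_Lipschitz_bdd[OF beta_plus_in[OF i]]] show ?thesis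
      unfolding dist_map_def by (simp add: g_def)
  qed
  from *[of 1] *[of "-1"] show ?thesis by auto
qed

lemma dist_map_attained:
  obtains \<phi> where "rule_Lipschitz x i \<phi>" "\<phi> (\<beta>m i) = 0" "\<phi> (\<beta>p i) = dist_map x i"
proof -
  let ?L = "{f. rule_Lipschitz x i f \<and> f (\<beta>m i) = 0}"
  define \<phi> where "\<phi> u = (SUP f\<in>?L. f u)" for u
  have *: "\<phi> u \<le> \<phi> z + x (colour i e)" if e: "e \<in> arcs (R i)"
    and "(u, z) = (tail (R i) e, head (R i) e) \<or> (u, z) = (head (R i) e, tail (R i) e)" for u z e
    unfolding \<phi>_def[of u]
  proof (rule cSUP_least)
    show "?L \<noteq> {}" using rule_Lipschitz_zero by blast
    fix f assume f: "f \<in> ?L"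
    have "z \<in> verts (R i)" using that i by auto
    then have "f z \<le> \<phi> z" unfolding \<phi>_def by (intro cSUP_upper[OF f rule_Lipschitz_bdd])
    moreover have "\<bar>f u - f z\<bar> \<le> x (colour i e)"
      using f that by (auto simp: rule_Lipschitz_def abs_minus_commute)
    ultimately show "f u \<le> \<phi> z + x (colour i e)" by linarith
  qed
  have "rule_Lipschitz x i \<phi>" unfolding rule_Lipschitz_def
  proof
    fix e assume "e \<in> arcs (R i)"
    from *[OF this, of "tail (R i) e" "head (R i) e"] *[OF this, of "head (R i) e" "tail (R i) e"]
    show "\<bar>\<phi> (tail (R i) e) - \<phi> (head (R i) e)\<bar> \<le> x (colour i e)" by auto
  qed
  moreover have "\<phi> (\<beta>m i) = (SUP f\<in>?L. 0)" unfolding \<phi>_def by (intro SUP_cong) auto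
  then have "\<phi> (\<beta>m i) = 0" using rule_Lipschitz_zero by (subst (asm) cSUP_const) blast+
  moreover have "\<phi> (\<beta>p i) = dist_map x i" by (simp add: \<phi>_def dist_map_def)
  ultimately show ?thesis using that by blast
qed

text \<open>Multiplied by \<open>x j\<close>, the potential of \<open>colour_cut\<close> changes
  only along arcs of colour \<open>j\<close>, and there by at most their length. In terms of paths:
  each planting path must use an arc of colour \<open>j\<close>.\<close>

lemma dist_map_ge_entry:
  assumes j: "j < K"
  shows "x j \<le> dist_map x i"
proof -
  obtain \<phi> :: "'v \<Rightarrow> real" where \<phi>: "\<phi> (\<beta>p i) = 1" "\<phi> (\<beta>m i) = 0"
    "\<forall>e\<in>arcs (R i). \<bar>\<phi> (tail (R i) e) - \<phi> (head (R i) e)\<bar> \<le> of_bool (colour i e = j)"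
    using colour_cut[OF i j] by blast
  have "rule_Lipschitz x i (\<lambda>u. x j * \<phi> u)" unfolding rule_Lipschitz_def
  proof
    fix e assume e: "e \<in> arcs (R i)"
    have "\<bar>x j * \<phi> (tail (R i) e) - x j * \<phi> (head (R i) e)\<bar> = x j * \<bar>\<phi> (tail (R i) e) - \<phi> (head (R i) e)\<bar>"
      using x[OF j] by (simp add: abs_mult flip: right_diff_distrib)
    also have "\<dots> \<le> x j * of_bool (colour i e = j)"
      by (rule mult_left_mono[OF bspec[OF \<phi>(3) e] x[OF j]])
    also have "\<dots> \<le> x (colour i e)" using x colour_less[OF i e] by auto
    finally show "\<bar>x j * \<phi> (tail (R i) e) - x j * \<phi> (head (R i) e)\<bar> \<le> x (colour i e)" .
  qed
  from rule_Lipschitz_le_dist_map[OF this] \<phi>(1,2) show ?thesis by simp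
qed

text \<open>Since the planting vertices are not adjacent, giving every inner vertex the mean of the two
  boundary values halves the difference along each arc.\<close>

lemma dist_map_ge_double:
  assumes c: "\<And>j. j < K \<Longrightarrow> c \<le> x j" and "0 \<le> c"
  shows "2 * c \<le> dist_map x i"
proof -
  define \<phi> where "\<phi> u = (if u = \<beta>m i then 0 else if u = \<beta>p i then 2 * c else c)" for u
  have "rule_Lipschitz x i \<phi>" unfolding rule_Lipschitz_def
  proof
    fix e assume e: "e \<in> arcs (R i)"
    have "\<bar>\<phi> (tail (R i) e) - \<phi> (head (R i) e)\<bar> \<le> c"
      using no_direct_arc[OF i e] \<open>0 \<le> c\<close> by (auto simp: \<phi>_def)
    with c[OF colour_less[OF i e]] show "\<bar>\<phi> (tail (R i) e) - \<phi> (head (R i) e)\<bar> \<le> x (colour i e)"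
      by linarith
  qed
  from rule_Lipschitz_le_dist_map[OF this] beta_neq[OF i] show ?thesis by (simp add: \<phi>_def)
qed

lemma dist_map_le:
  fixes B :: real
  assumes "\<And>j. j < K \<Longrightarrow> x j \<le> B"
  shows "dist_map x i \<le> rule_size * B"
proof -
  obtain \<phi> where \<phi>: "rule_Lipschitz x i \<phi>" "\<phi> (\<beta>m i) = 0" "\<phi> (\<beta>p i) = dist_map x i"
    using dist_map_attained by blast
  from rule_Lipschitz_bound[OF \<phi>(1) assms beta_plus_in[OF i] beta_minus_in[OF i]] \<phi>(2,3)
  show ?thesis by simp
qed

end

text \<open>The length acquired by an edge of colour \<open>i\<close> through \<open>k\<close>
  substitutions, if the edges of the final graph have length 1.\<close>

definition edge_len :: "nat \<Rightarrow> nat \<Rightarrow> real" where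
  "edge_len k = (dist_map ^^ k) (\<lambda>_. 1)"

definition min_len :: "nat \<Rightarrow> real" where
  "min_len k = Min (edge_len k ` {..<K})"

lemma edge_len_0 [simp]: "edge_len 0 i = 1"
  and edge_len_Suc: "edge_len (Suc k) = dist_map (edge_len k)"
  by (auto simp: edge_len_def)

lemma min_len_0 [simp]: "min_len 0 = 1"
  using K_pos by (auto simp: min_len_def image_constant_conv)

lemma min_len_le: "i < K \<Longrightarrow> min_len k \<le> edge_len k i"
  unfolding min_len_def by (rule Min_le) auto

lemma min_len_attained: "\<exists>i<K. min_len k = edge_len k i"
proof -
  have "min_len k \<in> edge_len k ` {..<K}" unfolding min_len_def using K_pos by (intro Min_in) auto
  then show ?thesis by auto
qed

lemma edge_len_pos: "i < K \<Longrightarrow> 0 < edge_len k i"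
proof (induct k arbitrary: i)
  case (Suc k)
  then have "edge_len k i \<le> edge_len (Suc k) i"
    unfolding edge_len_Suc by (intro dist_map_ge_entry) (auto intro: less_imp_le)
  with Suc(1)[OF Suc(2)] show ?case by linarith
qed simp

lemma min_len_pos: "0 < min_len k"
  using min_len_attained[of k] edge_len_pos by metis

text \<open>The two colours are independent of each other; this mixing of colours is what
  distance-positivity contributes to the comparison below.\<close>

lemma edge_len_le_Suc:
  assumes "i < K" "j < K"
  shows "edge_len k i \<le> edge_len (Suc k) j"
  unfolding edge_len_Suc using assms by (intro dist_map_ge_entry) (auto intro: less_imp_le edge_len_pos)

lemma edge_len_Suc_le:
  fixes B :: real
  assumes "i < K" "\<And>j. j < K \<Longrightarrow> edge_len k j \<le> B"
  shows "edge_len (Suc k) i \<le> rule_size * B"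
  unfolding edge_len_Suc using assms by (intro dist_map_le) (auto intro: less_imp_le edge_len_pos)

text \<open>After at least one substitution, every colour is no shorter than the longest colour one
  substitution earlier, and at most \<open>rule_size\<close> times as long. The ratio of two colours
  is thus bounded independently of \<open>k\<close>.\<close>

lemma edge_len_le_min_len:
  assumes i: "i < K"
  shows "edge_len k i \<le> rule_size * min_len k"
proof (cases k)
  case 0
  then show ?thesis using rule_size_ge_1 by simp
next
  case (Suc l)
  obtain j where j: "j < K" "min_len (Suc l) = edge_len (Suc l) j" using min_len_attained by blast
  have "edge_len (Suc l) i \<le> rule_size * edge_len (Suc l) j"
    using i by (rule edge_len_Suc_le) (rule edge_len_le_Suc[OF _ j(1)])
  then show ?thesis by (simp add: Suc j(2))
qed

lemma min_len_Suc_ge: "2 * min_len k \<le> min_len (Suc k)"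
proof -
  obtain j where j: "j < K" "min_len (Suc k) = edge_len (Suc k) j" using min_len_attained by blast
  then show ?thesis unfolding j(2) edge_len_Suc
    by (intro dist_map_ge_double) (auto intro: less_imp_le edge_len_pos min_len_pos min_len_le)
qed

lemma min_len_growth: "2 ^ l * min_len k \<le> min_len (k + l)"
proof (induct l)
  case (Suc l)
  then show ?case using min_len_Suc_ge[of "k + l"] by simp
qed simp

text \<open>One factor \<open>rule_size\<close> is the cost of a substitution, the other compares an
  arbitrary colour with the shortest one.\<close>

lemma min_len_Suc_le: "min_len (Suc k) \<le> rule_size * (rule_size * min_len k)"
proof -
  have "min_len (Suc k) \<le> edge_len (Suc k) 0" using K_pos by (intro min_len_le)
  also have "\<dots> \<le> rule_size * (rule_size * min_len k)"
    using K_pos by (intro edge_len_Suc_le edge_len_le_min_len)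
  finally show ?thesis .
qed

lemma min_len_growth_le: "min_len (k + l) \<le> real (rule_size * rule_size) ^ l * min_len k"
proof (induct l)
  case (Suc l)
  have "min_len (k + Suc l) \<le> rule_size * (rule_size * min_len (k + l))"
    unfolding add_Suc_right by (rule min_len_Suc_le)
  also have "\<dots> \<le> rule_size * (rule_size * (real (rule_size * rule_size) ^ l * min_len k))"
    using Suc by (intro mult_left_mono) auto
  finally show ?case by (simp add: algebra_simps)
qed simp

end


section \<open>Words, cells and connectivity of the iterated graphs\<close>

context eigs_system
begin

section \<open>Edges as words and vertices as their ends\<close>

abbreviation "E \<equiv> xi_arcs S"
abbreviation "V \<equiv> xi_verts S"
abbreviation "wcol \<equiv> word_colour S"
abbreviation "src w \<equiv> fst (word_ends S w)"
abbreviation "tgt w \<equiv> snd (word_ends S w)"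
abbreviation "planted w \<equiv> plant S w (word_ends S w)"
abbreviation "ends w \<equiv> {src w, tgt w}"

lemma Xi_simps [simp]:
  "verts (Xi S n) = V n" "arcs (Xi S n) = E n" "tail (Xi S n) w = src w" "head (Xi S n) w = tgt w"
  by (auto simp: Xi_def)

lemma xi_arcs_length: "w \<in> E n \<Longrightarrow> length w = n"
  by (induct n arbitrary: w) auto

lemma col_less: "w \<in> E n \<Longrightarrow> wcol w < K"
proof (induct n arbitrary: w)
  case (Suc n)
  then show ?case using colour_less by auto
qed (use init_colour_less in auto)

lemma Cons_in_xi_arcs: "e # w \<in> E n \<longleftrightarrow> n = Suc (length w) \<and> w \<in> E (length w) \<and> e \<in> arcs (R (wcol w))"
  by (cases n) (auto dest: xi_arcs_length)

lemma xi_arcs_suffix: "z @ w \<in> E n \<Longrightarrow> w \<in> E (length w)"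
  by (induct z arbitrary: n) (auto simp: Cons_in_xi_arcs dest: xi_arcs_length)

lemma finite_xi_arcs [simp]: "finite (E n)"
proof (induct n)
  case (Suc n)
  have "E (Suc n) = (\<Union>w\<in>E n. (\<lambda>e. e # w) ` arcs (R (wcol w)))" by auto
  then show ?case using Suc col_less by (auto intro!: finite_rule)
qed simp

lemma sum_xi_arcs_Suc:
  "(\<Sum>w\<in>E (Suc n). g w) = (\<Sum>w\<in>E n. \<Sum>e\<in>arcs (R (wcol w)). g (e # w))"
proof -
  have "(\<Sum>w\<in>E n. \<Sum>e\<in>arcs (R (wcol w)). g (e # w)) = (\<Sum>(w, e)\<in>Sigma (E n) (\<lambda>w. arcs (R (wcol w))). g (e # w))"
    using col_less by (intro sum.Sigma) auto
  also have "\<dots> = (\<Sum>w\<in>E (Suc n). g w)"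
    by (rule sum.reindex_bij_witness[of _ "\<lambda>w. (tl w, hd w)" "\<lambda>(w, e). e # w"]) auto
  finally show ?thesis ..
qed

lemma planted_beta_plus [simp]: "planted w (\<beta>p (wcol w)) = src w"
  by (simp add: plant_def)

lemma planted_beta_minus: "w \<in> E n \<Longrightarrow> planted w (\<beta>m (wcol w)) = tgt w"
  using beta_neq[OF col_less] by (fastforce simp: plant_def)

lemma xi_verts_mono: "m \<le> n \<Longrightarrow> V m \<subseteq> V n"
  by (rule lift_Suc_mono_le) auto

lemma finite_xi_verts [simp]: "finite (V n)"
proof (induct n)
  case (Suc n)
  have "{Inner w x | w x. w \<in> E n \<and> x \<in> verts (R (wcol w)) - {\<beta>p (wcol w), \<beta>m (wcol w)}}
    \<subseteq> (\<Union>w\<in>E n. Inner w ` verts (R (wcol w)))" by auto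
  then have "finite {Inner w x | w x. w \<in> E n \<and> x \<in> verts (R (wcol w)) - {\<beta>p (wcol w), \<beta>m (wcol w)}}"
    by (rule finite_subset) (use col_less in auto)
  with Suc show ?case by simp
qed simp

lemma planted_in: 
  assumes "w \<in> E n" "x \<in> verts (R (wcol w))" "ends w \<subseteq> V n"
  shows "planted w x \<in> V (Suc n)"
  using assms by (auto simp: plant_def)

lemma ends_in: "w \<in> E n \<Longrightarrow> ends w \<subseteq> V n"
proof (induct n arbitrary: w)
  case (Suc n)
  then obtain e u where w: "w = e # u" "u \<in> E n" "e \<in> arcs (R (wcol u))" by auto
  from planted_in[OF w(2) _ Suc(1)[OF w(2)]] show ?case
    using rule_tail_head[OF col_less[OF w(2)] w(3)] by (simp add: w(1) del: xi_verts.simps)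
qed auto

lemma planted_in_xi_verts: "w \<in> E n \<Longrightarrow> x \<in> verts (R (wcol w)) \<Longrightarrow> planted w x \<in> V (Suc n)"
  using planted_in ends_in by blast

lemma xi_verts_SucE:
  assumes "u \<in> V (Suc n)"
  obtains "u \<in> V n" | w x where "w \<in> E n" "x \<in> verts (R (wcol w))" "u = planted w x" "u = Inner w x"
  using assms by (auto simp: plant_def)

lemma Inner_in_xi_verts: "Inner w x \<in> V n \<Longrightarrow> length w < n"
  by (induct n) (auto dest: xi_arcs_length)

lemma planted_ends_of_child:
  assumes w: "w \<in> E n" and x: "x \<in> verts (R (wcol w))"
  shows "\<exists>e. e # w \<in> E (Suc n) \<and> planted w x \<in> ends (e # w)"
proof -
  obtain e where "e \<in> arcs (R (wcol w))" "x = tail (R (wcol w)) e \<or> x = head (R (wcol w)) e"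
    using incident_arc[OF col_less[OF w] x] by auto
  with w show ?thesis by (intro exI[of _ e]) auto
qed

text \<open>Every rule vertex, the planting vertices included, meets an arc of its rule graph. Hence
  a vertex that is an end of an edge stays an end of some descendant at all later levels.\<close>

lemma ends_persist:
  assumes w: "w \<in> E n" and u: "u \<in> ends w"
  shows "\<exists>e. e # w \<in> E (Suc n) \<and> u \<in> ends (e # w)"
  using planted_ends_of_child[OF w beta_plus_in[OF col_less[OF w]]]
    planted_ends_of_child[OF w beta_minus_in[OF col_less[OF w]]] u
  by (auto simp: planted_beta_minus[OF w])

lemma xi_vert_is_end: "u \<in> V n \<Longrightarrow> \<exists>w\<in>E n. u \<in> ends w"
proof (induct n arbitrary: u)
  case (Suc n)
  from Suc(2) show ?case
  proof (cases rule: xi_verts_SucE)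
    case 1
    with Suc(1) ends_persist show ?thesis by blast
  next
    case (2 w x)
    with planted_ends_of_child show ?thesis by blast
  qed
qed auto

text \<open>The cell of \<open>w\<close> consists of the ends of all descendants of
  \<open>w\<close>. The generation of the descendant is left open, since distances in the limit
  space involve all large levels.\<close>

definition in_cell :: "'e list \<Rightarrow> ('v, 'e) xvertex \<Rightarrow> bool" where
  "in_cell w u \<longleftrightarrow> (\<exists>z n. z @ w \<in> E n \<and> u \<in> ends (z @ w))"

lemma in_cell_exists:
  assumes "u \<in> all_verts S"
  shows "\<exists>w\<in>E m. in_cell w u"
proof -
  obtain k where "u \<in> V k" using assms by (auto simp: all_verts_def)
  then have "u \<in> V (max m k)" using xi_verts_mono[of k "max m k"] by auto
  then obtain w where w: "w \<in> E (max m k)" "u \<in> ends w" using xi_vert_is_end by blast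
  define z where "z = take (length w - m) w"
  define w' where "w' = drop (length w - m) w"
  have zw: "w = z @ w'" by (simp add: z_def w'_def)
  have "length w' = m" using xi_arcs_length[OF w(1)] by (simp add: w'_def)
  with xi_arcs_suffix[of z w'] w(1) zw have "w' \<in> E m" by auto
  with w zw show ?thesis unfolding in_cell_def by blast
qed

lemma in_cell_levels:
  assumes "in_cell w u"
  shows "\<exists>N\<ge>length w. \<forall>n\<ge>N. \<exists>z. z @ w \<in> E n \<and> u \<in> ends (z @ w)"
proof -
  from assms obtain z N where z: "z @ w \<in> E N" "u \<in> ends (z @ w)" by (auto simp: in_cell_def)
  have "\<exists>z. z @ w \<in> E (N + k) \<and> u \<in> ends (z @ w)" for k
  proof (induct k)
    case (Suc k)
    then obtain z where "z @ w \<in> E (N + k)" "u \<in> ends (z @ w)" by blast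
    from ends_persist[OF this] obtain e where "(e # z) @ w \<in> E (N + Suc k)" "u \<in> ends ((e # z) @ w)"
      unfolding add_Suc_right append_Cons by blast
    then show ?case by blast
  qed (use z in auto)
  then have "\<forall>n\<ge>N. \<exists>z. z @ w \<in> E n \<and> u \<in> ends (z @ w)" by (metis le_add_diff_inverse)
  moreover have "length w \<le> N" using xi_arcs_length[OF z(1)] by auto
  ultimately show ?thesis by blast
qed

lemma in_cell_in_all_verts: "in_cell w u \<Longrightarrow> u \<in> all_verts S"
  using ends_in by (fastforce simp: in_cell_def all_verts_def)

lemma Inner_in_cell:
  assumes "z @ w \<in> E n" "x \<in> verts (R (wcol (z @ w)))"
  shows "in_cell w (planted (z @ w) x)"
  using planted_ends_of_child[OF assms] unfolding in_cell_def by (metis append_Cons)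

text \<open>Chaining through the ancestors of an edge: each generation contributes one passage
  through a rule graph, in which \<open>f\<close> varies by at most \<open>rule_size * b k\<close>.
  With different \<open>b\<close> this serves both Lipschitz functions and functions of bounded
  energy.\<close>

lemma cell_oscillation:
  fixes f :: "('v, 'e) xvertex \<Rightarrow> real" and b :: "nat \<Rightarrow> real"
  assumes "z @ w \<in> E (m + length z)" "u \<in> ends (z @ w)"
    and "\<And>k. 0 \<le> b k"
    and "\<And>k w'. m \<le> k \<Longrightarrow> k \<le> m + length z \<Longrightarrow> w' \<in> E k \<Longrightarrow> \<bar>f (src w') - f (tgt w')\<bar> \<le> b k"
  shows "\<bar>f u - f (src w)\<bar> \<le> rule_size * (\<Sum>k=m..m + length z. b k)"
  using assms(1,2,4)
proof (induct z arbitrary: u)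
  case Nil
  then have "\<bar>f (src w) - f (tgt w)\<bar> \<le> b m" "u \<in> ends w" by auto
  then have "\<bar>f u - f (src w)\<bar> \<le> 1 * b m" using assms(3)[of m] by (auto simp: abs_minus_commute)
  also have "\<dots> \<le> rule_size * b m" using rule_size_ge_1 assms(3) by (intro mult_right_mono) auto
  finally show ?case by simp
next
  case (Cons e z)
  let ?n = "m + length z"
  have zw: "z @ w \<in> E ?n" and e: "e \<in> arcs (R (wcol (z @ w)))"
    using Cons(2) by (auto simp: Cons_in_xi_arcs dest: xi_arcs_length)
  note i = col_less[OF zw]
  obtain x where x: "x \<in> verts (R (wcol (z @ w)))" "u = planted (z @ w) x"
    using Cons(3) rule_tail_head[OF i e] by auto
  have "\<bar>f (src (z @ w)) - f (src w)\<bar> \<le> rule_size * (\<Sum>k=m..?n. b k)"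
    using Cons(4) by (intro Cons(1) zw) auto
  moreover have "\<bar>(f \<circ> planted (z @ w)) x - (f \<circ> planted (z @ w)) (\<beta>p (wcol (z @ w)))\<bar> \<le> rule_size * b (Suc ?n)"
  proof (rule rule_difference_bound[OF i])
    fix e' assume e': "e' \<in> arcs (R (wcol (z @ w)))"
    then have "e' # z @ w \<in> E (Suc ?n)" using zw by auto
    from Cons(4)[OF _ _ this]
    show "\<bar>(f \<circ> planted (z @ w)) (tail (R (wcol (z @ w))) e') - (f \<circ> planted (z @ w)) (head (R (wcol (z @ w))) e')\<bar>
      \<le> b (Suc ?n)" by simp
  qed (use assms(3) x beta_plus_in[OF i] in auto)
  then have "\<bar>f u - f (src (z @ w))\<bar> \<le> rule_size * b (Suc ?n)" using x(2) by simp
  ultimately have "\<bar>f u - f (src w)\<bar> \<le> rule_size * (\<Sum>k=m..?n. b k) + rule_size * b (Suc ?n)" by linarith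
  also have "\<dots> = rule_size * (\<Sum>k=m..Suc ?n. b k)" by (simp add: distrib_left)
  finally show ?case by simp
qed

section \<open>Connectivity of the iterated graphs\<close>

lemma wf_Xi: "wf_digraph (Xi S n)"
  using ends_in by unfold_locales auto

lemma Xi_reachable_sym: "u \<rightarrow>\<^sup>*\<^bsub>undir (Xi S n)\<^esub> z \<Longrightarrow> z \<rightarrow>\<^sup>*\<^bsub>undir (Xi S n)\<^esub> u"
  by (rule symmetric_reachable[OF symmetric_mk_symmetric])

lemma Xi_reachable_trans:
  "u \<rightarrow>\<^sup>*\<^bsub>undir (Xi S n)\<^esub> z \<Longrightarrow> z \<rightarrow>\<^sup>*\<^bsub>undir (Xi S n)\<^esub> x \<Longrightarrow> u \<rightarrow>\<^sup>*\<^bsub>undir (Xi S n)\<^esub> x"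
  by (rule wf_digraph.reachable_trans[OF wf_digraph.wf_undir[OF wf_Xi]])

lemma planted_reachable:
  assumes w: "w \<in> E n" and x: "x \<in> verts (R (wcol w))" and y: "y \<in> verts (R (wcol w))"
  shows "planted w x \<rightarrow>\<^sup>*\<^bsub>undir (Xi S (Suc n))\<^esub> planted w y"
  using connected_reachable[OF rule_connected[OF col_less[OF w]] x y] unfolding reachable_def[of "undir (R _)"]
proof (induct rule: rtrancl_on_induct)
  case base
  then show ?case using planted_in_xi_verts[OF w] by (simp add: reachable_def del: xi_verts.simps)
next
  case (step y z)
  then obtain e where e: "e \<in> arcs (R (wcol w))"
    "(y, z) = (tail (R (wcol w)) e, head (R (wcol w)) e) \<or> (y, z) = (head (R (wcol w)) e, tail (R (wcol w)) e)"
    by auto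
  have "e # w \<in> E (Suc n)" using w e(1) by simp
  then have "planted w y \<rightarrow>\<^bsub>undir (Xi S (Suc n))\<^esub> planted w z"
    using e(2) by (auto simp del: xi_arcs.simps intro!: bexI[of _ "e # w"])
  with step(5) show ?case
    by (rule wf_digraph.reachable_adj_trans[OF wf_digraph.wf_undir[OF wf_Xi]])
qed

lemma Xi_reachable_Suc:
  assumes "u \<rightarrow>\<^sup>*\<^bsub>undir (Xi S n)\<^esub> z"
  shows "u \<rightarrow>\<^sup>*\<^bsub>undir (Xi S (Suc n))\<^esub> z"
  using assms unfolding reachable_def[of "undir (Xi S n)"]
proof (induct rule: rtrancl_on_induct)
  case base
  then show ?case by (simp add: reachable_def)
next
  case (step y z)
  then obtain w where w: "w \<in> E n" "(y, z) = (src w, tgt w) \<or> (y, z) = (tgt w, src w)" by auto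
  have "src w \<rightarrow>\<^sup>*\<^bsub>undir (Xi S (Suc n))\<^esub> tgt w"
    using planted_reachable[OF w(1) beta_plus_in[OF col_less[OF w(1)]] beta_minus_in[OF col_less[OF w(1)]]]
    by (simp add: planted_beta_minus[OF w(1)])
  with w(2) have "y \<rightarrow>\<^sup>*\<^bsub>undir (Xi S (Suc n))\<^esub> z" using Xi_reachable_sym by blast
  with step(5) show ?case by (rule Xi_reachable_trans)
qed

lemma Xi_reachable_Root: "u \<in> V n \<Longrightarrow> Root_plus \<rightarrow>\<^sup>*\<^bsub>undir (Xi S n)\<^esub> u"
proof (induct n arbitrary: u)
  case 0
  have "(Root_plus, Root_plus) \<in> rtrancl_on (verts (undir (Xi S 0))) (arcs_ends (undir (Xi S 0)))"
    by (rule rtrancl_on_refl) simp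
  moreover from this have "(Root_plus, Root_minus) \<in> rtrancl_on (verts (undir (Xi S 0))) (arcs_ends (undir (Xi S 0)))"
    by (rule rtrancl_on_into_rtrancl_on) auto
  ultimately show ?case using 0 unfolding reachable_def by auto
next
  case (Suc n)
  from Suc(2) show ?case
  proof (cases rule: xi_verts_SucE)
    case 1
    then show ?thesis by (rule Xi_reachable_Suc[OF Suc(1)])
  next
    case (2 w x)
    have "Root_plus \<rightarrow>\<^sup>*\<^bsub>undir (Xi S (Suc n))\<^esub> src w"
      using ends_in[OF 2(1)] by (intro Xi_reachable_Suc Suc(1)) auto
    moreover have "src w \<rightarrow>\<^sup>*\<^bsub>undir (Xi S (Suc n))\<^esub> u"
      using planted_reachable[OF 2(1) beta_plus_in[OF col_less[OF 2(1)]] 2(2)] 2(3) by simp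
    ultimately show ?thesis by (rule Xi_reachable_trans)
  qed
qed

lemma Root_plus_in: "Root_plus \<in> V n" and Root_minus_in: "Root_minus \<in> V n"
  using xi_verts_mono[of 0 n] by auto

lemma Xi_connected: "Digraph_Component.connected (Xi S n)"
  unfolding Digraph_Component.connected_def strongly_connected_def
proof (intro conjI ballI)
  show "verts (undir (Xi S n)) \<noteq> {}" using Root_plus_in[of n] by auto
  fix u z assume "u \<in> verts (undir (Xi S n))" "z \<in> verts (undir (Xi S n))"
  then show "u \<rightarrow>\<^sup>*\<^bsub>undir (Xi S n)\<^esub> z"
    using Xi_reachable_trans[OF Xi_reachable_sym[OF Xi_reachable_Root] Xi_reachable_Root] by simp
qed


section \<open>Self-similar extension of functions\<close>

text \<open>\<open>\<phi> n i\<close> is a potential on the \<open>i\<close>-th rule graph with boundary values 1 and 0; its affine images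
  extend a function from the \<open>n\<close>-th to the next graph.  Minimal energy potentials give harmonic
  extensions, extremal Lipschitz potentials extend with optimal Lipschitz constant.\<close>

definition extension_step ::
    "(nat \<Rightarrow> nat \<Rightarrow> 'v \<Rightarrow> real) \<Rightarrow> nat \<Rightarrow> (('v, 'e) xvertex \<Rightarrow> real) \<Rightarrow> ('v, 'e) xvertex \<Rightarrow> real" where
  "extension_step \<phi> n f u = (case u of
     Inner w x \<Rightarrow> if length w = n then f (tgt w) + (f (src w) - f (tgt w)) * \<phi> n (wcol w) x else f u
   | _ \<Rightarrow> f u)"

primrec extension_seq ::
    "(nat \<Rightarrow> nat \<Rightarrow> 'v \<Rightarrow> real) \<Rightarrow> nat \<Rightarrow> (('v, 'e) xvertex \<Rightarrow> real) \<Rightarrow> nat \<Rightarrow> ('v, 'e) xvertex \<Rightarrow> real" where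
  "extension_seq \<phi> m h 0 = h"
| "extension_seq \<phi> m h (Suc k) = extension_step \<phi> (m + k) (extension_seq \<phi> m h k)"

lemma extension_seq_Suc_eq: "u \<in> V (m + k) \<Longrightarrow> extension_seq \<phi> m h (Suc k) u = extension_seq \<phi> m h k u"
  by (cases u) (auto simp: extension_step_def dest: Inner_in_xi_verts)

lemma extension_seq_eq:
  assumes "u \<in> V (m + k)" "k \<le> l"
  shows "extension_seq \<phi> m h l u = extension_seq \<phi> m h k u"
  using assms(2)
proof (induct l rule: dec_induct)
  case (step l)
  have "u \<in> V (m + l)" using assms(1) xi_verts_mono[of "m + k" "m + l"] step(1) by auto
  from extension_seq_Suc_eq[OF this] step(3) show ?case by simp
qed simp

text \<open>A single function satisfies the extension formula at all levels \<open>n \<ge> m\<close>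
  simultaneously, because an extension step changes no value on earlier vertices.\<close>

lemma self_similar_extension:
  fixes \<phi> :: "nat \<Rightarrow> nat \<Rightarrow> 'v \<Rightarrow> real" and h :: "('v, 'e) xvertex \<Rightarrow> real"
  assumes \<phi>: "\<And>n i. i < K \<Longrightarrow> \<phi> n i (\<beta>p i) = 1" "\<And>n i. i < K \<Longrightarrow> \<phi> n i (\<beta>m i) = 0"
  shows "\<exists>F. (\<forall>u\<in>V m. F u = h u) \<and> (\<forall>n\<ge>m. \<forall>w\<in>E n. \<forall>x\<in>verts (R (wcol w)).
    F (planted w x) = F (tgt w) + (F (src w) - F (tgt w)) * \<phi> n (wcol w) x)"
proof -
  \<comment> \<open>\<open>lev u\<close> is the generation in which \<open>u\<close> is born. Stage
    \<open>lev u\<close> has reached level \<open>m + lev u\<close>, which is late enough for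
    \<open>u\<close>, and later stages keep its value.\<close>
  define lev where "lev u = (case u of Inner w x \<Rightarrow> Suc (length w) | _ \<Rightarrow> 0)" for u :: "('v, 'e) xvertex"
  define F where "F u = extension_seq \<phi> m h (lev u) u" for u
  have F: "F u = extension_seq \<phi> m h k u" if u: "u \<in> V (m + k)" for u k
  proof (cases "lev u \<le> k")
    case True
    have "u \<in> V (lev u)" if "u \<in> V n" for n
      using that
    proof (induct n)
      case (Suc n)
      from Suc(2) show ?case
      proof (cases rule: xi_verts_SucE)
        case (2 w x)
        have "lev u = Suc n" unfolding 2(4) by (simp add: lev_def xi_arcs_length[OF 2(1)])
        with Suc(2) show ?thesis by simp
      qed (rule Suc(1))
    qed (auto simp: lev_def)
    with u have "u \<in> V (m + lev u)" using xi_verts_mono[of "lev u" "m + lev u"] by auto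
    from extension_seq_eq[OF this True] show ?thesis by (simp add: F_def)
  next
    case False
    then show ?thesis using extension_seq_eq[OF u, of "lev u"] by (simp add: F_def)
  qed
  have "F u = h u" if "u \<in> V m" for u using F[of u 0] that by simp
  moreover have "F (planted w x) = F (tgt w) + (F (src w) - F (tgt w)) * \<phi> n (wcol w) x"
    if n: "m \<le> n" and w: "w \<in> E n" and x: "x \<in> verts (R (wcol w))" for n w x
  proof -
    obtain k where k: "n = m + k" using n le_Suc_ex by blast
    note i = col_less[OF w]
    have st: "src w \<in> V (m + k)" "tgt w \<in> V (m + k)" using ends_in[OF w] k by auto
    have "planted w x \<in> V (m + Suc k)" using planted_in_xi_verts[OF w x] k by simp
    show ?thesis
    proof (cases "x = \<beta>p (wcol w) \<or> x = \<beta>m (wcol w)")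
      case True
      then show ?thesis using \<phi>[OF i] planted_beta_minus[OF w] by auto
    next
      case False
      then have "planted w x = Inner w x" by (simp add: plant_def)
      moreover have "F (planted w x) = extension_seq \<phi> m h (Suc k) (planted w x)"
        by (rule F) fact
      ultimately show ?thesis using xi_arcs_length[OF w] st by (simp add: F k extension_step_def)
    qed
  qed
  ultimately show ?thesis by blast
qed

end


section \<open>Distances in the iterated graphs\<close>

context eigs_system
begin

definition level_Lipschitz :: "nat \<Rightarrow> (nat \<Rightarrow> real) \<Rightarrow> (('v, 'e) xvertex \<Rightarrow> real) \<Rightarrow> bool" where
  "level_Lipschitz n x f \<longleftrightarrow> (\<forall>w\<in>E n. \<bar>f (src w) - f (tgt w)\<bar> \<le> x (wcol w))"

text \<open>On each planted copy \<open>f\<close> is admissible in the supremum defining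
  \<open>dist_map\<close>, which is the largest difference then possible across the replaced
  edge.\<close>

lemma level_Lipschitz_restrict:
  assumes f: "level_Lipschitz (Suc n) x f" and x: "\<And>j. j < K \<Longrightarrow> 0 \<le> x j"
  shows "level_Lipschitz n (dist_map x) f"
  unfolding level_Lipschitz_def
proof
  fix w assume w: "w \<in> E n"
  have "rule_Lipschitz x (wcol w) (f \<circ> planted w)" unfolding rule_Lipschitz_def
  proof
    fix e assume "e \<in> arcs (R (wcol w))"
    with w have "e # w \<in> E (Suc n)" by simp
    with f show "\<bar>(f \<circ> planted w) (tail (R (wcol w)) e) - (f \<circ> planted w) (head (R (wcol w)) e)\<bar>
      \<le> x (colour (wcol w) e)"
      unfolding level_Lipschitz_def by fastforce
  qed
  from rule_Lipschitz_le_dist_map[OF col_less[OF w] x this]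
  show "\<bar>f (src w) - f (tgt w)\<bar> \<le> dist_map x (wcol w)" by (simp add: planted_beta_minus[OF w])
qed

lemma level_Lipschitz_edge_len:
  assumes "level_Lipschitz (n + k) (\<lambda>_. 1) f"
  shows "level_Lipschitz n (edge_len k) f"
  using assms
proof (induct k arbitrary: n)
  case 0
  have "edge_len 0 = (\<lambda>_. 1)" by auto
  with 0 show ?case by simp
next
  case (Suc k)
  then have "level_Lipschitz (Suc n) (edge_len k) f" by simp
  then show ?case unfolding edge_len_Suc
    by (rule level_Lipschitz_restrict) (auto intro: less_imp_le edge_len_pos)
qed

text \<open>Doubling makes this a geometric sum, dominated by its coarsest term
  \<open>k = m\<close>.\<close>

lemma sum_min_len_le: "(\<Sum>k=m..m + l. min_len (m + l - k)) \<le> 2 * min_len l"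
proof (induct l)
  case 0
  then show ?case using min_len_pos[of 0] by simp
next
  case (Suc l)
  have "(\<Sum>k=m..m + Suc l. min_len (m + Suc l - k)) = min_len (Suc l) + (\<Sum>k=m..m + l. min_len (m + l - k))"
  proof -
    have "(\<Sum>k=m..m + Suc l. min_len (m + Suc l - k)) = (\<Sum>k=0..Suc l. min_len (Suc l - k))"
      by (rule sum.reindex_bij_witness[of _ "\<lambda>k. m + k" "\<lambda>k. k - m"]) (auto simp: add.commute)
    also have "\<dots> = min_len (Suc l) + (\<Sum>k=0..l. min_len (l - k))"
      by (simp add: sum.atLeast0_atMost_Suc_shift del: sum.cl_ivl_Suc)
    also have "(\<Sum>k=0..l. min_len (l - k)) = (\<Sum>k=m..m + l. min_len (m + l - k))"
      by (rule sum.reindex_bij_witness[of _ "\<lambda>k. k - m" "\<lambda>k. m + k"]) auto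
    finally show ?thesis .
  qed
  with Suc min_len_Suc_ge[of l] show ?case by linarith
qed

text \<open>The 4 collects a factor 2 from \<open>sum_min_len_le\<close> and a factor 2 from
  comparing two vertices through \<open>src w\<close>. Of the two factors \<open>rule_size\<close>,
  one is for crossing rule graphs and one for replacing \<open>edge_len\<close> by
  \<open>min_len\<close>.\<close>

definition cell_const :: real where
  "cell_const = 4 * real (rule_size * rule_size)"

lemma cell_const_pos: "0 < cell_const"
  using rule_size_ge_1 by (simp add: cell_const_def)

lemma Lipschitz_on_cell:
  assumes f: "level_Lipschitz n (\<lambda>_. 1) f"
    and z: "z @ w \<in> E n" "u \<in> ends (z @ w)" and n: "n = m + length z"
  shows "\<bar>f u - f (src w)\<bar> \<le> cell_const / 2 * min_len (n - m)"
proof -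
  have "\<bar>f (src w') - f (tgt w')\<bar> \<le> rule_size * min_len (n - k)" if k: "m \<le> k" "k \<le> n" and w': "w' \<in> E k" for k w'
  proof -
    have "level_Lipschitz k (edge_len (n - k)) f"
      by (rule level_Lipschitz_edge_len) (use f k in simp)
    with w' have "\<bar>f (src w') - f (tgt w')\<bar> \<le> edge_len (n - k) (wcol w')" by (auto simp: level_Lipschitz_def)
    also have "\<dots> \<le> rule_size * min_len (n - k)" by (rule edge_len_le_min_len[OF col_less[OF w']])
    finally show ?thesis .
  qed
  then have "\<bar>f u - f (src w)\<bar> \<le> rule_size * (\<Sum>k=m..m + length z. rule_size * min_len (n - k))"
    using z n by (intro cell_oscillation[where z = z and w = w]) (auto intro!: mult_nonneg_nonneg less_imp_le[OF min_len_pos])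
  also have "\<dots> = real (rule_size * rule_size) * (\<Sum>k=m..m + length z. min_len (n - k))"
    by (simp add: sum_distrib_left mult.assoc)
  also have "\<dots> \<le> real (rule_size * rule_size) * (2 * min_len (n - m))"
    using sum_min_len_le[of m "length z"] n by (intro mult_left_mono) auto
  finally show ?thesis by (simp add: cell_const_def)
qed

lemma gdist_cell_le:
  assumes z: "z @ w \<in> E n" "u \<in> ends (z @ w)" and z': "z' @ w \<in> E n" "u' \<in> ends (z' @ w)"
    and w: "w \<in> E m"
  shows "real (gdist (Xi S n) u u') \<le> cell_const * min_len (n - m)"
proof (rule wf_digraph.gdist_le_if_Lipschitz_bound[OF wf_Xi Xi_connected])
  show "u \<in> verts (Xi S n)" "u' \<in> verts (Xi S n)" using z z' ends_in by auto
  fix f :: "('v, 'e) xvertex \<Rightarrow> real"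
  assume "\<forall>e\<in>arcs (Xi S n). \<bar>f (tail (Xi S n) e) - f (head (Xi S n) e)\<bar> \<le> 1"
  then have f: "level_Lipschitz n (\<lambda>_. 1) f" by (simp add: level_Lipschitz_def)
  have "n = m + length z" "n = m + length z'" using xi_arcs_length[OF z(1)] xi_arcs_length[OF z'(1)]
    xi_arcs_length[OF w] by auto
  from Lipschitz_on_cell[OF f z this(1)] Lipschitz_on_cell[OF f z' this(2)]
  show "\<bar>f u - f u'\<bar> \<le> cell_const * min_len (n - m)" by linarith
qed

text \<open>The extremal functions of \<open>dist_map\<close>, scaled to boundary values 1 and 0,
  extend with the optimal constant. The added term is a multiple of the difference at the two ends,
  so a cell with equal end values receives a constant; this last clause is what separates disjoint
  cells.\<close>

lemma Lipschitz_extension: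
  assumes h: "level_Lipschitz m (edge_len k) h"
  shows "\<exists>F. level_Lipschitz (m + k) (\<lambda>_. 1) F \<and> (\<forall>u\<in>V m. F u = h u) \<and>
    (\<forall>z w u. z @ w \<in> E (m + k) \<longrightarrow> w \<in> E m \<longrightarrow> h (src w) = h (tgt w) \<longrightarrow> u \<in> ends (z @ w) \<longrightarrow> F u = h (src w))"
proof -
  have "\<forall>k i. \<exists>\<phi>. i < K \<longrightarrow> rule_Lipschitz (edge_len k) i \<phi> \<and> \<phi> (\<beta>m i) = 0 \<and> \<phi> (\<beta>p i) = edge_len (Suc k) i"
    unfolding edge_len_Suc using dist_map_attained edge_len_pos less_imp_le by metis
  then obtain \<psi> :: "nat \<Rightarrow> nat \<Rightarrow> 'v \<Rightarrow> real" where \<psi>: "\<And>k i. i < K \<Longrightarrow> rule_Lipschitz (edge_len k) i (\<psi> k i)"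
    "\<And>k i. i < K \<Longrightarrow> \<psi> k i (\<beta>m i) = 0" "\<And>k i. i < K \<Longrightarrow> \<psi> k i (\<beta>p i) = edge_len (Suc k) i"
    by metis
  \<comment> \<open>In passing from level \<open>n\<close> to level \<open>Suc n\<close>, there
    remain \<open>m + k - Suc n\<close> substitutions, which fixes the lengths to be respected by
    the new arcs; the divisor is the length of the replaced edge.\<close>
  define \<phi> where "\<phi> n i x = \<psi> (m + k - Suc n) i x / edge_len (Suc (m + k - Suc n)) i" for n i x
  have "\<phi> n i (\<beta>p i) = 1" "\<phi> n i (\<beta>m i) = 0" if "i < K" for n i
    using \<psi>[OF that] edge_len_pos[OF that, of "Suc (m + k - Suc n)"] by (auto simp: \<phi>_def)
  from self_similar_extension[of \<phi>, OF this] obtain F where F: "\<And>u. u \<in> V m \<Longrightarrow> F u = h u"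
    "\<And>n w x. m \<le> n \<Longrightarrow> w \<in> E n \<Longrightarrow> x \<in> verts (R (wcol w)) \<Longrightarrow>
      F (planted w x) = F (tgt w) + (F (src w) - F (tgt w)) * \<phi> n (wcol w) x" by metis
  have lip: "level_Lipschitz (m + l) (edge_len (k - l)) F" if "l \<le> k" for l
    using that
  proof (induct l)
    case 0
    have "F u = h u" if "w \<in> E m" "u \<in> ends w" for u w using F(1) ends_in that by blast
    then have "F (src w) = h (src w)" "F (tgt w) = h (tgt w)" if "w \<in> E m" for w using that by blast+
    with h show ?case by (simp add: level_Lipschitz_def)
  next
    case (Suc l)
    show ?case unfolding level_Lipschitz_def
    proof
      fix w' assume "w' \<in> E (m + Suc l)"
      then obtain e w where w': "w' = e # w" and w: "w \<in> E (m + l)" and e: "e \<in> arcs (R (wcol w))" by auto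
      note i = col_less[OF w]
      let ?d = "F (src w) - F (tgt w)" and ?L = "edge_len (k - l) (wcol w)"
      have kl: "k - l = Suc (k - Suc l)" and mk: "m + k - Suc (m + l) = k - Suc l" using Suc(2) by auto
      have d: "\<bar>?d\<bar> \<le> ?L" using Suc w by (simp add: level_Lipschitz_def)
      have L: "0 < ?L" by (rule edge_len_pos[OF i])
      have \<psi>e: "\<bar>\<psi> (k - Suc l) (wcol w) (tail (R (wcol w)) e) - \<psi> (k - Suc l) (wcol w) (head (R (wcol w)) e)\<bar>
        \<le> edge_len (k - Suc l) (wcol w')"
        using \<psi>(1)[OF i] e by (simp add: rule_Lipschitz_def w')
      have "F (src w') - F (tgt w') =
        ?d * (\<phi> (m + l) (wcol w) (tail (R (wcol w)) e) - \<phi> (m + l) (wcol w) (head (R (wcol w)) e))"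
        using F(2)[OF _ w] rule_tail_head[OF i e] by (simp add: w' right_diff_distrib)
      also have "\<dots> = ?d / ?L *
        (\<psi> (k - Suc l) (wcol w) (tail (R (wcol w)) e) - \<psi> (k - Suc l) (wcol w) (head (R (wcol w)) e))"
        by (simp only: \<phi>_def mk kl[symmetric] times_divide_eq_right times_divide_eq_left
          diff_divide_distrib[symmetric] right_diff_distrib[symmetric])
      finally have "\<bar>F (src w') - F (tgt w')\<bar> = \<bar>?d\<bar> / ?L *
        \<bar>\<psi> (k - Suc l) (wcol w) (tail (R (wcol w)) e) - \<psi> (k - Suc l) (wcol w) (head (R (wcol w)) e)\<bar>"
        using L by (simp add: abs_mult)
      also have "\<dots> \<le> 1 * edge_len (k - Suc l) (wcol w')"
        using d L \<psi>e by (intro mult_mono) auto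
      finally show "\<bar>F (src w') - F (tgt w')\<bar> \<le> edge_len (k - Suc l) (wcol w')" by simp
    qed
  qed
  have const: "F u' = h (src w)" if "z' @ w \<in> E (m + length z')" and w: "w \<in> E m"
    and hw: "h (src w) = h (tgt w)" and "u' \<in> ends (z' @ w)" for z' w u'
    using that(1,4)
  proof (induct z' arbitrary: u')
    case Nil
    then show ?case using F(1) ends_in[OF w] hw by auto
  next
    case (Cons e z')
    have zw: "z' @ w \<in> E (m + length z')" and e: "e \<in> arcs (R (wcol (z' @ w)))"
      using Cons(2) by (auto simp: Cons_in_xi_arcs dest: xi_arcs_length)
    obtain x where x: "x \<in> verts (R (wcol (z' @ w)))" "u' = planted (z' @ w) x"
      using Cons(3) rule_tail_head[OF col_less[OF zw] e] by auto
    have "F (src (z' @ w)) = h (src w)" "F (tgt (z' @ w)) = h (src w)" using Cons(1)[OF zw] by auto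
    then show ?case using F(2)[OF _ zw x(1)] x(2) by simp
  qed
  have len: "length z = k" if "z @ w \<in> E (m + k)" "w \<in> E m" for z w
    using xi_arcs_length[OF that(1)] xi_arcs_length[OF that(2)] by simp
  show ?thesis
  proof (intro exI[of _ F] conjI allI impI ballI)
    have "edge_len 0 = (\<lambda>_. 1)" by auto
    with lip[of k] show "level_Lipschitz (m + k) (\<lambda>_. 1) F" by simp
    show "F u = h u" if "u \<in> V m" for u by (rule F(1)[OF that])
    show "F u = h (src w)" if "z @ w \<in> E (m + k)" "w \<in> E m" "h (src w) = h (tgt w)" "u \<in> ends (z @ w)"
      for z w u using const[of z w u] len[OF that(1,2)] that by simp
  qed
qed

lemma gdist_ge_Lipschitz:
  assumes "level_Lipschitz n (\<lambda>_. 1) f" "u \<in> V n" "u' \<in> V n"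
  shows "\<bar>f u - f u'\<bar> \<le> gdist (Xi S n) u u'"
  by (rule wf_digraph.difference_le_gdist[OF wf_Xi Xi_connected])
    (use assms in \<open>auto simp: level_Lipschitz_def\<close>)

lemma gdist_Root_ge: "min_len n \<le> gdist (Xi S n) Root_plus Root_minus"
proof -
  define h :: "('v, 'e) xvertex \<Rightarrow> real" where "h u = (if u = Root_plus then edge_len n (init_colour S) else 0)" for u
  have "level_Lipschitz 0 (edge_len n) h"
    using edge_len_pos[OF init_colour_less, of n] by (simp add: level_Lipschitz_def h_def)
  from Lipschitz_extension[OF this] obtain F where F: "level_Lipschitz n (\<lambda>_. 1) F" "\<forall>u\<in>V 0. F u = h u"
    by auto
  have "edge_len n (init_colour S) = \<bar>F Root_plus - F Root_minus\<bar>"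
    using F(2) edge_len_pos[OF init_colour_less, of n] by (simp add: h_def)
  also have "\<dots> \<le> gdist (Xi S n) Root_plus Root_minus"
    by (rule gdist_ge_Lipschitz[OF F(1) Root_plus_in Root_minus_in])
  finally show ?thesis using min_len_le[OF init_colour_less, of n] by linarith
qed

text \<open>The test function is 0 at the ends of \<open>w\<close> and \<open>min_len k\<close> at
  all other level \<open>m\<close> vertices. Being a minimum over colours, this value is an
  admissible difference across any edge, and the extension is constant on both cells.\<close>

lemma gdist_separated_cells:
  assumes z: "z @ w \<in> E (m + k)" "u \<in> ends (z @ w)" and z': "z' @ w' \<in> E (m + k)" "u' \<in> ends (z' @ w')"
    and w: "w \<in> E m" "w' \<in> E m" and disj: "ends w \<inter> ends w' = {}"
  shows "min_len k \<le> gdist (Xi S (m + k)) u u'"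
proof -
  define h :: "('v, 'e) xvertex \<Rightarrow> real" where "h x = (if x \<in> ends w then 0 else min_len k)" for x
  have "level_Lipschitz m (edge_len k) h" unfolding level_Lipschitz_def
  proof
    fix w assume "w \<in> E m"
    have "\<bar>h (src w) - h (tgt w)\<bar> \<le> min_len k" using min_len_pos[of k] by (simp add: h_def)
    with min_len_le[OF col_less[OF \<open>w \<in> E m\<close>], of k]
    show "\<bar>h (src w) - h (tgt w)\<bar> \<le> edge_len k (wcol w)" by linarith
  qed
  from Lipschitz_extension[OF this] obtain F where F: "level_Lipschitz (m + k) (\<lambda>_. 1) F"
    "\<And>z w u. z @ w \<in> E (m + k) \<Longrightarrow> w \<in> E m \<Longrightarrow> h (src w) = h (tgt w) \<Longrightarrow> u \<in> ends (z @ w) \<Longrightarrow> F u = h (src w)"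
    by metis
  have "h (src w) = 0" "h (tgt w) = 0" by (auto simp: h_def)
  then have "F u = 0" using F(2)[OF z(1) w(1) _ z(2)] by simp
  moreover have "h (src w') = min_len k" "h (tgt w') = min_len k" using disj by (auto simp: h_def)
  then have "F u' = min_len k" using F(2)[OF z'(1) w(2) _ z'(2)] by simp
  ultimately have "min_len k = \<bar>F u - F u'\<bar>" using min_len_pos[of k] by simp
  also have "\<dots> \<le> gdist (Xi S (m + k)) u u'"
    by (rule gdist_ge_Lipschitz[OF F(1)]) (use z z' ends_in in auto)
  finally show ?thesis .
qed

lemma gdist_le_gdiam: "u \<in> V n \<Longrightarrow> u' \<in> V n \<Longrightarrow> gdist (Xi S n) u u' \<le> gdiam (Xi S n)"
  unfolding gdiam_def by (rule Max_ge) auto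

lemma gdiam_ge: "min_len n \<le> gdiam (Xi S n)"
  using gdist_Root_ge[of n] gdist_le_gdiam[OF Root_plus_in[of n] Root_minus_in[of n]] by linarith

lemma gdiam_le: "gdiam (Xi S n) \<le> cell_const * min_len n"
proof -
  have "gdiam (Xi S n) \<in> (\<lambda>(u, w). gdist (Xi S n) u w) ` (verts (Xi S n) \<times> verts (Xi S n))"
    unfolding gdiam_def using Root_plus_in[of n] by (intro Max_in) auto
  then obtain u u' where u: "u \<in> V n" "u' \<in> V n" "gdiam (Xi S n) = gdist (Xi S n) u u'" by auto
  \<comment> \<open>The whole graph is the cell of the empty word, so the estimate for cells at
    level 0 bounds the diameter.\<close>
  obtain z z' where "z @ [] \<in> E n" "u \<in> ends (z @ [])" "z' @ [] \<in> E n" "u' \<in> ends (z' @ [])"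
    using xi_vert_is_end[OF u(1)] xi_vert_is_end[OF u(2)] by (metis append_Nil2)
  from gdist_cell_le[OF this, of 0] u(3) show ?thesis by simp
qed

end


section \<open>The limit space\<close>

locale eigs_limit = eigs_system S for S :: "('v, 'e) eigs" +
  fixes \<iota> :: "('v, 'e) xvertex \<Rightarrow> 'x::complete_space"
  assumes limit_space: "is_limit_space S \<iota>"
begin

lemma normalised_dist_lim:
  "u \<in> all_verts S \<Longrightarrow> u' \<in> all_verts S \<Longrightarrow> (\<lambda>n. normalised_dist S n u u') \<longlonglongrightarrow> dist (\<iota> u) (\<iota> u')"
  and iota_dense: "closure (\<iota> ` all_verts S) = UNIV"
  using limit_space by (auto simp: is_limit_space_def)

lemma dist_cell_le:
  assumes w: "w \<in> E m" and u: "in_cell w u" "in_cell w u'"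
  shows "dist (\<iota> u) (\<iota> u') \<le> cell_const / 2 ^ m"
proof (rule LIMSEQ_le_const2[OF normalised_dist_lim[OF u[THEN in_cell_in_all_verts]]])
  obtain N where N: "length w \<le> N" "\<And>n. n \<ge> N \<Longrightarrow> \<exists>z. z @ w \<in> E n \<and> u \<in> ends (z @ w)"
    using in_cell_levels[OF u(1)] by blast
  obtain N' where N': "\<And>n. n \<ge> N' \<Longrightarrow> \<exists>z. z @ w \<in> E n \<and> u' \<in> ends (z @ w)"
    using in_cell_levels[OF u(2)] by blast
  show "\<exists>N. \<forall>n\<ge>N. normalised_dist S n u u' \<le> cell_const / 2 ^ m"
  proof (intro exI[of _ "max N N'"] allI impI)
    fix n assume n: "n \<ge> max N N'"
    obtain z z' where z: "z @ w \<in> E n" "u \<in> ends (z @ w)" "z' @ w \<in> E n" "u' \<in> ends (z' @ w)"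
      using N(2)[of n] N'[of n] n by auto
    have mn: "m \<le> n" using N(1) n xi_arcs_length[OF w] by simp
    have "real (gdist (Xi S n) u u') \<le> cell_const * min_len (n - m)" by (rule gdist_cell_le[OF z w])
    also have "min_len (n - m) \<le> min_len n / 2 ^ m"
      using min_len_growth[of m "n - m"] mn by (simp add: field_simps)
    also have "\<dots> \<le> gdiam (Xi S n) / 2 ^ m" by (intro divide_right_mono gdiam_ge) simp
    finally have "real (gdist (Xi S n) u u') \<le> cell_const * (gdiam (Xi S n) / 2 ^ m)"
      using cell_const_pos by simp
    moreover have "0 < real (gdiam (Xi S n))" using gdiam_ge[of n] min_len_pos[of n] by linarith
    ultimately show "normalised_dist S n u u' \<le> cell_const / 2 ^ m"
      by (simp add: normalised_dist_def field_simps)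
  qed
qed

text \<open>\<open>cell_const\<close> compares the diameter with \<open>min_len n\<close>, and
  \<open>rule_size * rule_size\<close> bounds the growth of \<open>min_len\<close> over each of the
  \<open>m\<close> levels from \<open>n - m\<close> to \<open>n\<close>.\<close>

definition separation :: "nat \<Rightarrow> real" where
  "separation m = 1 / (cell_const * real (rule_size * rule_size) ^ m)"

lemma separation_pos: "0 < separation m"
  using cell_const_pos rule_size_ge_1 by (simp add: separation_def)

lemma dist_separated_cells:
  assumes w: "w \<in> E m" "w' \<in> E m" and u: "in_cell w u" "in_cell w' u'" and disj: "ends w \<inter> ends w' = {}"
  shows "separation m \<le> dist (\<iota> u) (\<iota> u')"
proof (rule LIMSEQ_le_const[OF normalised_dist_lim[OF u[THEN in_cell_in_all_verts]]])
  obtain N where N: "length w \<le> N" "\<And>n. n \<ge> N \<Longrightarrow> \<exists>z. z @ w \<in> E n \<and> u \<in> ends (z @ w)"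
    using in_cell_levels[OF u(1)] by blast
  obtain N' where N': "\<And>n. n \<ge> N' \<Longrightarrow> \<exists>z. z @ w' \<in> E n \<and> u' \<in> ends (z @ w')"
    using in_cell_levels[OF u(2)] by blast
  show "\<exists>N. \<forall>n\<ge>N. separation m \<le> normalised_dist S n u u'"
  proof (intro exI[of _ "max N N'"] allI impI)
    fix n assume n: "n \<ge> max N N'"
    obtain k where k: "n = m + k" using N(1) n xi_arcs_length[OF w(1)] le_Suc_ex[of m n] by auto
    obtain z z' where "z @ w \<in> E (m + k)" "u \<in> ends (z @ w)" "z' @ w' \<in> E (m + k)" "u' \<in> ends (z' @ w')"
      using N(2)[of n] N'[of n] n k by auto
    from gdist_separated_cells[OF this w disj]
    have g: "min_len k \<le> gdist (Xi S n) u u'" by (simp add: k)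
    have "separation m * gdiam (Xi S n) \<le> separation m * (cell_const * min_len n)"
      using separation_pos[of m] by (intro mult_left_mono gdiam_le) simp
    also have "\<dots> \<le> separation m * (cell_const * (real (rule_size * rule_size) ^ m * min_len k))"
      using separation_pos[of m] cell_const_pos min_len_growth_le[of k m]
      by (intro mult_left_mono) (auto simp: k add.commute)
    also have "\<dots> = min_len k" using cell_const_pos rule_size_ge_1 by (simp add: separation_def)
    finally have "separation m * gdiam (Xi S n) \<le> gdist (Xi S n) u u'" using g by linarith
    moreover have "0 < real (gdiam (Xi S n))" using gdiam_ge[of n] min_len_pos[of n] by linarith
    ultimately show "separation m \<le> normalised_dist S n u u'"
      by (simp add: normalised_dist_def field_simps)
  qed
qed

end


section \<open>The limit measure has full support\<close>

context eigs_system
begin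

section \<open>Counting the edges and vertices of a cell\<close>

primrec word_count :: "nat \<Rightarrow> nat \<Rightarrow> nat" where
  "word_count 0 i = 1"
| "word_count (Suc k) i = (\<Sum>e\<in>arcs (R i). word_count k (colour i e))"

lemma finite_extensions: "finite {z. z @ w \<in> E n}"
  using finite_vimageI[OF finite_xi_arcs, of "\<lambda>z. z @ w" n] by (simp add: inj_on_def vimage_def)

lemma card_extensions: "w \<in> E m \<Longrightarrow> card {z. z @ w \<in> E (m + k)} = word_count k (wcol w)"
proof (induct k arbitrary: w m)
  case 0
  have "{z. z @ w \<in> E (m + 0)} = {[]}"
  proof -
    have "z = []" if "z @ w \<in> E m" for z using xi_arcs_length[OF that] xi_arcs_length[OF 0] by simp
    then show ?thesis using 0 by auto
  qed
  then show ?case by simp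
next
  case (Suc k)
  let ?A = "arcs (R (wcol w))"
  have len: "length z = Suc k" if "z @ w \<in> E (m + Suc k)" for z
    using xi_arcs_length[OF that] xi_arcs_length[OF Suc(2)] by simp
  have mem: "z @ [e] \<in> {z. z @ w \<in> E (m + Suc k)} \<longleftrightarrow> e \<in> ?A \<and> z @ e # w \<in> E (Suc m + k)" for z e
    using xi_arcs_suffix[of z "e # w" "Suc m + k"] by (auto simp: Cons_in_xi_arcs)
  \<comment> \<open>Words list the latest arc first whereas \<open>word_count\<close> unfolds the
    earliest substitution, so the recursion splits off the last letter of \<open>z\<close>.\<close>
  have eq: "{z. z @ w \<in> E (m + Suc k)} = (\<Union>e\<in>?A. (\<lambda>z. z @ [e]) ` {z. z @ e # w \<in> E (Suc m + k)})"
  proof (intro equalityI subsetI)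
    fix z assume z: "z \<in> {z. z @ w \<in> E (m + Suc k)}"
    then have "length z = Suc k" by (intro len) (simp del: xi_arcs.simps)
    then have "z \<noteq> []" by auto
    then have "z = butlast z @ [last z]" by simp
    with z mem show "z \<in> (\<Union>e\<in>?A. (\<lambda>z. z @ [e]) ` {z. z @ e # w \<in> E (Suc m + k)})"
      by (metis (no_types, lifting) UN_I image_eqI mem_Collect_eq)
  qed (use mem in auto)
  have "card {z. z @ w \<in> E (m + Suc k)} = (\<Sum>e\<in>?A. card ((\<lambda>z. z @ [e]) ` {z. z @ e # w \<in> E (Suc m + k)}))"
    unfolding eq using col_less[OF Suc(2)]
    by (intro card_UN_disjoint) (auto intro!: finite_imageI finite_extensions simp del: xi_arcs.simps)
  also have "\<dots> = (\<Sum>e\<in>?A. word_count k (colour (wcol w) e))"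
  proof (rule sum.cong)
    fix e assume "e \<in> ?A"
    with Suc(2) have "e # w \<in> E (Suc m)" by simp
    from Suc(1)[OF this] show "card ((\<lambda>z. z @ [e]) ` {z. z @ e # w \<in> E (Suc m + k)}) = word_count k (colour (wcol w) e)"
      by (subst card_image) (auto simp: inj_on_def simp del: xi_arcs.simps)
  qed simp
  finally show ?case by simp
qed

lemma word_count_le_Suc:
  assumes "i < K" "j < K"
  shows "word_count k j \<le> word_count (Suc k) i"
proof -
  obtain e where e: "e \<in> arcs (R i)" "colour i e = j" using colour_occurs[OF assms] by blast
  then show ?thesis using member_le_sum[of e "arcs (R i)" "\<lambda>e. word_count k (colour i e)"] assms(1) by auto
qed

text \<open>The mechanism of \<open>edge_len_le_min_len\<close> again: each of the at most
  \<open>rule_size\<close> arcs of rule \<open>j\<close> has no more descendants in one generation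
  fewer than an edge of colour \<open>i\<close> has in \<open>k\<close> generations.\<close>

lemma word_count_comparable:
  assumes "i < K" "j < K"
  shows "word_count k j \<le> rule_size * word_count k i"
proof (cases k)
  case (Suc l)
  have "word_count k j \<le> (\<Sum>e\<in>arcs (R j). word_count k i)"
    unfolding Suc word_count.simps(2)[of l j]
    by (intro sum_mono word_count_le_Suc assms(1) colour_less[OF assms(2)])
  also have "\<dots> \<le> rule_size * word_count k i"
    using card_arcs_le[OF assms(2)] by simp
  finally show ?thesis .
qed (use rule_size_ge_1 in simp)

lemma card_xi_arcs_le:
  assumes w: "w \<in> E m"
  shows "card (E (m + k)) \<le> card (E m) * (rule_size * word_count k (wcol w))"
proof -
  have "E (m + k) \<subseteq> (\<Union>w\<in>E m. (\<lambda>z. z @ w) ` {z. z @ w \<in> E (m + k)})"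
  proof
    fix w' assume w': "w' \<in> E (m + k)"
    have split: "w' = take k w' @ drop k w'" by simp
    moreover have "length (drop k w') = m" using xi_arcs_length[OF w'] by simp
    then have "drop k w' \<in> E m" using xi_arcs_suffix[of "take k w'" "drop k w'"] w' by auto
    ultimately show "w' \<in> (\<Union>w\<in>E m. (\<lambda>z. z @ w) ` {z. z @ w \<in> E (m + k)})"
      using w' by (intro UN_I[of "drop k w'"] image_eqI[of _ _ "take k w'"]) auto
  qed
  then have "card (E (m + k)) \<le> card (\<Union>w\<in>E m. (\<lambda>z. z @ w) ` {z. z @ w \<in> E (m + k)})"
    by (intro card_mono) (auto intro!: finite_imageI finite_extensions)
  also have "\<dots> \<le> (\<Sum>w\<in>E m. card ((\<lambda>z. z @ w) ` {z. z @ w \<in> E (m + k)}))"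
    by (rule card_UN_le) simp
  also have "\<dots> \<le> (\<Sum>w'\<in>E m. rule_size * word_count k (wcol w))"
  proof (rule sum_mono)
    fix w' assume w': "w' \<in> E m"
    have "card ((\<lambda>z. z @ w') ` {z. z @ w' \<in> E (m + k)}) \<le> card {z. z @ w' \<in> E (m + k)}"
      by (rule card_image_le[OF finite_extensions])
    also have "\<dots> = word_count k (wcol w')" by (rule card_extensions[OF w'])
    also have "\<dots> \<le> rule_size * word_count k (wcol w)"
      by (rule word_count_comparable[OF col_less[OF w] col_less[OF w']])
    finally show "card ((\<lambda>z. z @ w') ` {z. z @ w' \<in> E (m + k)}) \<le> rule_size * word_count k (wcol w)" .
  qed
  finally show ?thesis by simp
qed

lemma card_xi_verts_Suc_le: "card (V (Suc n)) \<le> 2 * (rule_size * card (E n))"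
proof -
  have "V (Suc n) \<subseteq> (\<lambda>w. src w) ` E (Suc n) \<union> (\<lambda>w. tgt w) ` E (Suc n)"
    using xi_vert_is_end[of _ "Suc n"] by (auto simp del: xi_verts.simps xi_arcs.simps)
  then have "card (V (Suc n)) \<le> card ((\<lambda>w. src w) ` E (Suc n) \<union> (\<lambda>w. tgt w) ` E (Suc n))"
    by (intro card_mono) (auto simp del: xi_verts.simps xi_arcs.simps)
  also have "\<dots> \<le> card ((\<lambda>w. src w) ` E (Suc n)) + card ((\<lambda>w. tgt w) ` E (Suc n))" by (rule card_Un_le)
  also have "\<dots> \<le> card (E (Suc n)) + card (E (Suc n))"
    by (intro add_mono card_image_le finite_xi_arcs)
  also have "card (E (Suc n)) \<le> rule_size * card (E n)"
  proof -
    have "card (E (Suc n)) = (\<Sum>w\<in>E n. card (arcs (R (wcol w))))"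
      using sum_xi_arcs_Suc[of "\<lambda>_. 1 :: nat" n] by simp
    also have "\<dots> \<le> (\<Sum>w\<in>E n. rule_size)" by (intro sum_mono card_arcs_le col_less)
    finally show ?thesis by (simp add: mult.commute del: xi_arcs.simps)
  qed
  finally show ?thesis by simp
qed

text \<open>Each descendant of \<open>w\<close> creates an inner vertex when it is replaced. These
  vertices are distinct because \<open>Inner\<close> records the word, and they appear one level
  later, hence the \<open>Suc\<close>.\<close>

lemma card_cell_ge:
  assumes w: "w \<in> E m"
  shows "word_count k (wcol w) \<le> card {u \<in> V (Suc (m + k)). in_cell w u}"
proof -
  have "\<forall>i. \<exists>x. i < K \<longrightarrow> x \<in> verts (R i) \<and> x \<noteq> \<beta>p i \<and> x \<noteq> \<beta>m i" using inner_vertex_exists by blast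
  then obtain x where x: "\<And>i. i < K \<Longrightarrow> x i \<in> verts (R i) \<and> x i \<noteq> \<beta>p i \<and> x i \<noteq> \<beta>m i" by metis
  define g where "g z = Inner (z @ w) (x (wcol (z @ w)))" for z
  have "word_count k (wcol w) = card (g ` {z. z @ w \<in> E (m + k)})"
    using card_extensions[OF w] by (subst card_image) (auto simp: g_def inj_on_def)
  also have "\<dots> \<le> card {u \<in> V (Suc (m + k)). in_cell w u}"
  proof (rule card_mono)
    show "g ` {z. z @ w \<in> E (m + k)} \<subseteq> {u \<in> V (Suc (m + k)). in_cell w u}"
    proof safe
      fix z assume z: "z @ w \<in> E (m + k)"
      note xz = x[OF col_less[OF z]]
      then have g: "g z = planted (z @ w) (x (wcol (z @ w)))" by (simp add: g_def plant_def)
      show "g z \<in> V (Suc (m + k))" "in_cell w (g z)" unfolding g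
        using xz planted_in_xi_verts[OF z] Inner_in_cell[OF z] by blast+
    qed
  qed (use finite_xi_verts in \<open>simp del: xi_verts.simps\<close>)
  finally show ?thesis .
qed

lemma cell_fraction:
  assumes w: "w \<in> E m"
  shows "\<exists>c::real. c > 0 \<and> (\<forall>k. c * card (V (Suc (m + k))) \<le> card {u \<in> V (Suc (m + k)). in_cell w u})"
proof -
  \<comment> \<open>\<open>2 * rule_size\<close> bounds the number of vertices of the next graph per
    edge; \<open>card (E m) * rule_size\<close> bounds the number of edges relative to those
    descending from \<open>w\<close>.\<close>
  define a where "a = 2 * (rule_size * (card (E m) * rule_size))"
  have "0 < a" using rule_size_ge_1 w by (auto simp: a_def card_gt_0_iff)
  moreover have "card (V (Suc (m + k))) \<le> a * card {u \<in> V (Suc (m + k)). in_cell w u}" for k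
  proof -
    have "card (V (Suc (m + k))) \<le> 2 * (rule_size * card (E (m + k)))" by (rule card_xi_verts_Suc_le)
    also have "\<dots> \<le> 2 * (rule_size * (card (E m) * (rule_size * word_count k (wcol w))))"
      by (intro mult_le_mono2 card_xi_arcs_le w)
    also have "\<dots> = a * word_count k (wcol w)" by (simp add: a_def)
    also have "\<dots> \<le> a * card {u \<in> V (Suc (m + k)). in_cell w u}" by (intro mult_le_mono2 card_cell_ge w)
    finally show ?thesis .
  qed
  then have "real (card (V (Suc (m + k)))) \<le> real a * real (card {u \<in> V (Suc (m + k)). in_cell w u})" for k
    by (metis of_nat_le_iff of_nat_mult)
  ultimately have "1 / real a * real (card (V (Suc (m + k)))) \<le> real (card {u \<in> V (Suc (m + k)). in_cell w u})" for k
    by (simp add: pos_divide_le_eq mult.commute del: xi_verts.simps)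
  then show ?thesis using \<open>0 < a\<close>
    by (intro exI[of _ "1 / real a"]) (auto simp del: xi_verts.simps)
qed

end

section \<open>Positive mass near every point of the limit space\<close>

locale eigs_limit_measure = eigs_limit S \<iota>
  for S :: "('v, 'e) eigs" and \<iota> :: "('v, 'e) xvertex \<Rightarrow> 'x::complete_space" +
  fixes \<mu> :: "'x measure"
  assumes limit_measure: "is_limit_measure S \<iota> \<mu>"
begin

sublocale prob_space \<mu>
  using limit_measure by (simp add: is_limit_measure_def)

lemma sets_mu [measurable_cong, simp]: "sets \<mu> = sets borel"
  using limit_measure by (simp add: is_limit_measure_def)

lemma space_mu [simp]: "space \<mu> = UNIV"
  using sets_eq_imp_space_eq[OF sets_mu] by simp

lemma average_lim:
  assumes "continuous_on UNIV (f :: 'x \<Rightarrow> real)" "bounded (range f)"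
  shows "(\<lambda>n. (\<Sum>u\<in>V n. f (\<iota> u)) / real (card (V n))) \<longlonglongrightarrow> (LINT x|\<mu>. f x)"
  using limit_measure assms by (simp add: is_limit_measure_def)

lemma continuous_borel_mu:
  fixes g :: "'x \<Rightarrow> real"
  assumes "continuous_on UNIV g"
  shows "g \<in> borel_measurable \<mu>"
  using borel_measurable_continuous_onI[OF assms] by (simp cong: measurable_cong_sets)

lemma small_cell_around:
  assumes u: "u \<in> all_verts S" and "0 < \<epsilon>"
  obtains m w where "w \<in> E m" "in_cell w u" "\<And>u'. in_cell w u' \<Longrightarrow> dist (\<iota> u') (\<iota> u) < \<epsilon>"
proof -
  have "(\<lambda>m. cell_const * (1 / 2) ^ m) \<longlonglongrightarrow> cell_const * 0"
    by (intro tendsto_intros LIMSEQ_realpow_zero) auto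
  then have "\<forall>\<^sub>F m in sequentially. cell_const * (1 / 2) ^ m < \<epsilon>"
    using \<open>0 < \<epsilon>\<close> by (intro order_tendstoD) auto
  then obtain m where m: "cell_const / 2 ^ m < \<epsilon>"
    by (auto simp: eventually_sequentially power_divide)
  obtain w where w: "w \<in> E m" "in_cell w u" using in_cell_exists[OF u] by blast
  show ?thesis
  proof (rule that[OF w])
    fix u' assume "in_cell w u'"
    from dist_cell_le[OF w(1) this w(2)] m show "dist (\<iota> u') (\<iota> u) < \<epsilon>" by linarith
  qed
qed

text \<open>Full support in the form needed for uniqueness of continuous representatives. A nonzero
  value persists on a small cell, whose share of the vertices is bounded below along the graphs;
  this bounds the averages from below, and weak convergence passes the bound to the
  integral.\<close>

lemma continuous_AE_zero:
  fixes g :: "'x \<Rightarrow> real"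
  assumes g: "continuous_on UNIV g" and ae: "AE x in \<mu>. g x = 0"
  shows "g x = 0"
proof (rule ccontr)
  assume "g x \<noteq> 0"
  \<comment> \<open>Truncation gives a bounded test function, as weak convergence demands, and keeps
    the zero set of \<open>g\<close>.\<close>
  define G where "G x = min 1 \<bar>g x\<bar>" for x
  have cont: "continuous_on UNIV G" unfolding G_def by (intro continuous_intros g)
  have G01: "0 \<le> G x" "G x \<le> 1" for x by (auto simp: G_def)
  have "open {x. 0 < G x}" by (rule open_Collect_less[OF continuous_on_const cont])
  moreover have "{x. 0 < G x} \<noteq> {}" using \<open>g x \<noteq> 0\<close> by (auto simp: G_def)
  ultimately obtain u where u: "u \<in> all_verts S" "0 < G (\<iota> u)"
    using iota_dense open_Int_closure_eq_empty[of "{x. 0 < G x}" "\<iota> ` all_verts S"] by auto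
  define \<delta> where "\<delta> = G (\<iota> u) / 2"
  have \<delta>: "0 < \<delta>" "\<delta> < G (\<iota> u)" using u(2) by (auto simp: \<delta>_def)
  have "open {x. \<delta> < G x}" by (rule open_Collect_less[OF continuous_on_const cont])
  then obtain \<epsilon> where "0 < \<epsilon>" and \<epsilon>: "\<And>y. dist y (\<iota> u) < \<epsilon> \<Longrightarrow> \<delta> < G y"
    using \<delta>(2) unfolding open_dist by auto
  obtain m w where w: "w \<in> E m" "in_cell w u" "\<And>u'. in_cell w u' \<Longrightarrow> dist (\<iota> u') (\<iota> u) < \<epsilon>"
    using small_cell_around[OF u(1) \<open>0 < \<epsilon>\<close>] by blast
  obtain c :: real where c: "0 < c"
    "\<And>k. c * card (V (Suc (m + k))) \<le> card {u \<in> V (Suc (m + k)). in_cell w u}"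
    using cell_fraction[OF w(1)] by blast
  have "\<delta> * c \<le> (\<Sum>u\<in>V n. G (\<iota> u)) / real (card (V n))" if n: "n \<ge> Suc m" for n
  proof -
    obtain k where k: "n = Suc (m + k)" using n by (metis Suc_le_D Suc_le_mono le_Suc_ex)
    have V: "0 < real (card (V n))" using Root_plus_in[of n] by (auto simp: card_gt_0_iff)
    have "\<delta> * (c * card (V n)) \<le> \<delta> * card {u \<in> V n. in_cell w u}"
      using c(2)[of k] \<delta>(1) unfolding k by (intro mult_left_mono) (auto simp del: xi_verts.simps)
    also have "\<dots> = (\<Sum>u\<in>{u \<in> V n. in_cell w u}. \<delta>)" by simp
    also have "\<dots> \<le> (\<Sum>u\<in>{u \<in> V n. in_cell w u}. G (\<iota> u))"
      using w(3) \<epsilon> by (intro sum_mono) (auto intro: less_imp_le)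
    also have "\<dots> \<le> (\<Sum>u\<in>V n. G (\<iota> u))" using G01 by (intro sum_mono2) auto
    finally show ?thesis using V by (simp add: pos_le_divide_eq mult.assoc)
  qed
  moreover have "(\<lambda>n. (\<Sum>u\<in>V n. G (\<iota> u)) / real (card (V n))) \<longlonglongrightarrow> (LINT x|\<mu>. G x)"
    using G01 by (intro average_lim cont boundedI[where B = 1]) auto
  ultimately have "\<delta> * c \<le> (LINT x|\<mu>. G x)" using LIMSEQ_le_const by blast
  moreover have "(LINT x|\<mu>. G x) = 0"
    by (rule integral_eq_zero_AE) (use ae in \<open>auto simp: G_def elim!: eventually_mono\<close>)
  ultimately show False using \<delta>(1) c(1) by (simp add: mult_le_0_iff)
qed

lemma continuous_AE_eq:
  fixes f g :: "'x \<Rightarrow> real"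
  assumes "continuous_on UNIV f" "continuous_on UNIV g" "AE x in \<mu>. f x = g x"
  shows "f = g"
proof
  fix x
  have "f x - g x = 0" by (rule continuous_AE_zero) (use assms in \<open>auto intro!: continuous_intros\<close>)
  then show "f x = g x" by simp
qed

end


section \<open>Energies\<close>

locale eigs_energy = eigs_system S for S :: "('v, 'e) eigs" +
  fixes v :: "nat \<Rightarrow> real"
  assumes eigenpair: "Psi_eigenpair S (rho_Psi S) v"
begin

abbreviation "\<rho> \<equiv> rho_Psi S"

lemma rho_pos: "0 < \<rho>" and v_pos: "i < K \<Longrightarrow> 0 < v i" and Psi_v: "i < K \<Longrightarrow> Psi S v i = \<rho> * v i"
  using eigenpair by (auto simp: Psi_eigenpair_def)

section \<open>Energy on a single rule graph\<close>

definition rule_energy :: "nat \<Rightarrow> ('v \<Rightarrow> real) \<Rightarrow> real" where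
  "rule_energy i f = (\<Sum>e\<in>arcs (R i). (f (tail (R i) e) - f (head (R i) e))\<^sup>2 / v (colour i e))"

context
  fixes i assumes i: "i < K"
begin

lemma rule_energy_mono:
  assumes "\<And>e. e \<in> arcs (R i) \<Longrightarrow>
    \<bar>f (tail (R i) e) - f (head (R i) e)\<bar> \<le> \<bar>g (tail (R i) e) - g (head (R i) e)\<bar>"
  shows "rule_energy i f \<le> rule_energy i g"
  unfolding rule_energy_def
  by (intro sum_mono divide_right_mono)
    (use assms v_pos colour_less[OF i] in \<open>auto simp: abs_le_square_iff intro: less_imp_le\<close>)

lemma rule_energy_nonneg: "0 \<le> rule_energy i f"
  unfolding rule_energy_def
  by (intro sum_nonneg divide_nonneg_nonneg) (use v_pos colour_less[OF i] in \<open>auto intro: less_imp_le\<close>)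

lemma rule_energy_affine: "rule_energy i (\<lambda>x. a + c * f x) = c\<^sup>2 * rule_energy i f"
  unfolding rule_energy_def sum_distrib_left
  by (intro sum.cong) (simp_all add: power_mult_distrib flip: right_diff_distrib)

text \<open>Truncation to \<open>[0, 1]\<close> does not increase the energy, so the minimum over a compact cube is global.\<close>

lemma minimal_rule_potential_exists:
  "\<exists>\<phi>. \<phi> (\<beta>p i) = 1 \<and> \<phi> (\<beta>m i) = 0 \<and>
    (\<forall>f. f (\<beta>p i) = 1 \<longrightarrow> f (\<beta>m i) = 0 \<longrightarrow> rule_energy i \<phi> \<le> rule_energy i f)"
proof -
  \<comment> \<open>Potentials are functions on the whole type, so the cube is a possibly infinite
    product and is compact by the theorem of Tychonoff.\<close>
  define C where "C = {f :: 'v \<Rightarrow> real. (\<forall>x. f x \<in> {0..1})} \<inter> {f. f (\<beta>p i) = 1} \<inter> {f. f (\<beta>m i) = 0}"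
  have "compactin (product_topology (\<lambda>_. euclidean) UNIV) (Pi\<^sub>E UNIV (\<lambda>_ :: 'v. {0..1 :: real}))"
    by (subst compactin_PiE) auto
  then have "compact {f :: 'v \<Rightarrow> real. (\<forall>x. f x \<in> {0..1})}"
    by (simp add: euclidean_product_topology PiE_UNIV_domain Pi_def)
  moreover have coord: "continuous_on A (\<lambda>f :: 'v \<Rightarrow> real. f x)" for x A
    by (rule continuous_on_subset[OF continuous_on_product_coordinates]) simp
  then have "closed {f :: 'v \<Rightarrow> real. f (\<beta>p i) = 1}" "closed {f :: 'v \<Rightarrow> real. f (\<beta>m i) = 0}"
    by (intro closed_Collect_eq continuous_on_const coord)+
  ultimately have "compact C" unfolding C_def by (intro compact_Int_closed)
  moreover have "(\<lambda>x. of_bool (x = \<beta>p i)) \<in> C" using beta_neq[OF i] by (auto simp: C_def)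
  then have "C \<noteq> {}" by blast
  moreover have "continuous_on C (rule_energy i)" unfolding rule_energy_def
    by (intro continuous_intros coord) (use v_pos colour_less[OF i] in force)
  ultimately obtain \<phi> where \<phi>: "\<phi> \<in> C" "\<And>f. f \<in> C \<Longrightarrow> rule_energy i \<phi> \<le> rule_energy i f"
    using continuous_attains_inf[of C "rule_energy i"] by blast
  have "rule_energy i \<phi> \<le> rule_energy i f" if "f (\<beta>p i) = 1" "f (\<beta>m i) = 0" for f
  proof -
    have "(\<lambda>x. max 0 (min 1 (f x))) \<in> C" using that by (auto simp: C_def)
    then have "rule_energy i \<phi> \<le> rule_energy i (\<lambda>x. max 0 (min 1 (f x)))" by (rule \<phi>(2))
    also have "\<dots> \<le> rule_energy i f" by (rule rule_energy_mono) auto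
    finally show ?thesis .
  qed
  with \<phi>(1) show ?thesis by (auto simp: C_def)
qed

text \<open>The eigenvector equation says that the effective resistance of rule \<open>i\<close> is
  \<open>\<rho> * v i\<close>, so its reciprocal is the least energy; an affine change of values
  covers all other boundary data.\<close>

lemma harmonic_rule_potential:
  "\<exists>\<phi>. \<phi> (\<beta>p i) = 1 \<and> \<phi> (\<beta>m i) = 0 \<and> rule_energy i \<phi> = 1 / (\<rho> * v i) \<and>
    (\<forall>f. (f (\<beta>p i) - f (\<beta>m i))\<^sup>2 / (\<rho> * v i) \<le> rule_energy i f)"
proof -
  obtain \<phi> where \<phi>: "\<phi> (\<beta>p i) = 1" "\<phi> (\<beta>m i) = 0"
    "\<And>f. f (\<beta>p i) = 1 \<Longrightarrow> f (\<beta>m i) = 0 \<Longrightarrow> rule_energy i \<phi> \<le> rule_energy i f"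
    using minimal_rule_potential_exists by blast
  have "(INF f\<in>{f. f (\<beta>p i) = 1 \<and> f (\<beta>m i) = 0}. rule_energy i f) = rule_energy i \<phi>"
    by (rule cInf_eq_minimum) (use \<phi> in auto)
  then have "1 / rule_energy i \<phi> = \<rho> * v i"
    using Psi_v[OF i] by (simp add: Psi_def eff_resistance_def rule_energy_def)
  then have e: "rule_energy i \<phi> = 1 / (\<rho> * v i)" by (metis div_by_1 divide_divide_eq_right mult_1)
  have "(f (\<beta>p i) - f (\<beta>m i))\<^sup>2 / (\<rho> * v i) \<le> rule_energy i f" for f
  proof (cases "f (\<beta>p i) = f (\<beta>m i)")
    case True
    then show ?thesis using rule_energy_nonneg by simp
  next
    case False
    define d where "d = f (\<beta>p i) - f (\<beta>m i)"
    have d: "d \<noteq> 0" using False by (simp add: d_def)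
    define g where "g x = (f x - f (\<beta>m i)) / d" for x
    have "f = (\<lambda>x. f (\<beta>m i) + d * g x)" using d by (simp add: g_def)
    then have "rule_energy i f = d\<^sup>2 * rule_energy i g" using rule_energy_affine by metis
    moreover have "rule_energy i \<phi> \<le> rule_energy i g" by (rule \<phi>(3)) (use d in \<open>auto simp: g_def d_def\<close>)
    then have "d\<^sup>2 * (1 / (\<rho> * v i)) \<le> d\<^sup>2 * rule_energy i g" unfolding e by (intro mult_left_mono) auto
    ultimately show ?thesis by (simp add: d_def)
  qed
  with \<phi> e show ?thesis by blast
qed

end

section \<open>Energies on the iterated graphs\<close>

abbreviation "En \<equiv> energy S v"

lemma energy_eq: "En n f = (\<Sum>w\<in>E n. \<rho> ^ n / v (wcol w) * (f (src w) - f (tgt w))\<^sup>2)"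
  by (simp add: energy_def)

lemma energy_cong: "(\<And>u. u \<in> V n \<Longrightarrow> f u = g u) \<Longrightarrow> En n f = En n g"
  unfolding energy_eq using ends_in by (intro sum.cong) auto

lemma conductance_nonneg: "w \<in> E n \<Longrightarrow> 0 \<le> \<rho> ^ n / v (wcol w)"
  using rho_pos v_pos[OF col_less] by (simp add: less_imp_le)

lemma energy_nonneg: "0 \<le> En n f"
  unfolding energy_eq by (intro sum_nonneg mult_nonneg_nonneg conductance_nonneg) auto

lemma energy_Suc: "En (Suc n) f = (\<Sum>w\<in>E n. \<rho> ^ Suc n * rule_energy (wcol w) (f \<circ> planted w))"
  unfolding energy_eq sum_xi_arcs_Suc rule_energy_def sum_distrib_left by simp

text \<open>The extra factor \<rho> in the finer conductances compensates exactly for the resistance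
  \<rho> times larger of a planted rule graph.\<close>

lemma energy_le_Suc: "En n f \<le> En (Suc n) f"
  unfolding energy_Suc energy_eq[of n]
proof (rule sum_mono)
  fix w assume w: "w \<in> E n"
  have "((f \<circ> planted w) (\<beta>p (wcol w)) - (f \<circ> planted w) (\<beta>m (wcol w)))\<^sup>2 / (\<rho> * v (wcol w))
      \<le> rule_energy (wcol w) (f \<circ> planted w)"
    using harmonic_rule_potential[OF col_less[OF w]] by blast
  then have "\<rho> ^ Suc n * ((f (src w) - f (tgt w))\<^sup>2 / (\<rho> * v (wcol w)))
      \<le> \<rho> ^ Suc n * rule_energy (wcol w) (f \<circ> planted w)"
    using rho_pos by (intro mult_left_mono) (auto simp: planted_beta_minus[OF w])
  then show "\<rho> ^ n / v (wcol w) * (f (src w) - f (tgt w))\<^sup>2 \<le> \<rho> ^ Suc n * rule_energy (wcol w) (f \<circ> planted w)"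
    using rho_pos by simp
qed

lemma energy_mono: "m \<le> n \<Longrightarrow> En m f \<le> En n f"
  by (rule lift_Suc_mono_le[of "\<lambda>n. En n f"]) (rule energy_le_Suc)

text \<open>Planting the harmonic rule potentials turns the inequality of
  \<open>energy_le_Suc\<close> into an equality in each cell, and one function does this at all
  levels.\<close>

lemma harmonic_extension:
  "\<exists>F. (\<forall>u\<in>V m. F u = h u) \<and> (\<forall>n\<ge>m. En n F = En m h)"
proof -
  have "\<forall>i. \<exists>\<phi>. i < K \<longrightarrow> \<phi> (\<beta>p i) = 1 \<and> \<phi> (\<beta>m i) = 0 \<and> rule_energy i \<phi> = 1 / (\<rho> * v i)"
    using harmonic_rule_potential by blast
  then obtain \<phi> :: "nat \<Rightarrow> 'v \<Rightarrow> real" where \<phi>: "\<And>i. i < K \<Longrightarrow> \<phi> i (\<beta>p i) = 1" "\<And>i. i < K \<Longrightarrow> \<phi> i (\<beta>m i) = 0"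
    "\<And>i. i < K \<Longrightarrow> rule_energy i (\<phi> i) = 1 / (\<rho> * v i)" by metis
  from self_similar_extension[of "\<lambda>_. \<phi>", OF \<phi>(1,2)] obtain F where F: "\<And>u. u \<in> V m \<Longrightarrow> F u = h u"
    "\<And>n w x. m \<le> n \<Longrightarrow> w \<in> E n \<Longrightarrow> x \<in> verts (R (wcol w)) \<Longrightarrow>
      F (planted w x) = F (tgt w) + (F (src w) - F (tgt w)) * \<phi> (wcol w) x" by metis
  have "En n F = En m h" if "m \<le> n" for n
    using that
  proof (induct n rule: dec_induct)
    case base
    show ?case by (rule energy_cong) (rule F(1))
  next
    case (step n)
    have "En (Suc n) F = En n F" unfolding energy_Suc energy_eq[of n]
    proof (rule sum.cong)
      fix w assume w: "w \<in> E n"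
      note i = col_less[OF w]
      have "rule_energy (wcol w) (F \<circ> planted w) =
        rule_energy (wcol w) (\<lambda>x. F (tgt w) + (F (src w) - F (tgt w)) * \<phi> (wcol w) x)"
        unfolding rule_energy_def using F(2)[OF step(1) w] rule_tail_head[OF i] by (intro sum.cong) auto
      also have "\<dots> = (F (src w) - F (tgt w))\<^sup>2 * (1 / (\<rho> * v (wcol w)))"
        by (simp only: rule_energy_affine[OF i] \<phi>(3)[OF i])
      finally show "\<rho> ^ Suc n * rule_energy (wcol w) (F \<circ> planted w) =
          \<rho> ^ n / v (wcol w) * (F (src w) - F (tgt w))\<^sup>2" using rho_pos by simp
    qed simp
    with step show ?case by simp
  qed
  with F(1) show ?thesis by blast
qed

lemma parallelogram:
  "En n (\<lambda>x. f x + g x) + En n (\<lambda>x. f x - g x) = 2 * En n f + 2 * En n g"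
  unfolding energy_eq sum_distrib_left sum.distrib[symmetric]
  by (intro sum.cong) (auto simp: power2_eq_square algebra_simps)

lemma energy_scale: "En n (\<lambda>x. c * f x) = c\<^sup>2 * En n f"
  unfolding energy_eq sum_distrib_left
  by (intro sum.cong) (auto simp: power_mult_distrib mult.assoc mult.left_commute simp flip: right_diff_distrib)

lemma energy_commute: "En n (\<lambda>x. f x - g x) = En n (\<lambda>x. g x - f x)"
  unfolding energy_eq by (intro sum.cong) (auto simp: power2_eq_square algebra_simps)

lemma energy_diff_le: "En n (\<lambda>x. f x - g x) \<le> 2 * En n f + 2 * En n g"
  using parallelogram[of n f g] energy_nonneg[of n "\<lambda>x. f x + g x"] by linarith

text \<open>The square root of the energy is a Euclidean norm of the weighted differences along
  edges, so this is the Minkowski inequality.\<close>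

lemma sqrt_energy_triangle: "sqrt (En n f) \<le> sqrt (En n g) + sqrt (En n (\<lambda>x. f x - g x))"
proof -
  let ?c = "\<lambda>f w. sqrt (\<rho> ^ n / v (wcol w)) * (f (src w) - f (tgt w))"
  have *: "sqrt (En n f) = L2_set (?c f) (E n)" for f :: "('v, 'e) xvertex \<Rightarrow> real"
    unfolding L2_set_def energy_eq
    by (intro arg_cong[where f = sqrt] sum.cong) (simp_all only: power_mult_distrib real_sqrt_pow2 conductance_nonneg)
  have "L2_set (?c f) (E n) = L2_set (\<lambda>w. ?c g w + ?c (\<lambda>x. f x - g x) w) (E n)"
    by (intro L2_set_cong) (auto simp: algebra_simps)
  also have "\<dots> \<le> L2_set (?c g) (E n) + L2_set (?c (\<lambda>x. f x - g x)) (E n)" by (rule L2_set_triangle_ineq)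
  finally show ?thesis unfolding * .
qed

section \<open>Oscillation of functions of bounded energy\<close>

definition bounded_energy :: "real \<Rightarrow> (('v, 'e) xvertex \<Rightarrow> real) \<Rightarrow> bool" where
  "bounded_energy B f \<longleftrightarrow> (\<forall>n. En n f \<le> B)"

lemma bounded_energy_nonneg: "bounded_energy B f \<Longrightarrow> 0 \<le> B"
  by (meson bounded_energy_def energy_nonneg order_trans)

lemma sum_v_nonneg: "0 \<le> (\<Sum>j<K. v j)"
  by (intro sum_nonneg) (auto intro: less_imp_le v_pos)

text \<open>The value of a geometric series with ratio \<open>1 / sqrt \<rho>\<close>, times
  \<open>rule_size\<close> for the chaining in a cell; the sum of all \<open>v j\<close> replaces
  the resistance of the colour at hand.\<close>

definition osc_const :: real where
  "osc_const = rule_size * (sqrt (\<Sum>j<K. v j) / (1 - 1 / sqrt \<rho>))"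

text \<open>A single summand of the level \<open>n\<close> energy already bounds the difference
  across its edge.\<close>

lemma arc_oscillation:
  assumes f: "bounded_energy B f" and w: "w \<in> E n"
  shows "\<bar>f (src w) - f (tgt w)\<bar> \<le> sqrt (\<Sum>j<K. v j) * sqrt B * (1 / sqrt \<rho>) ^ n"
proof -
  note i = col_less[OF w]
  have "\<rho> ^ n / v (wcol w) * (f (src w) - f (tgt w))\<^sup>2 \<le> En n f"
    unfolding energy_eq by (rule member_le_sum[OF w], intro mult_nonneg_nonneg conductance_nonneg) auto
  also have "\<dots> \<le> B" using f by (simp add: bounded_energy_def)
  finally have "(f (src w) - f (tgt w))\<^sup>2 \<le> v (wcol w) * B / \<rho> ^ n"
    using rho_pos v_pos[OF i] by (simp add: field_simps)
  also have "\<dots> \<le> (\<Sum>j<K. v j) * B / \<rho> ^ n"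
    using rho_pos bounded_energy_nonneg[OF f] i v_pos
    by (intro divide_right_mono mult_right_mono member_le_sum) (auto intro: less_imp_le)
  finally have "\<bar>f (src w) - f (tgt w)\<bar> \<le> sqrt ((\<Sum>j<K. v j) * B / \<rho> ^ n)"
    by (metis real_sqrt_abs real_sqrt_le_iff)
  also have "\<dots> = sqrt (\<Sum>j<K. v j) * sqrt B * (1 / sqrt \<rho>) ^ n"
    by (simp add: real_sqrt_mult real_sqrt_divide real_sqrt_power power_divide)
  finally show ?thesis .
qed

context
  assumes rho_gt_1: "1 < \<rho>"
begin

text \<open>Chaining with a geometric bound on arcs. The series converges because
  \<open>1 < \<rho>\<close>, so the depth at which \<open>u\<close> appears in the cell does not
  matter.\<close>

lemma cell_energy_oscillation:
  assumes f: "bounded_energy B f" and w: "w \<in> E m" and u: "in_cell w u"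
  shows "\<bar>f u - f (src w)\<bar> \<le> osc_const * sqrt B * (1 / sqrt \<rho>) ^ m"
proof -
  let ?q = "1 / sqrt \<rho>" and ?A = "sqrt (\<Sum>j<K. v j) * sqrt B"
  have q: "0 \<le> ?q" "?q < 1" using rho_gt_1 by auto
  have A: "0 \<le> ?A" using bounded_energy_nonneg[OF f] sum_v_nonneg by simp
  obtain z n where z: "z @ w \<in> E n" "u \<in> ends (z @ w)" using u by (auto simp: in_cell_def)
  have "n = m + length z" using xi_arcs_length[OF z(1)] xi_arcs_length[OF w] by simp
  with z have "\<bar>f u - f (src w)\<bar> \<le> rule_size * (\<Sum>k=m..m + length z. ?A * ?q ^ k)"
    by (intro cell_oscillation[of z w]) (use A q in \<open>auto intro!: mult_nonneg_nonneg arc_oscillation[OF f]\<close>)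
  also have "(\<Sum>k=m..m + length z. ?A * ?q ^ k) = ?A * (\<Sum>k=m..m + length z. ?q ^ k)"
    by (simp add: sum_distrib_left)
  also have "(\<Sum>k=m..m + length z. ?q ^ k) \<le> ?q ^ m / (1 - ?q)"
  proof -
    have "(\<Sum>k=m..m + length z. ?q ^ k) = (?q ^ m - ?q ^ Suc (m + length z)) / (1 - ?q)"
      using q by (subst sum_gp) auto
    also have "\<dots> \<le> ?q ^ m / (1 - ?q)" using q by (intro divide_right_mono) auto
    finally show ?thesis .
  qed
  finally have "\<bar>f u - f (src w)\<bar> \<le> rule_size * (?A * (?q ^ m / (1 - ?q)))"
    using A by (auto simp: mult_left_mono)
  then show ?thesis by (simp add: osc_const_def)
qed

end

end


section \<open>The resistance form and harmonic splines\<close>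

locale eigs_forms = eigs_energy S v + eigs_limit_measure S \<iota> \<mu>
  for S :: "('v, 'e) eigs" and v and \<iota> :: "('v, 'e) xvertex \<Rightarrow> 'x::complete_space" and \<mu> +
  assumes rho_gt_1: "1 < rho_Psi S"
begin

text \<open>Vertices closer than \<open>separation m\<close> lie in level \<open>m\<close> cells
  with a common end \<open>p\<close>. The chain \<open>u\<close>, \<open>src w\<close>,
  \<open>p\<close>, \<open>src w'\<close>, \<open>u'\<close> has four steps, whence the factor
  4.\<close>

lemma iota_modulus:
  assumes f: "bounded_energy B f" and "0 < \<epsilon>"
  shows "\<exists>\<delta>>0. \<forall>u\<in>all_verts S. \<forall>u'\<in>all_verts S. dist (\<iota> u) (\<iota> u') < \<delta> \<longrightarrow> \<bar>f u - f u'\<bar> < \<epsilon>"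
proof -
  let ?s = "\<lambda>m. osc_const * sqrt B * (1 / sqrt \<rho>) ^ m"
  have "(\<lambda>m. 4 * ?s m) \<longlonglongrightarrow> 4 * (osc_const * sqrt B * 0)"
    using rho_gt_1 by (intro tendsto_intros LIMSEQ_realpow_zero) auto
  then have "\<forall>\<^sub>F m in sequentially. 4 * ?s m < \<epsilon>"
    using \<open>0 < \<epsilon>\<close> by (intro order_tendstoD) auto
  then obtain m where m: "4 * ?s m < \<epsilon>" by (auto simp: eventually_sequentially)
  have "\<bar>f u - f u'\<bar> < \<epsilon>"
    if u: "u \<in> all_verts S" "u' \<in> all_verts S" and d: "dist (\<iota> u) (\<iota> u') < separation m" for u u'
  proof -
    obtain w w' where w: "w \<in> E m" "in_cell w u" "w' \<in> E m" "in_cell w' u'"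
      using in_cell_exists u by meson
    with dist_separated_cells[OF w(1,3,2,4)] d obtain p where p: "p \<in> ends w" "p \<in> ends w'" by fastforce
    have "in_cell w p" "in_cell w' p" using w(1,3) p unfolding in_cell_def by (metis append_Nil)+
    from cell_energy_oscillation[OF rho_gt_1 f w(1) this(1)] cell_energy_oscillation[OF rho_gt_1 f w(3) this(2)]
      cell_energy_oscillation[OF rho_gt_1 f w(1) w(2)] cell_energy_oscillation[OF rho_gt_1 f w(3) w(4)] m
    show ?thesis by linarith
  qed
  with separation_pos show ?thesis by blast
qed

lemma continuous_extension:
  assumes f: "bounded_energy B f"
  shows "\<exists>g. continuous_on UNIV g \<and> (\<forall>u\<in>all_verts S. g (\<iota> u) = f u)"
proof -
  define f' where "f' y = f (inv_into (all_verts S) \<iota> y)" for y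
  have eq: "f' (\<iota> u) = f u" if u: "u \<in> all_verts S" for u
  proof (rule ccontr)
    let ?u = "inv_into (all_verts S) \<iota> (\<iota> u)"
    assume "f' (\<iota> u) \<noteq> f u"
    then have "0 < \<bar>f ?u - f u\<bar>" by (simp add: f'_def)
    from iota_modulus[OF f this] obtain \<delta> where "0 < \<delta>" and
      \<delta>: "\<And>z z'. z \<in> all_verts S \<Longrightarrow> z' \<in> all_verts S \<Longrightarrow> dist (\<iota> z) (\<iota> z') < \<delta> \<Longrightarrow> \<bar>f z - f z'\<bar> < \<bar>f ?u - f u\<bar>"
      by blast
    have "?u \<in> all_verts S" "\<iota> ?u = \<iota> u" using u by (auto intro: inv_into_into f_inv_into_f)
    with \<delta>[of ?u u] u \<open>0 < \<delta>\<close> show False by simp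
  qed
  have "uniformly_continuous_on (\<iota> ` all_verts S) f'" unfolding uniformly_continuous_on_def
  proof (intro allI impI)
    fix \<epsilon> :: real assume "0 < \<epsilon>"
    from iota_modulus[OF f this] obtain \<delta> where "0 < \<delta>" and
      \<delta>: "\<And>z z'. z \<in> all_verts S \<Longrightarrow> z' \<in> all_verts S \<Longrightarrow> dist (\<iota> z) (\<iota> z') < \<delta> \<Longrightarrow> \<bar>f z - f z'\<bar> < \<epsilon>"
      by blast
    then show "\<exists>\<delta>>0. \<forall>x\<in>\<iota> ` all_verts S. \<forall>x'\<in>\<iota> ` all_verts S. dist x' x < \<delta> \<longrightarrow> dist (f' x') (f' x) < \<epsilon>"
      by (intro exI[of _ \<delta>]) (auto simp: eq dist_real_def)
  qed
  then obtain g where "uniformly_continuous_on (closure (\<iota> ` all_verts S)) g"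
    "\<And>x. x \<in> \<iota> ` all_verts S \<Longrightarrow> f' x = g x"
    using uniformly_continuous_on_extension_on_closure by metis
  with eq show ?thesis unfolding iota_dense by (intro exI[of _ g]) (auto intro: uniformly_continuous_imp_continuous)
qed

text \<open>At level 0 the only cell is everything and its source is \<open>Root_plus\<close>;
  density and continuity carry the bound to all points.\<close>

lemma oscillation_bound:
  assumes g: "continuous_on UNIV g" "bounded_energy B (g \<circ> \<iota>)"
  shows "\<bar>g x - g (\<iota> Root_plus)\<bar> \<le> osc_const * sqrt B"
proof -
  let ?A = "{x. \<bar>g x - g (\<iota> Root_plus)\<bar> \<le> osc_const * sqrt B}"
  have "closed ?A" by (intro closed_Collect_le continuous_intros g(1))
  moreover have "\<iota> u \<in> ?A" if u: "u \<in> all_verts S" for u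
  proof -
    obtain w where w: "w \<in> E 0" "in_cell w u" using in_cell_exists[OF u] by blast
    from cell_energy_oscillation[OF rho_gt_1 g(2) w] w(1) show ?thesis by simp
  qed
  ultimately have "closure (\<iota> ` all_verts S) \<subseteq> ?A" by (intro closure_minimal) auto
  then show ?thesis unfolding iota_dense by auto
qed

section \<open>The resistance form and its quadratic inequalities\<close>

abbreviation "\<F> \<equiv> fst (R_form S v \<iota>)"
abbreviation "\<E> \<equiv> snd (R_form S v \<iota>)"

lemma F_iff: "u \<in> \<F> \<longleftrightarrow> continuous_on UNIV u \<and> bdd_above (range (\<lambda>m. En m (u \<circ> \<iota>)))"
  by (simp add: R_form_def vertex_form_def)

lemma F_continuous: "u \<in> \<F> \<Longrightarrow> continuous_on UNIV u"
  by (simp add: F_iff)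

lemma energy_incseq: "incseq (\<lambda>m. En m f)"
  by (simp add: incseq_def energy_mono)

lemma energy_lim:
  assumes "u \<in> \<F>"
  shows "(\<lambda>m. En m (u \<circ> \<iota>)) \<longlonglongrightarrow> \<E> u"
proof -
  have "(\<lambda>m. En m (u \<circ> \<iota>)) \<longlonglongrightarrow> (SUP m. En m (u \<circ> \<iota>))"
    using assms by (intro LIMSEQ_incseq_SUP energy_incseq) (simp add: F_iff)
  then show ?thesis by (simp add: R_form_def vertex_form_def limI)
qed

lemma energy_le_limit: "u \<in> \<F> \<Longrightarrow> En m (u \<circ> \<iota>) \<le> \<E> u"
  by (rule incseq_le[OF energy_incseq energy_lim])

lemma F_bounded_energy: "u \<in> \<F> \<Longrightarrow> bounded_energy (\<E> u) (u \<circ> \<iota>)"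
  by (simp add: bounded_energy_def energy_le_limit)

lemma limit_energy_nonneg: "u \<in> \<F> \<Longrightarrow> 0 \<le> \<E> u"
  using F_bounded_energy bounded_energy_nonneg by blast

lemma F_I: "continuous_on UNIV u \<Longrightarrow> bounded_energy B (u \<circ> \<iota>) \<Longrightarrow> u \<in> \<F>"
  by (auto simp: F_iff bounded_energy_def)

lemma limit_energy_le: "u \<in> \<F> \<Longrightarrow> (\<And>n. En n (u \<circ> \<iota>) \<le> B) \<Longrightarrow> \<E> u \<le> B"
  using LIMSEQ_le_const2[OF energy_lim] by blast

lemma comp_diff: "(\<lambda>x. f x - g x) \<circ> \<iota> = (\<lambda>x. (f \<circ> \<iota>) x - (g \<circ> \<iota>) x)"
  by (simp add: fun_eq_iff)

lemma F_diff:
  assumes "f \<in> \<F>" "g \<in> \<F>"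
  shows "(\<lambda>x. f x - g x) \<in> \<F>" and "\<E> (\<lambda>x. f x - g x) \<le> 2 * \<E> f + 2 * \<E> g"
proof -
  have *: "En n ((\<lambda>x. f x - g x) \<circ> \<iota>) \<le> 2 * \<E> f + 2 * \<E> g" for n
    using energy_diff_le[of n "f \<circ> \<iota>" "g \<circ> \<iota>"] energy_le_limit[OF assms(1), of n]
      energy_le_limit[OF assms(2), of n] unfolding comp_diff by linarith
  show F: "(\<lambda>x. f x - g x) \<in> \<F>"
    by (rule F_I[where B = "2 * \<E> f + 2 * \<E> g"])
      (use * F_continuous assms in \<open>auto simp: bounded_energy_def intro!: continuous_intros\<close>)
  show "\<E> (\<lambda>x. f x - g x) \<le> 2 * \<E> f + 2 * \<E> g" by (rule limit_energy_le[OF F *])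
qed

lemma limit_energy_commute: "\<E> (\<lambda>x. f x - g x) = \<E> (\<lambda>x. g x - f x)"
proof -
  have "(\<lambda>m. En m ((\<lambda>x. f x - g x) \<circ> \<iota>)) = (\<lambda>m. En m ((\<lambda>x. g x - f x) \<circ> \<iota>))"
    unfolding comp_diff by (rule ext, rule energy_commute)
  then show ?thesis by (simp add: R_form_def vertex_form_def)
qed

lemma limit_energy_diff_triangle:
  assumes "f \<in> \<F>" "g \<in> \<F>" "h \<in> \<F>"
  shows "\<E> (\<lambda>x. f x - g x) \<le> 2 * \<E> (\<lambda>x. f x - h x) + 2 * \<E> (\<lambda>x. g x - h x)"
  using F_diff(2)[OF F_diff(1)[OF assms(1,3)] F_diff(1)[OF assms(2,3)]] by simp

lemma sqrt_limit_energy_triangle: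
  assumes "f \<in> \<F>" "g \<in> \<F>"
  shows "sqrt (\<E> f) \<le> sqrt (\<E> g) + sqrt (\<E> (\<lambda>x. f x - g x))"
proof (rule tendsto_le[OF sequentially_bot])
  show "(\<lambda>n. sqrt (En n (f \<circ> \<iota>))) \<longlonglongrightarrow> sqrt (\<E> f)"
    by (intro tendsto_real_sqrt energy_lim assms)
  show "(\<lambda>n. sqrt (En n (g \<circ> \<iota>)) + sqrt (En n ((\<lambda>x. f x - g x) \<circ> \<iota>))) \<longlonglongrightarrow> sqrt (\<E> g) + sqrt (\<E> (\<lambda>x. f x - g x))"
    by (intro tendsto_add tendsto_real_sqrt energy_lim F_diff(1) assms)
  show "\<forall>\<^sub>F n in sequentially. sqrt (En n (f \<circ> \<iota>)) \<le> sqrt (En n (g \<circ> \<iota>)) + sqrt (En n ((\<lambda>x. f x - g x) \<circ> \<iota>))"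
    unfolding comp_diff by (intro always_eventually allI sqrt_energy_triangle)
qed

lemma limit_energy_tendsto:
  assumes F: "\<And>k. F k \<in> \<F>" and u: "u \<in> \<F>" and lim: "(\<lambda>k. \<E> (\<lambda>x. F k x - u x)) \<longlonglongrightarrow> 0"
  shows "(\<lambda>k. \<E> (F k)) \<longlonglongrightarrow> \<E> u"
proof -
  have "(\<lambda>k. sqrt (\<E> (\<lambda>x. F k x - u x))) \<longlonglongrightarrow> sqrt 0" by (intro tendsto_real_sqrt lim)
  then have 0: "(\<lambda>k. sqrt (\<E> (\<lambda>x. F k x - u x))) \<longlonglongrightarrow> 0" by simp
  have "\<bar>sqrt (\<E> (F k)) - sqrt (\<E> u)\<bar> \<le> sqrt (\<E> (\<lambda>x. F k x - u x))" for k
    using sqrt_limit_energy_triangle[OF F u, of k] sqrt_limit_energy_triangle[OF u F, of k]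
      limit_energy_commute[of u "F k"] by simp
  then have "(\<lambda>k. sqrt (\<E> (F k)) - sqrt (\<E> u)) \<longlonglongrightarrow> 0"
    by (intro Lim_null_comparison[OF _ 0] always_eventually) simp
  then have "(\<lambda>k. sqrt (\<E> (F k))) \<longlonglongrightarrow> sqrt (\<E> u)" by (simp add: LIM_zero_iff)
  then have "(\<lambda>k. (sqrt (\<E> (F k)))\<^sup>2) \<longlonglongrightarrow> (sqrt (\<E> u))\<^sup>2" by (intro tendsto_power)
  then show ?thesis using limit_energy_nonneg F u by simp
qed

text \<open>A description without boundary data, by stabilising energies; it puts splines of
  different levels on an equal footing, as differences of splines require.\<close>

definition spline :: "('x \<Rightarrow> real) \<Rightarrow> bool" where
  "spline P \<longleftrightarrow> continuous_on UNIV P \<and> (\<exists>m. \<forall>n\<ge>m. En n (P \<circ> \<iota>) = En m (P \<circ> \<iota>))"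

text \<open>By monotonicity no extension of \<open>h\<close> has energy below \<open>En m h\<close>,
  and \<open>harmonic_extension\<close> attains this value at every level, so minimising means
  preserving the energy.\<close>

lemma is_harmonic_spline_iff:
  "is_harmonic_spline S v \<iota> m h P \<longleftrightarrow> continuous_on UNIV P \<and> (\<forall>u\<in>V m. P (\<iota> u) = h u) \<and>
    (\<forall>n\<ge>m. En n (P \<circ> \<iota>) = En m h)"
proof (cases "\<forall>u\<in>V m. P (\<iota> u) = h u")
  case True
  obtain F where F: "\<forall>u\<in>V m. F u = h u" "\<And>n. n \<ge> m \<Longrightarrow> En n F = En m h" using harmonic_extension by blast
  have min: "En m h \<le> En n g" if "n \<ge> m" "\<forall>u\<in>V m. g u = h u" for n g
    using energy_cong[of m h g] energy_mono[OF that(1), of g] that(2) by simp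
  have "(\<forall>g. (\<forall>u\<in>V m. g u = h u) \<longrightarrow> En n (P \<circ> \<iota>) \<le> En n g) \<longleftrightarrow> En n (P \<circ> \<iota>) = En m h" if n: "n \<ge> m" for n
  proof
    assume "\<forall>g. (\<forall>u\<in>V m. g u = h u) \<longrightarrow> En n (P \<circ> \<iota>) \<le> En n g"
    with F have "En n (P \<circ> \<iota>) \<le> En m h" using n by metis
    with min[OF n, of "P \<circ> \<iota>"] True show "En n (P \<circ> \<iota>) = En m h" by simp
  qed (use min[OF n] in simp)
  then show ?thesis unfolding is_harmonic_spline_def by (auto simp: True)
qed (auto simp: is_harmonic_spline_def)

lemma spline_iff: "spline P \<longleftrightarrow> (\<exists>m h. is_harmonic_spline S v \<iota> m h P)"
proof
  assume "spline P"
  then obtain m where c: "continuous_on UNIV P" and e: "\<forall>n\<ge>m. En n (P \<circ> \<iota>) = En m (P \<circ> \<iota>)"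
    by (auto simp: spline_def)
  have "is_harmonic_spline S v \<iota> m (P \<circ> \<iota>) P"
    by (intro is_harmonic_spline_iff[THEN iffD2] conjI c e) simp
  then show "\<exists>m h. is_harmonic_spline S v \<iota> m h P" by blast
next
  assume "\<exists>m h. is_harmonic_spline S v \<iota> m h P"
  then obtain m h where "continuous_on UNIV P" "\<forall>n\<ge>m. En n (P \<circ> \<iota>) = En m h"
    unfolding is_harmonic_spline_iff by blast
  then show "spline P" unfolding spline_def by (metis order_refl)
qed

lemma spline_in_F:
  assumes "spline P"
  shows "P \<in> \<F>"
proof -
  obtain m where P: "continuous_on UNIV P" "\<And>n. n \<ge> m \<Longrightarrow> En n (P \<circ> \<iota>) = En m (P \<circ> \<iota>)"
    using assms by (auto simp: spline_def)
  have "En n (P \<circ> \<iota>) \<le> En m (P \<circ> \<iota>)" for n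
    using P(2)[of "max m n"] energy_mono[of n "max m n" "P \<circ> \<iota>"] by simp
  with P(1) show ?thesis by (intro F_I) (auto simp: bounded_energy_def)
qed

lemma limit_energy_eqI:
  assumes "u \<in> \<F>" "\<And>n. n \<ge> m \<Longrightarrow> En n (u \<circ> \<iota>) = e"
  shows "\<E> u = e"
  by (rule LIMSEQ_unique[OF energy_lim[OF assms(1)]], rule tendsto_eventually)
    (use assms(2) in \<open>auto simp: eventually_sequentially\<close>)

text \<open>The definite description in \<open>spline_form\<close> is harmless: every pair
  \<open>m\<close>, \<open>h\<close> representing \<open>P\<close> has the limit energy of
  \<open>P\<close>.\<close>

lemma spline_form_simps:
  "fst (spline_form S v \<iota>) = {P. spline P}"
  "spline P \<Longrightarrow> snd (spline_form S v \<iota>) P = \<E> P"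
proof -
  show "fst (spline_form S v \<iota>) = {P. spline P}" by (simp add: spline_form_def spline_iff)
  assume P: "spline P"
  have e: "En m h = \<E> P" if "is_harmonic_spline S v \<iota> m h P" for m h
    using limit_energy_eqI[OF spline_in_F[OF P]] that by (metis is_harmonic_spline_iff)
  from P obtain m h where "is_harmonic_spline S v \<iota> m h P" by (auto simp: spline_iff)
  then show "snd (spline_form S v \<iota>) P = \<E> P"
    unfolding spline_form_def snd_conv using e by (intro the_equality) (metis, metis)
qed

text \<open>By the parallelogram law, the excess energies of \<open>P + Q\<close> and \<open>P - Q\<close> over their level \<open>m\<close>
  energies add up to 0, so both vanish.\<close>

lemma spline_diff:
  assumes P: "spline P" and Q: "spline Q"
  shows "spline (\<lambda>x. P x - Q x)"
proof -
  obtain m where m: "\<And>n. n \<ge> m \<Longrightarrow> En n (P \<circ> \<iota>) = En m (P \<circ> \<iota>)" using P by (auto simp: spline_def)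
  obtain m' where m': "\<And>n. n \<ge> m' \<Longrightarrow> En n (Q \<circ> \<iota>) = En m' (Q \<circ> \<iota>)" using Q by (auto simp: spline_def)
  define M where "M = max m m'"
  have "En n ((\<lambda>x. P x - Q x) \<circ> \<iota>) = En M ((\<lambda>x. P x - Q x) \<circ> \<iota>)" if n: "n \<ge> M" for n
  proof -
    have "En n (P \<circ> \<iota>) = En M (P \<circ> \<iota>)" "En n (Q \<circ> \<iota>) = En M (Q \<circ> \<iota>)"
      using n m[of n] m[of M] m'[of n] m'[of M] by (auto simp: M_def)
    with parallelogram[of n "P \<circ> \<iota>" "Q \<circ> \<iota>"] parallelogram[of M "P \<circ> \<iota>" "Q \<circ> \<iota>"]
      energy_mono[OF n, of "\<lambda>x. (P \<circ> \<iota>) x + (Q \<circ> \<iota>) x"] energy_mono[OF n, of "\<lambda>x. (P \<circ> \<iota>) x - (Q \<circ> \<iota>) x"]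
    show ?thesis unfolding comp_diff by linarith
  qed
  with P Q show ?thesis by (auto simp: spline_def intro!: continuous_intros)
qed

text \<open>\<open>P\<close> extends the level \<open>m\<close> values of \<open>u\<close>
  harmonically. There \<open>P + u\<close> equals \<open>2 * u\<close>, so its energy is at least
  four times the level \<open>m\<close> energy of \<open>u\<close>, and the parallelogram law leaves
  at most twice the missing energy for \<open>P - u\<close>.\<close>

lemma spline_interpolation:
  assumes u: "u \<in> \<F>"
  obtains P where "spline P" "\<And>y. y \<in> V m \<Longrightarrow> P (\<iota> y) = u (\<iota> y)"
    "\<E> (\<lambda>x. P x - u x) \<le> 2 * (\<E> u - En m (u \<circ> \<iota>))"
proof -
  obtain F where F: "\<And>y. y \<in> V m \<Longrightarrow> F y = (u \<circ> \<iota>) y" "\<And>n. n \<ge> m \<Longrightarrow> En n F = En m (u \<circ> \<iota>)"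
    using harmonic_extension by metis
  have "En n F \<le> En m (u \<circ> \<iota>)" for n using F(2)[of "max m n"] energy_mono[of n "max m n" F] by simp
  then have "bounded_energy (En m (u \<circ> \<iota>)) F" by (simp add: bounded_energy_def)
  from continuous_extension[OF this] obtain P where P: "continuous_on UNIV P" "\<And>y. y \<in> all_verts S \<Longrightarrow> P (\<iota> y) = F y"
    by blast
  have PE: "En n (P \<circ> \<iota>) = En m (u \<circ> \<iota>)" if "n \<ge> m" for n
    using F(2)[OF that] P(2) by (subst energy_cong[of n _ F]) (auto simp: all_verts_def)
  then have sp: "spline P" using P(1) unfolding spline_def by (metis order_refl)
  have Pu: "P (\<iota> y) = u (\<iota> y)" if "y \<in> V m" for y using P(2)[of y] F(1)[OF that] that by (auto simp: all_verts_def)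
  have "En n ((\<lambda>x. P x - u x) \<circ> \<iota>) \<le> 2 * (\<E> u - En m (u \<circ> \<iota>))" for n
  proof -
    define N where "N = max m n"
    have "4 * En m (u \<circ> \<iota>) = En m (\<lambda>x. 2 * (u \<circ> \<iota>) x)" by (subst energy_scale) simp
    also have "\<dots> = En m (\<lambda>x. (P \<circ> \<iota>) x + (u \<circ> \<iota>) x)" by (rule energy_cong) (simp add: Pu)
    also have "\<dots> \<le> En N (\<lambda>x. (P \<circ> \<iota>) x + (u \<circ> \<iota>) x)" by (rule energy_mono) (simp add: N_def)
    finally have lower: "4 * En m (u \<circ> \<iota>) \<le> En N (\<lambda>x. (P \<circ> \<iota>) x + (u \<circ> \<iota>) x)" .
    have EnP: "En N (P \<circ> \<iota>) = En m (u \<circ> \<iota>)" by (rule PE) (simp add: N_def)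
    have arith: "a \<le> 2 * (e - b)" if "4 * b \<le> s" "p = b" "s + a = 2 * p + 2 * q" "q \<le> e"
      for a b e p q s :: real using that by (simp add: algebra_simps)
    have "En N (\<lambda>x. (P \<circ> \<iota>) x - (u \<circ> \<iota>) x) \<le> 2 * (\<E> u - En m (u \<circ> \<iota>))"
      by (rule arith[OF lower EnP parallelogram energy_le_limit[OF u]])
    with energy_mono[of n N "\<lambda>x. (P \<circ> \<iota>) x - (u \<circ> \<iota>) x"] show ?thesis unfolding comp_diff by (simp add: N_def)
  qed
  then have "\<E> (\<lambda>x. P x - u x) \<le> 2 * (\<E> u - En m (u \<circ> \<iota>))"
    by (intro limit_energy_le F_diff(1) spline_in_F sp u)
  with sp Pu show ?thesis using that by blast
qed

end


section \<open>Coincidence of the two forms\<close>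

context eigs_forms
begin

section \<open>Square integrable functions and closure sequences\<close>

lemma L2_diff_integrable:
  assumes "f \<in> L2 \<mu>" "g \<in> L2 \<mu>"
  shows "integrable \<mu> (\<lambda>x. (f x - g x)\<^sup>2)"
proof (rule Bochner_Integration.integrable_bound)
  show "integrable \<mu> (\<lambda>x. 2 * (f x)\<^sup>2 + 2 * (g x)\<^sup>2)" using assms by (auto simp: L2_def)
  show "(\<lambda>x. (f x - g x)\<^sup>2) \<in> borel_measurable \<mu>" using assms by (auto simp: L2_def)
  have "(a - b)\<^sup>2 \<le> 2 * a\<^sup>2 + 2 * b\<^sup>2" for a b :: real
    using zero_le_power2[of "a + b"] by (simp add: power2_eq_square algebra_simps)
  then show "AE x in \<mu>. norm ((f x - g x)\<^sup>2) \<le> norm (2 * (f x)\<^sup>2 + 2 * (g x)\<^sup>2)" by simp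
qed

lemma L2_diff_triangle:
  assumes "f \<in> L2 \<mu>" "g \<in> L2 \<mu>" "h \<in> L2 \<mu>"
  shows "(LINT x|\<mu>. (f x - g x)\<^sup>2) \<le> 2 * (LINT x|\<mu>. (f x - h x)\<^sup>2) + 2 * (LINT x|\<mu>. (g x - h x)\<^sup>2)"
proof -
  have "(a - b)\<^sup>2 \<le> 2 * (a - c)\<^sup>2 + 2 * (b - c)\<^sup>2" for a b c :: real
    using zero_le_power2[of "(a - c) + (b - c)"] by (simp add: power2_eq_square algebra_simps)
  then have "(LINT x|\<mu>. (f x - g x)\<^sup>2) \<le> (LINT x|\<mu>. 2 * (f x - h x)\<^sup>2 + 2 * (g x - h x)\<^sup>2)"
    by (intro integral_mono) (auto intro!: L2_diff_integrable assms)
  also have "\<dots> = 2 * (LINT x|\<mu>. (f x - h x)\<^sup>2) + 2 * (LINT x|\<mu>. (g x - h x)\<^sup>2)"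
    by (subst Bochner_Integration.integral_add) (auto intro!: L2_diff_integrable assms)
  finally show ?thesis .
qed

lemma bounded_continuous_L2:
  fixes u :: "'x \<Rightarrow> real"
  assumes "continuous_on UNIV u" "\<And>x. \<bar>u x\<bar> \<le> B"
  shows "u \<in> L2 \<mu>"
proof -
  have "u \<in> borel_measurable \<mu>" by (rule continuous_borel_mu) fact
  moreover have "(u x)\<^sup>2 \<le> B\<^sup>2" for x using assms(2)[of x] by (intro abs_le_square_iff[THEN iffD1]) simp
  ultimately show ?thesis unfolding L2_def by (auto intro!: integrable_const_bound[where B = "B\<^sup>2"])
qed

lemma F_L2:
  assumes u: "u \<in> \<F>"
  shows "u \<in> L2 \<mu>"
proof (rule bounded_continuous_L2[OF F_continuous[OF u]])
  fix x
  show "\<bar>u x\<bar> \<le> \<bar>u (\<iota> Root_plus)\<bar> + osc_const * sqrt (\<E> u)"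
    using oscillation_bound[OF F_continuous[OF u] F_bounded_energy[OF u], of x] by linarith
qed

lemma closure_approx_iff:
  "closure_approx \<mu> (spline_form S v \<iota>) F u \<longleftrightarrow> (\<forall>k. spline (F k)) \<and>
    (\<forall>\<epsilon>>0. \<exists>N. \<forall>k\<ge>N. \<forall>l\<ge>N. \<E> (\<lambda>x. F k x - F l x) < \<epsilon>) \<and>
    (\<lambda>k. LINT x|\<mu>. (F k x - u x)\<^sup>2) \<longlonglongrightarrow> 0"
  (is "?L \<longleftrightarrow> ?R")
proof -
  have "(\<forall>k. F k \<in> fst (spline_form S v \<iota>) \<inter> L2 \<mu>) \<longleftrightarrow> (\<forall>k. spline (F k))"
    using F_L2[OF spline_in_F] by (auto simp: spline_form_simps)
  moreover have "snd (spline_form S v \<iota>) (\<lambda>x. F k x - F l x) = \<E> (\<lambda>x. F k x - F l x)"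
    if "\<forall>k. spline (F k)" for k l
    by (intro spline_form_simps spline_diff) (use that in auto)
  ultimately show ?thesis unfolding closure_approx_def by (auto cong: conj_cong)
qed

lemma closure_approx_exists:
  assumes u: "u \<in> \<F>" and f: "f \<in> L2 \<mu>" and ae: "AE x in \<mu>. f x = u x"
  shows "\<exists>F. closure_approx \<mu> (spline_form S v \<iota>) F f"
proof -
  have "\<forall>m. \<exists>P. spline P \<and> (\<forall>y\<in>V m. P (\<iota> y) = u (\<iota> y)) \<and> \<E> (\<lambda>x. P x - u x) \<le> 2 * (\<E> u - En m (u \<circ> \<iota>))"
    using spline_interpolation[OF u] by metis
  from choice[OF this] obtain P where P: "\<And>m. spline (P m)" "\<And>m y. y \<in> V m \<Longrightarrow> P m (\<iota> y) = u (\<iota> y)"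
    "\<And>m. \<E> (\<lambda>x. P m x - u x) \<le> 2 * (\<E> u - En m (u \<circ> \<iota>))" by blast
  note PF = spline_in_F[OF P(1)]
  have DF: "(\<lambda>x. P k x - u x) \<in> \<F>" for k by (rule F_diff(1)[OF PF u])
  have "(\<lambda>m. 2 * (\<E> u - En m (u \<circ> \<iota>))) \<longlonglongrightarrow> 2 * (\<E> u - \<E> u)"
    by (intro tendsto_intros energy_lim u)
  then have upper: "(\<lambda>m. 2 * (\<E> u - En m (u \<circ> \<iota>))) \<longlonglongrightarrow> 0" by simp
  have lim: "(\<lambda>m. \<E> (\<lambda>x. P m x - u x)) \<longlonglongrightarrow> 0"
  proof (rule tendsto_sandwich[OF _ _ tendsto_const upper])
    show "\<forall>\<^sub>F m in sequentially. 0 \<le> \<E> (\<lambda>x. P m x - u x)"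
      by (intro always_eventually allI limit_energy_nonneg DF)
    show "\<forall>\<^sub>F m in sequentially. \<E> (\<lambda>x. P m x - u x) \<le> 2 * (\<E> u - En m (u \<circ> \<iota>))"
      by (intro always_eventually allI P(3))
  qed
  have "\<exists>N. \<forall>k\<ge>N. \<forall>l\<ge>N. \<E> (\<lambda>x. P k x - P l x) < \<epsilon>" if "0 < \<epsilon>" for \<epsilon>
  proof -
    have "\<forall>\<^sub>F m in sequentially. \<E> (\<lambda>x. P m x - u x) < \<epsilon> / 4"
      using lim that by (intro order_tendstoD) auto
    then obtain N where N: "\<And>m. m \<ge> N \<Longrightarrow> \<E> (\<lambda>x. P m x - u x) < \<epsilon> / 4" by (auto simp: eventually_sequentially)
    have "\<E> (\<lambda>x. P k x - P l x) < \<epsilon>" if "k \<ge> N" "l \<ge> N" for k l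
      using limit_energy_diff_triangle[OF PF[of k] PF[of l] u] N[OF that(1)] N[OF that(2)] by linarith
    then show ?thesis by blast
  qed
  moreover have "(\<lambda>k. LINT x|\<mu>. (P k x - f x)\<^sup>2) \<longlonglongrightarrow> 0"
  proof (rule tendsto_sandwich[OF _ _ tendsto_const])
    show "\<forall>\<^sub>F k in sequentially. (LINT x|\<mu>. (P k x - f x)\<^sup>2) \<le> osc_const\<^sup>2 * \<E> (\<lambda>x. P k x - u x)"
    proof (intro always_eventually allI)
      fix k
      have [measurable]: "P k \<in> borel_measurable \<mu>" "u \<in> borel_measurable \<mu>" "f \<in> borel_measurable \<mu>"
        using F_L2[OF PF[of k]] F_L2[OF u] f by (auto simp: L2_def)
      have "(LINT x|\<mu>. (P k x - f x)\<^sup>2) = (LINT x|\<mu>. (P k x - u x)\<^sup>2)"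
        using ae by (intro integral_cong_AE) (auto elim!: eventually_mono)
      also have "\<dots> \<le> (LINT x|\<mu>. osc_const\<^sup>2 * \<E> (\<lambda>x. P k x - u x))"
      proof (intro integral_mono L2_diff_integrable F_L2 PF u)
        fix x
        \<comment> \<open>Agreement at one point removes the additive constant that energies do not
          see, so convergence in energy becomes uniform.\<close>
        have "P k (\<iota> Root_plus) = u (\<iota> Root_plus)" by (rule P(2)[OF Root_plus_in])
        with oscillation_bound[OF F_continuous[OF DF] F_bounded_energy[OF DF[of k]], of x]
        have "\<bar>P k x - u x\<bar> \<le> \<bar>osc_const * sqrt (\<E> (\<lambda>x. P k x - u x))\<bar>" by simp
        then have "(P k x - u x)\<^sup>2 \<le> (osc_const * sqrt (\<E> (\<lambda>x. P k x - u x)))\<^sup>2"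
          by (simp only: abs_le_square_iff)
        then show "(P k x - u x)\<^sup>2 \<le> osc_const\<^sup>2 * \<E> (\<lambda>x. P k x - u x)"
          by (simp add: power_mult_distrib limit_energy_nonneg[OF DF])
      qed simp
      finally show "(LINT x|\<mu>. (P k x - f x)\<^sup>2) \<le> osc_const\<^sup>2 * \<E> (\<lambda>x. P k x - u x)"
        by (simp add: prob_space[unfolded space_mu])
    qed
    have "(\<lambda>k. osc_const\<^sup>2 * \<E> (\<lambda>x. P k x - u x)) \<longlonglongrightarrow> osc_const\<^sup>2 * 0" by (intro tendsto_intros lim)
    then show "(\<lambda>k. osc_const\<^sup>2 * \<E> (\<lambda>x. P k x - u x)) \<longlonglongrightarrow> 0" by simp
  qed auto
  ultimately show ?thesis using P(1) unfolding closure_approx_iff by blast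
qed

text \<open>A Sobolev type embedding, by integrating over \<open>y\<close> the comparison of
  \<open>g x\<close> with \<open>g y\<close>. Each value is within
  \<open>osc_const * sqrt (\<E> g)\<close> of that at the root; squaring twice this gives 4, and
  splitting the square gives 8.\<close>

lemma pointwise_bound:
  assumes g: "g \<in> \<F>"
  shows "(g x)\<^sup>2 \<le> 2 * (LINT y|\<mu>. (g y)\<^sup>2) + 8 * osc_const\<^sup>2 * \<E> g"
proof -
  have int: "integrable \<mu> (\<lambda>y. (g y)\<^sup>2)" using F_L2[OF g] by (simp add: L2_def)
  have "(g x)\<^sup>2 \<le> 2 * (g y)\<^sup>2 + 8 * osc_const\<^sup>2 * \<E> g" for y
  proof -
    note osc = oscillation_bound[OF F_continuous[OF g] F_bounded_energy[OF g]]
    have "\<bar>g x - g y\<bar> \<le> \<bar>2 * (osc_const * sqrt (\<E> g))\<bar>" using osc[of x] osc[of y] by linarith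
    then have "(g x - g y)\<^sup>2 \<le> (2 * (osc_const * sqrt (\<E> g)))\<^sup>2" by (simp only: abs_le_square_iff)
    also have "\<dots> = 4 * osc_const\<^sup>2 * \<E> g" by (simp add: power_mult_distrib limit_energy_nonneg[OF g])
    finally have "(g x - g y)\<^sup>2 \<le> 4 * osc_const\<^sup>2 * \<E> g" .
    moreover have "(g x)\<^sup>2 \<le> 2 * (g y)\<^sup>2 + 2 * (g x - g y)\<^sup>2"
      using zero_le_power2[of "g x - 2 * g y"] by (simp add: power2_eq_square algebra_simps)
    ultimately show ?thesis by linarith
  qed
  then have "(LINT y|\<mu>. (g x)\<^sup>2) \<le> (LINT y|\<mu>. 2 * (g y)\<^sup>2 + 8 * osc_const\<^sup>2 * \<E> g)"
    using int by (intro integral_mono) auto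
  also have "\<dots> = 2 * (LINT y|\<mu>. (g y)\<^sup>2) + 8 * osc_const\<^sup>2 * \<E> g"
    using int by (subst Bochner_Integration.integral_add) (auto simp: prob_space[unfolded space_mu])
  finally show ?thesis by (simp add: prob_space[unfolded space_mu])
qed

text \<open>By \<open>pointwise_bound\<close>, a sequence that is Cauchy in energy and in the mean
  square is uniformly Cauchy. Its continuous limit inherits finite energy and is a representative of
  \<open>f\<close>.\<close>

lemma closure_approx_limit:
  assumes approx: "closure_approx \<mu> (spline_form S v \<iota>) F f" and f: "f \<in> L2 \<mu>"
  shows "\<exists>u\<in>\<F>. (AE x in \<mu>. f x = u x) \<and> (\<lambda>k. \<E> (F k)) \<longlonglongrightarrow> \<E> u"
proof -
  have sp: "\<And>k. spline (F k)" and
    cauchy: "\<And>\<epsilon>. 0 < \<epsilon> \<Longrightarrow> \<exists>N. \<forall>k\<ge>N. \<forall>l\<ge>N. \<E> (\<lambda>x. F k x - F l x) < \<epsilon>" and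
    L2lim: "(\<lambda>k. LINT x|\<mu>. (F k x - f x)\<^sup>2) \<longlonglongrightarrow> 0"
    using approx unfolding closure_approx_iff by blast+
  note FF = spline_in_F[OF sp]
  have DF: "(\<lambda>x. F k x - F l x) \<in> \<F>" for k l by (rule F_diff(1)[OF FF FF])
  define a where "a k = (LINT x|\<mu>. (F k x - f x)\<^sup>2)" for k
  have "uniformly_Cauchy_on UNIV F" unfolding uniformly_Cauchy_on_def
  proof (intro allI impI)
    fix \<epsilon> :: real assume \<epsilon>: "0 < \<epsilon>"
    \<comment> \<open>Chosen so that the bound
      \<open>8 * \<eta> + 8 * osc_const\<^sup>2 * \<eta>\<close> obtained below equals half of
      \<open>\<epsilon>\<^sup>2\<close>.\<close>
    define \<eta> where "\<eta> = \<epsilon>\<^sup>2 / (16 + 16 * osc_const\<^sup>2)"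
    have pos: "0 < 16 + 16 * osc_const\<^sup>2" by (rule add_pos_nonneg) auto
    have \<eta>: "0 < \<eta>" using \<epsilon> pos by (simp add: \<eta>_def)
    obtain N where N: "\<And>k l. k \<ge> N \<Longrightarrow> l \<ge> N \<Longrightarrow> \<E> (\<lambda>x. F k x - F l x) < \<eta>" using cauchy[OF \<eta>] by blast
    have "\<forall>\<^sub>F k in sequentially. a k < \<eta>" using L2lim \<eta> unfolding a_def by (intro order_tendstoD) auto
    then obtain N' where N': "\<And>k. k \<ge> N' \<Longrightarrow> a k < \<eta>" by (auto simp: eventually_sequentially)
    have "dist (F k x) (F l x) < \<epsilon>" if k: "k \<ge> max N N'" "l \<ge> max N N'" for k l x
    proof -
      have "(LINT x|\<mu>. (F k x - F l x)\<^sup>2) \<le> 2 * a k + 2 * a l"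
        unfolding a_def by (intro L2_diff_triangle F_L2 FF f)
      moreover have "8 * osc_const\<^sup>2 * \<E> (\<lambda>x. F k x - F l x) \<le> 8 * osc_const\<^sup>2 * \<eta>"
        using N[of k l] k by (intro mult_left_mono) auto
      ultimately have "(F k x - F l x)\<^sup>2 < 8 * \<eta> + 8 * osc_const\<^sup>2 * \<eta>"
        using pointwise_bound[OF DF[of k l], of x] N'[of k] N'[of l] k by linarith
      also have "\<dots> = \<eta> * (16 + 16 * osc_const\<^sup>2) / 2" by (simp add: algebra_simps)
      also have "\<dots> = \<epsilon>\<^sup>2 / 2" using pos by (simp add: \<eta>_def)
      also have "\<dots> < \<epsilon>\<^sup>2" using \<epsilon> by simp
      finally have "\<bar>F k x - F l x\<bar>\<^sup>2 < \<epsilon>\<^sup>2" by simp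
      then have "\<bar>F k x - F l x\<bar> < \<epsilon>" using \<epsilon> by (intro power2_less_imp_less[of _ \<epsilon>]) auto
      then show ?thesis by (simp add: dist_real_def)
    qed
    then show "\<exists>M. \<forall>x\<in>UNIV. \<forall>m\<ge>M. \<forall>n\<ge>M. dist (F m x) (F n x) < \<epsilon>" by blast
  qed
  then obtain u where u: "uniform_limit UNIV F u sequentially"
    using Cauchy_uniformly_convergent unfolding uniformly_convergent_on_def by blast
  have cont: "continuous_on UNIV u"
    by (rule uniform_limit_theorem[OF _ u]) (auto intro!: always_eventually F_continuous FF)
  have ptw: "(\<lambda>k. F k x) \<longlonglongrightarrow> u x" for x by (rule tendsto_uniform_limitI[OF u]) simp
  \<comment> \<open>A level \<open>n\<close> energy is a finite sum, so pointwise convergence in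
    \<open>l\<close> suffices; the bound is independent of \<open>n\<close> and therefore passes to
    the limit energy.\<close>
  have diff_energy: "En n (\<lambda>x. (F k \<circ> \<iota>) x - (u \<circ> \<iota>) x) \<le> \<epsilon>"
    if N: "\<And>l. l \<ge> N \<Longrightarrow> \<E> (\<lambda>x. F k x - F l x) < \<epsilon>" for N k n \<epsilon>
  proof (rule LIMSEQ_le_const2)
    show "(\<lambda>l. En n (\<lambda>x. (F k \<circ> \<iota>) x - (F l \<circ> \<iota>) x)) \<longlonglongrightarrow> En n (\<lambda>x. (F k \<circ> \<iota>) x - (u \<circ> \<iota>) x)"
      unfolding energy_eq comp_def by (intro tendsto_intros ptw)
    have "En n (\<lambda>x. (F k \<circ> \<iota>) x - (F l \<circ> \<iota>) x) \<le> \<epsilon>" if "l \<ge> N" for l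
      using energy_le_limit[OF DF[of k l], of n] N[OF that] unfolding comp_diff by linarith
    then show "\<exists>N. \<forall>l\<ge>N. En n (\<lambda>x. (F k \<circ> \<iota>) x - (F l \<circ> \<iota>) x) \<le> \<epsilon>" by blast
  qed
  have uF: "u \<in> \<F>"
  proof -
    obtain N where N: "\<And>k l. k \<ge> N \<Longrightarrow> l \<ge> N \<Longrightarrow> \<E> (\<lambda>x. F k x - F l x) < 1" using cauchy[of 1] by auto
    have "En n (u \<circ> \<iota>) \<le> 2 * \<E> (F N) + 2 * 1" for n
    proof -
      have "En n (u \<circ> \<iota>) = En n (\<lambda>x. (F N \<circ> \<iota>) x - ((F N \<circ> \<iota>) x - (u \<circ> \<iota>) x))"
        by (rule energy_cong) simp
      also have "\<dots> \<le> 2 * En n (F N \<circ> \<iota>) + 2 * En n (\<lambda>x. (F N \<circ> \<iota>) x - (u \<circ> \<iota>) x)" by (rule energy_diff_le)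
      also have "\<dots> \<le> 2 * \<E> (F N) + 2 * 1"
        using energy_le_limit[OF FF] diff_energy[OF N[of N]] by (intro add_mono mult_left_mono) auto
      finally show ?thesis .
    qed
    then show ?thesis by (intro F_I[OF cont]) (auto simp: bounded_energy_def)
  qed
  have "(\<lambda>k. \<E> (\<lambda>x. F k x - u x)) \<longlonglongrightarrow> 0"
  proof (rule LIMSEQ_I)
    fix \<epsilon> :: real assume "0 < \<epsilon>"
    then obtain N where N: "\<And>k l. k \<ge> N \<Longrightarrow> l \<ge> N \<Longrightarrow> \<E> (\<lambda>x. F k x - F l x) < \<epsilon> / 2"
      using cauchy[of "\<epsilon> / 2"] by auto
    have "\<E> (\<lambda>x. F k x - u x) \<le> \<epsilon> / 2" if "k \<ge> N" for k
      using diff_energy[OF N[OF that]] by (intro limit_energy_le F_diff(1) FF uF) (simp add: comp_diff)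
    then show "\<exists>N. \<forall>k\<ge>N. norm (\<E> (\<lambda>x. F k x - u x) - 0) < \<epsilon>"
      using \<open>0 < \<epsilon>\<close> limit_energy_nonneg[OF F_diff(1)[OF FF uF]] by (intro exI[of _ N]) fastforce
  qed
  from limit_energy_tendsto[OF FF uF this] have "(\<lambda>k. \<E> (F k)) \<longlonglongrightarrow> \<E> u" .
  moreover have "AE x in \<mu>. f x = u x"
  proof -
    have "(LINT x|\<mu>. (f x - u x)\<^sup>2) \<le> \<epsilon>" if "0 < \<epsilon>" for \<epsilon>
    proof -
      have "\<forall>\<^sub>F k in sequentially. a k < \<epsilon> / 4"
        using L2lim \<open>0 < \<epsilon>\<close> unfolding a_def by (intro order_tendstoD) auto
      moreover have "\<forall>\<^sub>F k in sequentially. \<forall>x\<in>UNIV. dist (F k x) (u x) < sqrt (\<epsilon> / 4)"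
        using u \<open>0 < \<epsilon>\<close> unfolding uniform_limit_iff by auto
      ultimately have "\<forall>\<^sub>F k in sequentially. a k < \<epsilon> / 4 \<and> (\<forall>x. dist (F k x) (u x) < sqrt (\<epsilon> / 4))"
        by eventually_elim simp
      from eventually_happens'[OF sequentially_bot this]
      obtain k where k: "a k < \<epsilon> / 4" "\<And>x. dist (F k x) (u x) < sqrt (\<epsilon> / 4)" by blast
      have "(u x - F k x)\<^sup>2 \<le> \<epsilon> / 4" for x
        using k(2)[of x] \<open>0 < \<epsilon>\<close> by (intro sqrt_ge_absD) (auto simp: dist_real_def)
      then have "(LINT x|\<mu>. (u x - F k x)\<^sup>2) \<le> (LINT x|\<mu>. \<epsilon> / 4)"
        by (intro integral_mono L2_diff_integrable F_L2 FF uF) auto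
      then have "(LINT x|\<mu>. (u x - F k x)\<^sup>2) \<le> \<epsilon> / 4" by (simp add: prob_space[unfolded space_mu])
      moreover have "(LINT x|\<mu>. (f x - F k x)\<^sup>2) = a k" unfolding a_def by (simp add: power2_commute)
      ultimately show ?thesis using L2_diff_triangle[OF f F_L2[OF uF] F_L2[OF FF[of k]]] k(1) by linarith
    qed
    then have "(LINT x|\<mu>. (f x - u x)\<^sup>2) \<le> 0" by (rule field_le_epsilon) simp
    then have "(LINT x|\<mu>. (f x - u x)\<^sup>2) = 0" by (intro antisym) auto
    then have "AE x in \<mu>. (f x - u x)\<^sup>2 = 0"
      using integral_nonneg_eq_0_iff_AE[OF L2_diff_integrable[OF f F_L2[OF uF]]] by simp
    then show ?thesis by simp
  qed
  ultimately show ?thesis using uF by blast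
qed

text \<open>Full support makes the continuous representative unique, so the definite description has
  only one candidate.\<close>

lemma L2_realisation_value:
  assumes u: "u \<in> \<F>" "AE x in \<mu>. f x = u x"
  shows "snd (L2_realisation \<mu> (R_form S v \<iota>)) f = \<E> u"
  unfolding L2_realisation_def snd_conv
proof (rule the_equality)
  fix e assume "\<exists>u\<in>\<F>. (AE x in \<mu>. f x = u x) \<and> e = \<E> u"
  then obtain u' where u': "u' \<in> \<F>" "AE x in \<mu>. f x = u' x" "e = \<E> u'" by blast
  have "AE x in \<mu>. u' x = u x" using u(2) u'(2) by eventually_elim simp
  from continuous_AE_eq[OF F_continuous[OF u'(1)] F_continuous[OF u(1)] this] u'(3) show "e = \<E> u" by simp
qed (use u in blast)

text \<open>All approximating sequences of \<open>f\<close> lead to the same continuous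
  representative and hence to the same limit of energies, which is closability in the form required
  here.\<close>

lemma W_form_value:
  assumes u: "u \<in> \<F>" "AE x in \<mu>. f x = u x" and f: "f \<in> L2 \<mu>"
  shows "snd (W_form S v \<iota> \<mu>) f = \<E> u"
  unfolding W_form_def form_closure_def snd_conv
proof (rule the_equality)
  have lim: "(\<lambda>k. snd (spline_form S v \<iota>) (F k)) \<longlonglongrightarrow> \<E> u"
    if F: "closure_approx \<mu> (spline_form S v \<iota>) F f" for F
  proof -
    obtain u' where u': "u' \<in> \<F>" "AE x in \<mu>. f x = u' x" "(\<lambda>k. \<E> (F k)) \<longlonglongrightarrow> \<E> u'"
      using closure_approx_limit[OF F f] by blast
    have "AE x in \<mu>. u' x = u x" using u(2) u'(2) by eventually_elim simp
    from continuous_AE_eq[OF F_continuous[OF u'(1)] F_continuous[OF u(1)] this] u'(3)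
    have "(\<lambda>k. \<E> (F k)) \<longlonglongrightarrow> \<E> u" by simp
    moreover have "spline (F k)" for k using F by (simp add: closure_approx_iff)
    ultimately show ?thesis by (simp add: spline_form_simps)
  qed
  then show "\<exists>F. closure_approx \<mu> (spline_form S v \<iota>) F f \<and> (\<lambda>k. snd (spline_form S v \<iota>) (F k)) \<longlonglongrightarrow> \<E> u"
    using closure_approx_exists[OF u(1) f u(2)] by blast
  show "e = \<E> u"
    if "\<exists>F. closure_approx \<mu> (spline_form S v \<iota>) F f \<and> (\<lambda>k. snd (spline_form S v \<iota>) (F k)) \<longlonglongrightarrow> e" for e
    using that lim LIMSEQ_unique by blast
qed

lemma forms_coincide_R_W: "forms_coincide (L2_realisation \<mu> (R_form S v \<iota>)) (W_form S v \<iota> \<mu>)"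
  unfolding forms_coincide_def
proof (intro conjI ballI)
  show "fst (L2_realisation \<mu> (R_form S v \<iota>)) = fst (W_form S v \<iota> \<mu>)"
    unfolding L2_realisation_def W_form_def form_closure_def fst_conv
    using closure_approx_exists closure_approx_limit by blast
  fix f assume "f \<in> fst (L2_realisation \<mu> (R_form S v \<iota>))"
  then obtain u where "f \<in> L2 \<mu>" "u \<in> \<F>" "AE x in \<mu>. f x = u x" by (auto simp: L2_realisation_def)
  then show "snd (L2_realisation \<mu> (R_form S v \<iota>)) f = snd (W_form S v \<iota> \<mu>) f"
    by (simp add: L2_realisation_value W_form_value)
qed

end


section \<open>The sign of the resistance dimension\<close>

lemma sum_row_pow_ge:
  fixes D :: "nat mat"
  assumes D: "D \<in> carrier_mat n n" and row: "\<And>i. i < n \<Longrightarrow> 2 \<le> (\<Sum>j<n. D $$ (i, j))" and i: "i < n"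
  shows "2 ^ k \<le> (\<Sum>j<n. (D ^\<^sub>m k) $$ (i, j))"
proof (induct k)
  case 0
  have "(\<Sum>j<n. (1\<^sub>m n :: nat mat) $$ (i, j)) = (\<Sum>j<n. if j = i then 1 else 0)"
    using i by (intro sum.cong) auto
  then show ?case using D i by simp
next
  case (Suc k)
  have Dk: "D ^\<^sub>m k \<in> carrier_mat n n" using D by simp
  have "(\<Sum>j<n. (D ^\<^sub>m Suc k) $$ (i, j)) = (\<Sum>j<n. \<Sum>l<n. (D ^\<^sub>m k) $$ (i, l) * D $$ (l, j))"
    using D Dk i by (intro sum.cong) (auto simp: scalar_prod_def lessThan_atLeast0)
  also have "\<dots> = (\<Sum>l<n. (D ^\<^sub>m k) $$ (i, l) * (\<Sum>j<n. D $$ (l, j)))"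
    by (subst sum.swap) (simp add: sum_distrib_left)
  also have "\<dots> \<ge> (\<Sum>l<n. (D ^\<^sub>m k) $$ (i, l) * 2)" using row by (intro sum_mono mult_le_mono2) auto
  finally show ?case using Suc by (simp flip: sum_distrib_right)
qed

text \<open>With spectral radius at most 1, the Jordan normal form allows only polynomial growth of
  the entries of powers, while row sums of the \<open>k\<close>-th power are at least
  \<open>2 ^ k\<close>.\<close>

lemma spectral_radius_gt_1_if_row_sums:
  fixes D :: "nat mat"
  assumes D: "D \<in> carrier_mat n n" and n: "0 < n" and row: "\<And>i. i < n \<Longrightarrow> 2 \<le> (\<Sum>j<n. D $$ (i, j))"
  shows "1 < spectral_radius (map_mat of_nat D)"
proof (rule ccontr)
  let ?A = "map_mat of_nat D :: complex mat"
  assume "\<not> 1 < spectral_radius ?A"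
  moreover have A: "?A \<in> carrier_mat n n" using D by simp
  ultimately obtain c1 c2 where bound: "\<And>k. norm_bound (?A ^\<^sub>m k) (c1 + c2 * real k ^ (n - 1))"
    using spectral_radius_jnf_norm_bound_le_1_upper_triangular[OF A] by auto
  have le: "2 ^ k \<le> real n * (c1 + c2 * real k ^ (n - 1))" for k
  proof -
    interpret semiring_hom "of_nat :: nat \<Rightarrow> complex" by unfold_locales auto
    have "?A ^\<^sub>m k = map_mat of_nat (D ^\<^sub>m k)" by (rule mat_hom_pow[OF D, symmetric])
    then have entry: "real ((D ^\<^sub>m k) $$ (0, j)) \<le> c1 + c2 * real k ^ (n - 1)" if "j < n" for j
      using bound[of k] that n D by (auto simp: norm_bound_def)
    have "(2 :: real) ^ k = real (2 ^ k)" by simp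
    also have "\<dots> \<le> real (\<Sum>j<n. (D ^\<^sub>m k) $$ (0, j))"
      using sum_row_pow_ge[OF D row n, of k] by (simp only: of_nat_le_iff)
    also have "\<dots> = (\<Sum>j<n. real ((D ^\<^sub>m k) $$ (0, j)))" by simp
    also have "\<dots> \<le> (\<Sum>j<n. c1 + c2 * real k ^ (n - 1))" by (intro sum_mono entry) simp
    finally show ?thesis by simp
  qed
  have "(\<lambda>k. real n * (c1 + c2 * real k ^ (n - 1)) / 2 ^ k) \<longlonglongrightarrow> 0" by real_asymp
  then have "\<forall>\<^sub>F k in sequentially. real n * (c1 + c2 * real k ^ (n - 1)) / 2 ^ k < 1"
    by (intro order_tendstoD) auto
  then obtain k where "real n * (c1 + c2 * real k ^ (n - 1)) / 2 ^ k < 1" by (auto simp: eventually_sequentially)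
  with le[of k] show False by (simp add: field_simps)
qed

context eigs_system
begin

lemma card_arcs_on_planting_path:
  assumes i: "i < K" and p: "p \<in> planting_paths S i"
  shows "2 \<le> card (arcs_on (R i) p)"
proof -
  obtain x y where x: "x \<noteq> \<beta>p i" "x \<noteq> \<beta>m i" "(\<beta>p i, x) \<in> set (vwalk_arcs p)"
    and y: "y \<noteq> \<beta>p i" "(y, \<beta>m i) \<in> set (vwalk_arcs p)"
    using beta_neighbours[OF i p] by metis
  have "set (vwalk_arcs p) \<subseteq> arcs_ends (undir (R i))"
    using p by (auto simp: planting_paths_def simple_paths_def vpath_def vwalk_def)
  then have arc: "\<exists>e\<in>arcs_on (R i) p. {tail (R i) e, head (R i) e} = {a, b}"
    if "(a, b) \<in> set (vwalk_arcs p)" for a b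
    using that by (fastforce simp: arcs_on_def)
  obtain e e' where e: "e \<in> arcs_on (R i) p" "{tail (R i) e, head (R i) e} = {\<beta>p i, x}"
    "e' \<in> arcs_on (R i) p" "{tail (R i) e', head (R i) e'} = {y, \<beta>m i}"
    using arc[OF x(3)] arc[OF y(2)] by blast
  then have "e \<noteq> e'" using x y beta_neq[OF i] by (auto simp: doubleton_eq_iff)
  then have "2 = card {e, e'}" by simp
  also have "\<dots> \<le> card (arcs_on (R i) p)"
    using e i by (intro card_mono) (auto simp: arcs_on_def)
  finally show ?thesis .
qed

text \<open>Summing over colours counts all arcs of the chosen path.\<close>

lemma distance_matrix_row_sum:
  assumes D: "D \<in> distance_matrices S" and i: "i < K"
  shows "2 \<le> (\<Sum>j<K. D $$ (i, j))"
proof -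
  obtain p where p: "p i \<in> planting_paths S i"
    and D: "D = mat K K (\<lambda>(i, j). card {e \<in> arcs_on (R i) (p i). colour i e = j})"
    using D i by (auto simp: distance_matrices_def)
  let ?A = "arcs_on (R i) (p i)"
  have fin: "finite ?A" using i by (auto simp: arcs_on_def)
  have "?A = (\<Union>j<K. {e \<in> ?A. colour i e = j})" using colour_less[OF i] by (auto simp: arcs_on_def)
  then have "card ?A = card (\<Union>j<K. {e \<in> ?A. colour i e = j})" by simp
  also have "\<dots> = (\<Sum>j<K. card {e \<in> ?A. colour i e = j})"
    using fin by (intro card_UN_disjoint) auto
  also have "\<dots> = (\<Sum>j<K. D $$ (i, j))" using i by (intro sum.cong) (auto simp: D)
  finally show ?thesis using card_arcs_on_planting_path[OF i p] by simp
qed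

text \<open>Choices of paths are functions on all of \<open>nat\<close>, but the matrix sees only
  their restriction to colours. Finiteness is what makes \<open>Min\<close> in
  \<open>rho_min\<close> an attained value.\<close>

lemma finite_distance_matrices: "finite (distance_matrices S)"
proof -
  let ?M = "\<lambda>p. mat K K (\<lambda>(i, j). card {e \<in> arcs_on (R i) (p i). colour i e = j})"
  have "planting_paths S i \<subseteq> {p. set p \<subseteq> verts (R i) \<and> distinct p}" for i
    by (auto simp: planting_paths_def simple_paths_def vpath_def vwalk_def)
  then have "finite (planting_paths S i)" if "i < K" for i
    using finite_subset_distinct[OF finite_rule(1)[OF that]] finite_subset by blast
  then have "finite (?M ` Pi\<^sub>E {..<K} (planting_paths S))" by (intro finite_imageI finite_PiE) auto
  moreover have "distance_matrices S \<subseteq> ?M ` Pi\<^sub>E {..<K} (planting_paths S)"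
  proof
    fix D assume "D \<in> distance_matrices S"
    then obtain p where p: "\<forall>i<K. p i \<in> planting_paths S i" "D = ?M p" by (auto simp: distance_matrices_def)
    have "?M p = ?M (restrict p {..<K})" by (intro cong_mat) auto
    with p show "D \<in> ?M ` Pi\<^sub>E {..<K} (planting_paths S)"
      by (intro image_eqI[of _ _ "restrict p {..<K}"]) auto
  qed
  ultimately show ?thesis by (rule rev_finite_subset)
qed

lemma rho_min_gt_1: "1 < rho_min (distance_matrices S)"
proof -
  obtain p where p: "\<And>i. i < K \<Longrightarrow> p i \<in> planting_paths S i" using planting_path_exists by metis
  then have ne: "distance_matrices S \<noteq> {}" unfolding distance_matrices_def by blast
  have "rho_min (distance_matrices S) \<in> (\<lambda>D. spectral_radius (map_mat of_nat D)) ` distance_matrices S"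
    unfolding rho_min_def using finite_distance_matrices ne by (intro Min_in) auto
  then obtain D where D: "D \<in> distance_matrices S"
    "rho_min (distance_matrices S) = spectral_radius (map_mat of_nat D)" by blast
  have "D \<in> carrier_mat K K" using D(1) by (auto simp: distance_matrices_def)
  from spectral_radius_gt_1_if_row_sums[OF this K_pos distance_matrix_row_sum[OF D(1)]] D(2)
  show ?thesis by simp
qed

end

lemma (in eigs_energy) dim_R_pos_iff: "0 < dim_R S \<longleftrightarrow> 1 < rho_Psi S"
  using rho_min_gt_1 rho_pos by (simp add: dim_R_def zero_less_divide_iff)

theorem theorem3p18:
  fixes S :: "('v, 'e) eigs"
    and v :: "nat \<Rightarrow> real"
    and \<iota> :: "('v, 'e) xvertex \<Rightarrow> 'x::complete_space"
    and \<mu> :: "'x measure"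
    and W :: "('w, 'x) mprocess"
  assumes "is_eigs S" and "canonical S" and "distance_positive S" and "degree_primitive S"
    and "Psi_eigenpair S (rho_Psi S) v"
    and "is_limit_space S \<iota>" and "is_limit_measure S \<iota> \<mu>"
  shows "(dim_R S > 0 \<longleftrightarrow> rho_Psi S > 1) \<and>
    (dim_R S > 0 \<longrightarrow>
       forms_coincide (L2_realisation \<mu> (R_form S v \<iota>)) (W_form S v \<iota> \<mu>) \<and>
       (hunt_process_of_form \<mu> (W_form S v \<iota> \<mu>) W
          \<longrightarrow> brownian_motion_of_resistance_form \<mu> (R_form S v \<iota>) W))"
proof -
  interpret eigs_energy S v using assms by unfold_locales
  have "forms_coincide (L2_realisation \<mu> (R_form S v \<iota>)) (W_form S v \<iota> \<mu>)" if "1 < rho_Psi S"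
  proof -
    interpret eigs_forms S v \<iota> \<mu> using assms that by unfold_locales
    show ?thesis by (rule forms_coincide_R_W)
  qed
  \<comment> \<open>The process statement follows since \<open>hunt_process_of_form\<close> refers
    to the form only through \<open>forms_coincide\<close>, which is transitive.\<close>
  then show ?thesis
    by (auto simp: dim_R_pos_iff brownian_motion_of_resistance_form_def hunt_process_of_form_def forms_coincide_def)
qed

end
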